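(* Let $(\mathcal{C},T,\Sigma)$ be a Krull–Schmidt right triangulated category such that whenever $B\xrightarrow{g}C\xrightarrow{h}TA\xrightarrow{-Tf}TB$ is a right triangle (for morphisms $f:A\to B$, $g:B\to C$, $h:C\to TA$), then $A\xrightarrow{f}B\xrightarrow{g}C\xrightarrow{h}TA$ is a right triangle. Let $\mathcal{D}\subseteq\mathcal{Z}$ be subcategories of $\mathcal{C}$ such that $\mathcal{D}$ is factor-through-epic, $\mathcal{Z}$ is extension-closed, and $\mathcal{Z}=\mu(\mathcal{Z};\mathcal{D})$. Then the quotient category $\mathcal{Z}/\mathcal{D}$, equipped with the additive endofunctor $\sigma:\mathcal{Z}/\mathcal{D}\to\mathcal{Z}/\mathcal{D}$ and the class of right triangles in $\mathcal{Z}/\mathcal{D}$ described in the context, is a right triangulated category.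
   Context: Right triangulated category. Let $\mathcal{C}$ be an additive category and $T$ an additive endofunctor of $\mathcal{C}$. A sextuple is a diagram $A\xrightarrow{f}B\xrightarrow{g}C\xrightarrow{h}TA$; a morphism of sextuples from $(A,B,C,f,g,h)$ to $(A',B',C',f',g',h')$ is a triple $(a,b,c)$ with $bf=f'a$, $cg=g'b$, $(Ta)h=h'c$; it is an isomorphism if $a,b,c$ are. A class $\Sigma$ of sextuples, whose elements are called right triangles, is a right triangulation (and $(\mathcal{C},T,\Sigma)$ a right triangulated category with shift functor $T$) if: TR(0) $\Sigma$ is closed under isomorphisms. TR(1) $0\to A\xrightarrow{1}A\to 0$ is a right triangle for every $A$. TR(2) Every morphism $f:A\to B$ extends to a right triangle $A\xrightarrow{f}B\xrightarrow{g}C\xrightarrow{h}TA$. TR(3) If $A\xrightarrow{f}B\xrightarrow{g}C\xrightarrow{h}TA$ is a right triangle, so is $B\xrightarrow{g}C\xrightarrow{h}TA\xrightarrow{-Tf}TB$. TR(4) Given right triangles $(A,B,C,f,g,h)$, $(A',B',C',f',g',h')$ and $a:A\to A'$, $b:B\to B'$ with $bf=f'a$, there is $c:C\to C'$ such that $(a,b,c)$ is a morphism of right triangles. TR(5) (octahedral axiom) Given right triangles $X\xrightarrow{a}Y\xrightarrow{b}Z\xrightarrow{c}TX$, $Y\xrightarrow{d}U\xrightarrow{e}V\xrightarrow{f}TY$, $X\xrightarrow{da}U\xrightarrow{g}W\xrightarrow{h}TX$, there are $l:Z\to W$, $i:W\to V$ with $lb=gd$, $hl=c$, $ig=e$, $fi=(Ta)h$,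 and $Z\xrightarrow{l}W\xrightarrow{i}V\xrightarrow{(Tb)f}TZ$ a right triangle. Conventions. Krull–Schmidt: every object is isomorphic to a finite direct sum of objects with local endomorphism rings. Subcategories are full and closed under isomorphisms, direct sums and direct summands. $\mathcal{Z}$ is extension-closed if for every right triangle $A\to B\to C\to TA$ with $A,C\in\mathcal{Z}$ we have $B\in\mathcal{Z}$. A morphism $f:A\to B$ is $\mathcal{D}$-epic if $\mathrm{Hom}_{\mathcal{C}}(D,A)\to\mathrm{Hom}_{\mathcal{C}}(D,B)$, $u\mapsto fu$, is surjective for all $D\in\mathcal{D}$; it is $\mathcal{D}$-monic if $\mathrm{Hom}_{\mathcal{C}}(B,D)\to\mathrm{Hom}_{\mathcal{C}}(A,D)$, $u\mapsto uf$, is surjective for all $D\in\mathcal{D}$. $f:A\to B$ is a right $\mathcal{D}$-approximation of $B$ if $A\in\mathcal{D}$ and $f$ is $\mathcal{D}$-epic; it is a left $\mathcal{D}$-approximation of $A$ if $B\in\mathcal{D}$ and $f$ is $\mathcal{D}$-monic. For a subcategory $\mathcal{Y}\supseteq\mathcal{D}$, $\mu(\mathcal{Y};\mathcal{D})$ is the subcategory of objects $X\in\mathcal{C}$ such that $X\in\mathcal{D}$ or there is a right triangle $X\xrightarrow{f}D\xrightarrow{g}Y\xrightarrow{h}TX$ with $Y\in\mathcal{Y}$, $D\in\mathcal{D}$, $f$ a left $\mathcal{D}$-approximation and $g$ a right $\mathcal{D}$-approximation. $[\mathcal{D}](X,Y)$ is the subgroup of $\mathrm{Hom}_{\mathcal{C}}(X,Y)$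 of morphisms factoring through an object of $\mathcal{D}$. $\mathcal{D}$ is factor-through-epic if for all objects $X,Y\in\mathcal{C}$, all $n>0$ and all $f\in[T^n\mathcal{D}](TX,TY)$ there is $f'\in[T^{n-1}\mathcal{D}](X,Y)$ with $Tf'=f$. The quotient category $\mathcal{Z}/\mathcal{D}$ has the objects of $\mathcal{Z}$ and morphism groups $\mathrm{Hom}_{\mathcal{Z}}(X,Y)/[\mathcal{D}](X,Y)$; the class of $f$ is denoted $\overline f$. The functor $\sigma$. For each $M\in\mathcal{Z}$ fix a right triangle $M\xrightarrow{\alpha_M}D_M\xrightarrow{\beta_M}\sigma M\xrightarrow{\gamma_M}TM$ with $\sigma M\in\mathcal{Z}$, $D_M\in\mathcal{D}$, $\alpha_M$ a left and $\beta_M$ a right $\mathcal{D}$-approximation (it exists since $\mathcal{Z}=\mu(\mathcal{Z};\mathcal{D})$); for $M\in\mathcal{D}$ take $M\xrightarrow{1}M\to0\to TM$. For $\mu:M\to N$ in $\mathcal{Z}$ choose $g:D_M\to D_N$ and $\mu':\sigma M\to\sigma N$ such that $(\mu,g,\mu')$ is a morphism between the fixed right triangles of $M$ and $N$; put $\sigma(\overline\mu)=\overline{\mu'}$. Right triangles in $\mathcal{Z}/\mathcal{D}$. Let $M\xrightarrow{\mu}N\xrightarrow{\gamma}P\xrightarrow{\varphi}TM$ be a right triangle in $\mathcal{C}$ with $M,N,P\in\mathcal{Z}$ and $\mu$ $\mathcal{D}$-monic. Then there are $n:N\to D_M$ and $\pi:P\to\sigma M$ such that $(1_M,n,\pi)$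 is a morphism of right triangles from it to the fixed right triangle of $M$. This gives the sextuple $M\xrightarrow{\overline\mu}N\xrightarrow{\overline\gamma}P\xrightarrow{\overline\pi}\sigma M$ in $\mathcal{Z}/\mathcal{D}$. The right triangles in $\mathcal{Z}/\mathcal{D}$ are the sextuples (with respect to $\sigma$) isomorphic to sextuples arising this way. *)

theory Defs
  imports "HOL-Algebra.Coset" "HOL-Algebra.Ring"
begin

section \<open>Additive categories\<close>

text \<open>
  A category with a (partial) addition on arrows. Composition and addition are only meaningful
  on composable, respectively parallel, arrows. \<open>g \<cdot> f\<close> is \<open>g\<close> after \<open>f\<close>.
\<close>

record ('o, 'm) precat =
  Obj :: "'o set"
  Arr :: "'m set"
  Dom :: "'m \<Rightarrow> 'o"
  Cod :: "'m \<Rightarrow> 'o"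
  Ident :: "'o \<Rightarrow> 'm"
  Comp :: "'m \<Rightarrow> 'm \<Rightarrow> 'm" (infixl "\<cdot>\<index>" 70)
  Add :: "'m \<Rightarrow> 'm \<Rightarrow> 'm"
  Zero :: "'o \<Rightarrow> 'o \<Rightarrow> 'm"

definition Hom :: "('o, 'm) precat \<Rightarrow> 'o \<Rightarrow> 'o \<Rightarrow> 'm set" where
  "Hom C A B = {f \<in> Arr C. Dom C f = A \<and> Cod C f = B}"

definition hom_group :: "('o, 'm) precat \<Rightarrow> 'o \<Rightarrow> 'o \<Rightarrow> 'm monoid" where
  "hom_group C A B = \<lparr>carrier = Hom C A B, monoid.mult = Add C, one = Zero C A B\<rparr>"

definition Neg :: "('o, 'm) precat \<Rightarrow> 'm \<Rightarrow> 'm" where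
  "Neg C f = inv\<^bsub>hom_group C (Dom C f) (Cod C f)\<^esub> f"

definition End_ring :: "('o, 'm) precat \<Rightarrow> 'o \<Rightarrow> 'm ring" where
  "End_ring C A =
    \<lparr>carrier = Hom C A A, monoid.mult = Comp C, one = Ident C A, zero = Zero C A A, add = Add C\<rparr>"

locale category =
  fixes C :: "('o, 'm) precat" (structure)
  assumes Dom_Obj: "f \<in> Arr C \<Longrightarrow> Dom C f \<in> Obj C"
    and Cod_Obj: "f \<in> Arr C \<Longrightarrow> Cod C f \<in> Obj C"
    and Ident_Hom: "A \<in> Obj C \<Longrightarrow> Ident C A \<in> Hom C A A"
    and Comp_Hom: "\<lbrakk>f \<in> Hom C A B; g \<in> Hom C B D\<rbrakk> \<Longrightarrow> g \<cdot> f \<in> Hom C A D"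
    and Comp_assoc: "\<lbrakk>f \<in> Hom C A B; g \<in> Hom C B D; h \<in> Hom C D E\<rbrakk>
        \<Longrightarrow> (h \<cdot> g) \<cdot> f = h \<cdot> (g \<cdot> f)"
    and Comp_Ident_left: "f \<in> Hom C A B \<Longrightarrow> Ident C B \<cdot> f = f"
    and Comp_Ident_right: "f \<in> Hom C A B \<Longrightarrow> f \<cdot> Ident C A = f"

locale preadditive_category = category +
  assumes hom_comm_group: "\<lbrakk>A \<in> Obj C; B \<in> Obj C\<rbrakk> \<Longrightarrow> comm_group (hom_group C A B)"
    and Comp_Add_left: "\<lbrakk>f \<in> Hom C A B; g \<in> Hom C B D; g' \<in> Hom C B D\<rbrakk>
        \<Longrightarrow> Add C g g' \<cdot> f = Add C (g \<cdot> f) (g' \<cdot> f)"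
    and Comp_Add_right: "\<lbrakk>f \<in> Hom C A B; f' \<in> Hom C A B; g \<in> Hom C B D\<rbrakk>
        \<Longrightarrow> g \<cdot> Add C f f' = Add C (g \<cdot> f) (g \<cdot> f')"

definition is_zero_object :: "('o, 'm) precat \<Rightarrow> 'o \<Rightarrow> bool" where
  "is_zero_object C Z \<longleftrightarrow>
    Z \<in> Obj C \<and> (\<forall>A\<in>Obj C. (\<exists>!f. f \<in> Hom C Z A) \<and> (\<exists>!f. f \<in> Hom C A Z))"

text \<open>
  \<open>S\<close> is a biproduct of \<open>X 0, \<dots>, X (n - 1)\<close>. The empty case \<open>n = 0\<close> says that \<open>S\<close> is a zero
  object. The group operation of \<^const>\<open>hom_group\<close> is the addition of morphisms, so
  \<^const>\<open>finprod\<close> is a sum here.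
\<close>

definition is_direct_sum :: "('o, 'm) precat \<Rightarrow> nat \<Rightarrow> (nat \<Rightarrow> 'o) \<Rightarrow> 'o \<Rightarrow> bool" where
  "is_direct_sum C n X S \<longleftrightarrow>
    S \<in> Obj C \<and> (\<forall>k<n. X k \<in> Obj C) \<and>
    (\<exists>i p. (\<forall>k<n. i k \<in> Hom C (X k) S \<and> p k \<in> Hom C S (X k)) \<and>
      (\<forall>j<n. \<forall>k<n. p j \<cdot>\<^bsub>C\<^esub> i k = (if j = k then Ident C (X k) else Zero C (X k) (X j))) \<and>
      finprod (hom_group C S S) (\<lambda>k. i k \<cdot>\<^bsub>C\<^esub> p k) {..<n} = Ident C S)"

locale additive_category = preadditive_category +
  assumes direct_sum_exists: "(\<And>k. k < n \<Longrightarrow> X k \<in> Obj C) \<Longrightarrow> \<exists>S. is_direct_sum C n X S"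

definition is_iso :: "('o, 'm) precat \<Rightarrow> 'm \<Rightarrow> bool" where
  "is_iso C f \<longleftrightarrow> f \<in> Arr C \<and>
    (\<exists>g \<in> Hom C (Cod C f) (Dom C f).
      g \<cdot>\<^bsub>C\<^esub> f = Ident C (Dom C f) \<and> f \<cdot>\<^bsub>C\<^esub> g = Ident C (Cod C f))"

definition local_ring :: "'m ring \<Rightarrow> bool" where
  "local_ring R \<longleftrightarrow> ring R \<and> \<one>\<^bsub>R\<^esub> \<noteq> \<zero>\<^bsub>R\<^esub> \<and>
    (\<forall>x \<in> carrier R - Units R. \<forall>y \<in> carrier R - Units R. x \<oplus>\<^bsub>R\<^esub> y \<notin> Units R)"

definition Krull_Schmidt :: "('o, 'm) precat \<Rightarrow> bool" where
  "Krull_Schmidt C \<longleftrightarrow>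
    (\<forall>A\<in>Obj C. \<exists>n X. is_direct_sum C n X A \<and> (\<forall>k<n. local_ring (End_ring C (X k))))"

text \<open>
  A full subcategory is given by its class of objects. Closure under the empty direct sum makes
  it contain all zero objects.
\<close>

definition subcategory :: "('o, 'm) precat \<Rightarrow> 'o set \<Rightarrow> bool" where
  "subcategory C \<D> \<longleftrightarrow> \<D> \<subseteq> Obj C \<and>
    (\<forall>A\<in>\<D>. \<forall>B\<in>Obj C. (\<exists>f \<in> Hom C A B. is_iso C f) \<longrightarrow> B \<in> \<D>) \<and>
    (\<forall>n X S. is_direct_sum C n X S \<longrightarrow> (\<forall>k<n. X k \<in> \<D>) \<longrightarrow> S \<in> \<D>) \<and>
    (\<forall>n X S. is_direct_sum C n X S \<longrightarrow> S \<in> \<D> \<longrightarrow> (\<forall>k<n. X k \<in> \<D>))"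


section \<open>Right triangulated categories\<close>

record ('o, 'm) endofunctor =
  omap :: "'o \<Rightarrow> 'o"
  amap :: "'m \<Rightarrow> 'm"

locale additive_endofunctor = additive_category +
  fixes T :: "('o, 'm) endofunctor"
  assumes omap_Obj: "A \<in> Obj C \<Longrightarrow> omap T A \<in> Obj C"
    and amap_Hom: "f \<in> Hom C A B \<Longrightarrow> amap T f \<in> Hom C (omap T A) (omap T B)"
    and amap_Ident: "A \<in> Obj C \<Longrightarrow> amap T (Ident C A) = Ident C (omap T A)"
    and amap_Comp: "\<lbrakk>f \<in> Hom C A B; g \<in> Hom C B D\<rbrakk> \<Longrightarrow> amap T (g \<cdot> f) = amap T g \<cdot> amap T f"
    and amap_Add: "\<lbrakk>f \<in> Hom C A B; f' \<in> Hom C A B\<rbrakk>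
        \<Longrightarrow> amap T (Add C f f') = Add C (amap T f) (amap T f')"

text \<open>The tuple \<open>(A, B, X, f, g, h)\<close> stands for the diagram \<open>A \<rightarrow> B \<rightarrow> X \<rightarrow> TA\<close>.\<close>

type_synonym ('o, 'm) sextuple = "'o \<times> 'o \<times> 'o \<times> 'm \<times> 'm \<times> 'm"

definition sextuples :: "('o, 'm) precat \<Rightarrow> ('o, 'm) endofunctor \<Rightarrow> ('o, 'm) sextuple set" where
  "sextuples C T =
    {(A, B, X, f, g, h). f \<in> Hom C A B \<and> g \<in> Hom C B X \<and> h \<in> Hom C X (omap T A)}"

fun sextuple_morphism :: "('o, 'm) precat \<Rightarrow> ('o, 'm) endofunctor \<Rightarrow>
    ('o, 'm) sextuple \<Rightarrow> ('o, 'm) sextuple \<Rightarrow> 'm \<times> 'm \<times> 'm \<Rightarrow> bool" where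
  "sextuple_morphism C T (A, B, X, f, g, h) (A', B', X', f', g', h') (a, b, c) \<longleftrightarrow>
    a \<in> Hom C A A' \<and> b \<in> Hom C B B' \<and> c \<in> Hom C X X' \<and>
    b \<cdot>\<^bsub>C\<^esub> f = f' \<cdot>\<^bsub>C\<^esub> a \<and> c \<cdot>\<^bsub>C\<^esub> g = g' \<cdot>\<^bsub>C\<^esub> b \<and> amap T a \<cdot>\<^bsub>C\<^esub> h = h' \<cdot>\<^bsub>C\<^esub> c"

definition sextuple_isomorphic :: "('o, 'm) precat \<Rightarrow> ('o, 'm) endofunctor \<Rightarrow>
    ('o, 'm) sextuple \<Rightarrow> ('o, 'm) sextuple \<Rightarrow> bool" where
  "sextuple_isomorphic C T s s' \<longleftrightarrow>
    (\<exists>a b c. sextuple_morphism C T s s' (a, b, c) \<and> is_iso C a \<and> is_iso C b \<and> is_iso C c)"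

locale right_triangulated = additive_endofunctor +
  fixes \<Sigma> :: "('o, 'm) sextuple set"
  assumes triangles_sextuples: "\<Sigma> \<subseteq> sextuples C T"
    and TR0: "\<lbrakk>s \<in> \<Sigma>; s' \<in> sextuples C T; sextuple_isomorphic C T s s'\<rbrakk> \<Longrightarrow> s' \<in> \<Sigma>"
    and TR1: "\<lbrakk>is_zero_object C Z; A \<in> Obj C\<rbrakk>
        \<Longrightarrow> (Z, A, A, Zero C Z A, Ident C A, Zero C A (omap T Z)) \<in> \<Sigma>"
    and TR2: "f \<in> Hom C A B \<Longrightarrow> \<exists>X g h. (A, B, X, f, g, h) \<in> \<Sigma>"
    and TR3: "(A, B, X, f, g, h) \<in> \<Sigma>
        \<Longrightarrow> (B, X, omap T A, g, h, Neg C (amap T f)) \<in> \<Sigma>"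
    and TR4: "\<lbrakk>(A, B, X, f, g, h) \<in> \<Sigma>; (A', B', X', f', g', h') \<in> \<Sigma>;
          a \<in> Hom C A A'; b \<in> Hom C B B'; b \<cdot> f = f' \<cdot> a\<rbrakk>
        \<Longrightarrow> \<exists>c. sextuple_morphism C T (A, B, X, f, g, h) (A', B', X', f', g', h') (a, b, c)"
    and TR5: "\<lbrakk>(X, Y, Z, a, b, c) \<in> \<Sigma>; (Y, U, V, d, e, f) \<in> \<Sigma>; (X, U, W, d \<cdot> a, g, h) \<in> \<Sigma>\<rbrakk>
        \<Longrightarrow> \<exists>l i. l \<in> Hom C Z W \<and> i \<in> Hom C W V \<and>
              l \<cdot> b = g \<cdot> d \<and> h \<cdot> l = c \<and> i \<cdot> g = e \<and> f \<cdot> i = amap T a \<cdot> h \<and>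
              (Z, W, V, l, i, amap T b \<cdot> f) \<in> \<Sigma>"

definition extension_closed :: "('o, 'm) sextuple set \<Rightarrow> 'o set \<Rightarrow> bool" where
  "extension_closed \<Sigma> \<Z> \<longleftrightarrow>
    (\<forall>A B X f g h. (A, B, X, f, g, h) \<in> \<Sigma> \<and> A \<in> \<Z> \<and> X \<in> \<Z> \<longrightarrow> B \<in> \<Z>)"


section \<open>Approximations\<close>

definition epic_wrt :: "('o, 'm) precat \<Rightarrow> 'o set \<Rightarrow> 'm \<Rightarrow> bool" where
  "epic_wrt C \<D> f \<longleftrightarrow> f \<in> Arr C \<and>
    (\<forall>D\<in>\<D>. (\<lambda>u. f \<cdot>\<^bsub>C\<^esub> u) ` Hom C D (Dom C f) = Hom C D (Cod C f))"

definition monic_wrt :: "('o, 'm) precat \<Rightarrow> 'o set \<Rightarrow> 'm \<Rightarrow> bool" where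
  "monic_wrt C \<D> f \<longleftrightarrow> f \<in> Arr C \<and>
    (\<forall>D\<in>\<D>. (\<lambda>u. u \<cdot>\<^bsub>C\<^esub> f) ` Hom C (Cod C f) D = Hom C (Dom C f) D)"

definition right_approx :: "('o, 'm) precat \<Rightarrow> 'o set \<Rightarrow> 'm \<Rightarrow> bool" where
  "right_approx C \<D> f \<longleftrightarrow> Dom C f \<in> \<D> \<and> epic_wrt C \<D> f"

definition left_approx :: "('o, 'm) precat \<Rightarrow> 'o set \<Rightarrow> 'm \<Rightarrow> bool" where
  "left_approx C \<D> f \<longleftrightarrow> Cod C f \<in> \<D> \<and> monic_wrt C \<D> f"

definition mu :: "('o, 'm) precat \<Rightarrow> ('o, 'm) sextuple set \<Rightarrow> 'o set \<Rightarrow> 'o set \<Rightarrow> 'o set" where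
  "mu C \<Sigma> \<Y> \<D> = {X \<in> Obj C. X \<in> \<D> \<or>
    (\<exists>D Y f g h. (X, D, Y, f, g, h) \<in> \<Sigma> \<and> Y \<in> \<Y> \<and> D \<in> \<D> \<and>
      left_approx C \<D> f \<and> right_approx C \<D> g)}"

definition factoring :: "('o, 'm) precat \<Rightarrow> 'o set \<Rightarrow> 'o \<Rightarrow> 'o \<Rightarrow> 'm set" where
  "factoring C \<D> X Y = {v \<cdot>\<^bsub>C\<^esub> u | u v D. D \<in> \<D> \<and> u \<in> Hom C X D \<and> v \<in> Hom C D Y}"

definition factor_through_epic ::
    "('o, 'm) precat \<Rightarrow> ('o, 'm) endofunctor \<Rightarrow> 'o set \<Rightarrow> bool" where
  "factor_through_epic C T \<D> \<longleftrightarrow>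
    (\<forall>X\<in>Obj C. \<forall>Y\<in>Obj C. \<forall>n>0.
      \<forall>f \<in> factoring C ((omap T ^^ n) ` \<D>) (omap T X) (omap T Y).
        \<exists>f' \<in> factoring C ((omap T ^^ (n - 1)) ` \<D>) X Y. amap T f' = f)"


section \<open>The quotient category\<close>

text \<open>The class of \<open>f : X \<rightarrow> Y\<close> is its coset modulo the subgroup \<^term>\<open>factoring C \<D> X Y\<close>.\<close>

definition cls :: "('o, 'm) precat \<Rightarrow> 'o set \<Rightarrow> 'm \<Rightarrow> 'm set" where
  "cls C \<D> f = factoring C \<D> (Dom C f) (Cod C f) #>\<^bsub>hom_group C (Dom C f) (Cod C f)\<^esub> f"

text \<open>
  The group of morphisms from \<open>X\<close> to \<open>Y\<close> is the factor group
  \<^term>\<open>hom_group C X Y Mod factoring C \<D> X Y\<close>. All members of a class have the same source and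
  target, so the choices in the source and target maps do not matter; likewise the union in the
  composition is over one and the same class.
\<close>

definition quotient_cat :: "('o, 'm) precat \<Rightarrow> 'o set \<Rightarrow> 'o set \<Rightarrow> ('o, 'm set) precat" where
  "quotient_cat C \<Z> \<D> =
    \<lparr>Obj = \<Z>,
     Arr = (\<Union>X\<in>\<Z>. \<Union>Y\<in>\<Z>. carrier (hom_group C X Y Mod factoring C \<D> X Y)),
     Dom = (\<lambda>F. Dom C (SOME f. f \<in> F)),
     Cod = (\<lambda>F. Cod C (SOME f. f \<in> F)),
     Ident = (\<lambda>X. cls C \<D> (Ident C X)),
     Comp = (\<lambda>G F. \<Union>g\<in>G. \<Union>f\<in>F. cls C \<D> (g \<cdot>\<^bsub>C\<^esub> f)),
     Add = (\<lambda>F G. {Add C f g | f g. f \<in> F \<and> g \<in> G}),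
     Zero = (\<lambda>X Y. factoring C \<D> X Y)\<rparr>"

text \<open>
  A choice, for every object \<open>M\<close>, of a diagram \<open>M \<rightarrow> D\<^sub>M \<rightarrow> \<sigma>M \<rightarrow> TM\<close> with morphisms
  \<open>\<alpha>\<^sub>M, \<beta>\<^sub>M, \<gamma>\<^sub>M\<close>.
\<close>

record ('o, 'm) triangle_choice =
  mid :: "'o \<Rightarrow> 'o"
  sig :: "'o \<Rightarrow> 'o"
  alpha :: "'o \<Rightarrow> 'm"
  beta :: "'o \<Rightarrow> 'm"
  gamma :: "'o \<Rightarrow> 'm"

definition fixed_triangle :: "('o, 'm) triangle_choice \<Rightarrow> 'o \<Rightarrow> ('o, 'm) sextuple" where
  "fixed_triangle K M = (M, mid K M, sig K M, alpha K M, beta K M, gamma K M)"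

text \<open>
  In the last clause \<open>\<beta>\<^sub>M\<close> and \<open>\<gamma>\<^sub>M\<close> need not be mentioned: they are maps into and out of a zero
  object.
\<close>

definition fixed_triangles :: "('o, 'm) precat \<Rightarrow> ('o, 'm) sextuple set \<Rightarrow>
    'o set \<Rightarrow> 'o set \<Rightarrow> ('o, 'm) triangle_choice \<Rightarrow> bool" where
  "fixed_triangles C \<Sigma> \<Z> \<D> K \<longleftrightarrow>
    (\<forall>M\<in>\<Z>. fixed_triangle K M \<in> \<Sigma> \<and> sig K M \<in> \<Z> \<and> mid K M \<in> \<D> \<and>
      left_approx C \<D> (alpha K M) \<and> right_approx C \<D> (beta K M) \<and>
      (M \<in> \<D> \<longrightarrow> mid K M = M \<and> alpha K M = Ident C M \<and> is_zero_object C (sig K M)))"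

text \<open>
  On the class of \<open>m : M \<rightarrow> N\<close>, the functor \<open>\<sigma>\<close> takes the class of any \<open>m'\<close> completing some
  \<open>(m, g, m')\<close> to a morphism of the fixed triangles. The union runs over all representatives and
  all completions. It is a single class exactly when the result does not depend on
  these choices, so well-definedness of \<open>\<sigma>\<close> is part of its being a functor.
\<close>

definition sigma_functor :: "('o, 'm) precat \<Rightarrow> ('o, 'm) endofunctor \<Rightarrow> 'o set \<Rightarrow>
    ('o, 'm) triangle_choice \<Rightarrow> ('o, 'm set) endofunctor" where
  "sigma_functor C T \<D> K =
    \<lparr>omap = sig K,
     amap = (\<lambda>F. \<Union>{cls C \<D> m' | m m' g. m \<in> F \<and>
       sextuple_morphism C T
         (fixed_triangle K (Dom C m)) (fixed_triangle K (Cod C m)) (m, g, m')})\<rparr>"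

definition standard_quotient_triangles :: "('o, 'm) precat \<Rightarrow> ('o, 'm) endofunctor \<Rightarrow>
    ('o, 'm) sextuple set \<Rightarrow> 'o set \<Rightarrow> 'o set \<Rightarrow> ('o, 'm) triangle_choice \<Rightarrow>
    ('o, 'm set) sextuple set" where
  "standard_quotient_triangles C T \<Sigma> \<Z> \<D> K =
    {(M, N, P, cls C \<D> m, cls C \<D> c, cls C \<D> p) | M N P m c \<phi> n p.
      (M, N, P, m, c, \<phi>) \<in> \<Sigma> \<and> M \<in> \<Z> \<and> N \<in> \<Z> \<and> P \<in> \<Z> \<and> monic_wrt C \<D> m \<and>
      sextuple_morphism C T (M, N, P, m, c, \<phi>) (fixed_triangle K M) (Ident C M, n, p)}"

definition quotient_triangles :: "('o, 'm) precat \<Rightarrow> ('o, 'm) endofunctor \<Rightarrow>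
    ('o, 'm) sextuple set \<Rightarrow> 'o set \<Rightarrow> 'o set \<Rightarrow> ('o, 'm) triangle_choice \<Rightarrow>
    ('o, 'm set) sextuple set" where
  "quotient_triangles C T \<Sigma> \<Z> \<D> K =
    {s \<in> sextuples (quotient_cat C \<Z> \<D>) (sigma_functor C T \<D> K).
      \<exists>s0 \<in> standard_quotient_triangles C T \<Sigma> \<Z> \<D> K.
        sextuple_isomorphic (quotient_cat C \<Z> \<D>) (sigma_functor C T \<D> K) s0 s}"

end

theory Submission
  imports Defs
begin

text \<open>
  Undoing the rotation of the split triangle \<open>B \<rightarrow> B \<oplus> TA \<rightarrow> TA \<rightarrow> TB\<close> shows that \<open>T\<close> is faithful.
  Since \<open>T\<close> is also full on morphisms into or out of \<open>T\<D>\<close>, the first map of a triangle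
  \<open>A \<rightarrow> B \<rightarrow> X \<rightarrow> TA\<close> is a weak kernel of the second one on test objects in \<open>\<D>\<close>, or on all of them if
  \<open>A \<in> \<D>\<close>. Hence a morphism \<open>u\<close> into \<open>\<sigma>N\<close> is determined modulo \<open>[\<D>]\<close> by \<open>\<gamma>\<^sub>N u\<close>. This makes \<open>\<sigma>\<close> a
  well-defined functor, and it reduces every identity in \<open>\<Z>/\<D>\<close> that ends in \<open>\<sigma>N\<close> to one in \<open>\<C>\<close>.
  The axioms are then lifted from \<open>\<C>\<close>, after replacing a morphism \<open>M \<rightarrow> N\<close> by the \<open>\<D>\<close>-monic
  \<open>M \<rightarrow> N \<oplus> D\<^sub>M\<close>; the octahedral axiom and the closure under undoing rotations show that its cone
  stays in \<open>\<Z>\<close>.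
\<close>

section \<open>Preadditive categories\<close>

text \<open>A right triangulation provides weak cokernels but in general no weak kernels. TR(4)
  completes a morphism only at the third object, so a morphism into the first object of a triangle
  has to be found after rotating, and the completion then lives between shifted objects. Bringing it
  back needs that T loses no information and that the completion is a T-image; factor-through-epic
  with n = 1 grants the latter as soon as one of the two objects lies in \<D>. The second obstacle
  is that squares in the quotient commute only modulo [\<D>], while the axioms of the original
  category need strict equalities. If a square commutes up to v u with u ending in \<D>, then u
  extends along a \<D>-monic first morphism and the error can be subtracted. For octahedra this is
  avoided altogether: both morphisms are exchanged for \<D>-monic representatives with enlarged
  targets, whose composite is \<D>-monic again, and the axiom is checked for this isomorphic copy of
  the given pair.\<close>

lemma Hom_iff: "f \<in> Hom C A B \<longleftrightarrow> f \<in> Arr C \<and> Dom C f = A \<and> Cod C f = B"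
  by (auto simp: Hom_def)

section \<open>Composition and isomorphisms\<close>

context category
begin

lemma Hom_Obj:
  assumes "f \<in> Hom C A B"
  shows "A \<in> Obj C" "B \<in> Obj C"
  using assms Dom_Obj Cod_Obj by (auto simp: Hom_iff)

declare Dom_Obj [simp] Cod_Obj [simp]

text \<open>The axioms are restated with source and target as equations instead of membership in
  \<open>Hom\<close>, so that composability conditions resolve by rewriting.\<close>

lemma Ident_simps [simp]:
  assumes "A \<in> Obj C"
  shows "Ident C A \<in> Arr C" "Dom C (Ident C A) = A" "Cod C (Ident C A) = A"
  using Ident_Hom[OF assms] by (auto simp: Hom_iff)

lemma Comp_simps [simp]:
  assumes "f \<in> Arr C" "g \<in> Arr C" "Dom C g = Cod C f"
  shows "g \<cdot> f \<in> Arr C" "Dom C (g \<cdot> f) = Dom C f" "Cod C (g \<cdot> f) = Cod C g"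
  using Comp_Hom[of f "Dom C f" "Cod C f" g "Cod C g"] assms by (auto simp: Hom_iff)

lemma Comp_assoc' [simp]:
  assumes "f \<in> Arr C" "g \<in> Arr C" "h \<in> Arr C" "Dom C g = Cod C f" "Dom C h = Cod C g"
  shows "(h \<cdot> g) \<cdot> f = h \<cdot> (g \<cdot> f)"
  using Comp_assoc[of f "Dom C f" "Cod C f" g "Cod C g" h "Cod C h"] assms by (auto simp: Hom_iff)

lemma Comp_Ident [simp]:
  assumes "f \<in> Arr C"
  shows "Cod C f = A \<Longrightarrow> Ident C A \<cdot> f = f" "Dom C f = A \<Longrightarrow> f \<cdot> Ident C A = f"
  using Comp_Ident_left[of f "Dom C f" "Cod C f"] Comp_Ident_right[of f "Dom C f" "Cod C f"] assms
  by (auto simp: Hom_iff)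

text \<open>In right-nested composites a known product \<open>g \<cdot> f\<close> is hidden inside
  \<open>g \<cdot> (f \<cdot> x)\<close>; this form rewrites it there.\<close>

lemma Comp_reassoc:
  assumes "g \<cdot> f = k" "f \<in> Arr C" "g \<in> Arr C" "Dom C g = Cod C f" "x \<in> Arr C" "Dom C f = Cod C x"
  shows "g \<cdot> (f \<cdot> x) = k \<cdot> x"
  using assms Comp_assoc' by metis

lemma is_isoI:
  assumes "f \<in> Hom C A B" "g \<in> Hom C B A" "g \<cdot> f = Ident C A" "f \<cdot> g = Ident C B"
  shows "is_iso C f"
  using assms by (auto simp: is_iso_def Hom_iff)

lemma is_isoE:
  assumes "is_iso C f" "f \<in> Hom C A B"
  obtains g where "g \<in> Hom C B A" "g \<cdot> f = Ident C A" "f \<cdot> g = Ident C B"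
  using assms by (auto simp: is_iso_def Hom_iff)

lemma is_iso_Ident [simp]: "A \<in> Obj C \<Longrightarrow> is_iso C (Ident C A)"
  by (rule is_isoI[of _ A A "Ident C A"]) (auto simp: Hom_iff)

lemma is_iso_Comp:
  assumes "is_iso C f" "is_iso C g" "f \<in> Hom C A B" "g \<in> Hom C B X"
  shows "is_iso C (g \<cdot> f)"
proof -
  obtain f' where f': "f' \<in> Hom C B A" "f' \<cdot> f = Ident C A" "f \<cdot> f' = Ident C B"
    using assms is_isoE by blast
  obtain g' where g': "g' \<in> Hom C X B" "g' \<cdot> g = Ident C B" "g \<cdot> g' = Ident C X"
    using assms is_isoE by blast
  note t = assms(3,4) f' g'
  show ?thesis
    by (rule is_isoI[of _ A X "f' \<cdot> g'"])
      (use t in \<open>auto simp: Hom_iff Comp_reassoc[OF g'(2)] Comp_reassoc[OF f'(3)]\<close>)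
qed

text \<open>With \<open>r\<close> and \<open>s\<close> inverse to the two composites,
  \<open>r \<cdot> g\<close> is a left inverse of \<open>f\<close> and \<open>g \<cdot> s\<close> a
  right inverse, and such inverses coincide.\<close>

lemma is_iso_of_composites:
  assumes "f \<in> Hom C A B" "g \<in> Hom C B A" "is_iso C (g \<cdot> f)" "is_iso C (f \<cdot> g)"
  shows "is_iso C f"
proof -
  obtain r where r: "r \<in> Hom C A A" "r \<cdot> (g \<cdot> f) = Ident C A"
    by (rule is_isoE[OF assms(3), of A A]) (use assms in \<open>auto simp: Hom_iff\<close>)
  obtain s where s: "s \<in> Hom C B B" "(f \<cdot> g) \<cdot> s = Ident C B"
    by (rule is_isoE[OF assms(4), of B B]) (use assms in \<open>auto simp: Hom_iff\<close>)
  note t = assms(1,2) r(1) s(1)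
  have "r \<cdot> g = (r \<cdot> g) \<cdot> ((f \<cdot> g) \<cdot> s)"
    unfolding s(2) using t by (auto simp: Hom_iff)
  also have "\<dots> = (r \<cdot> (g \<cdot> f)) \<cdot> (g \<cdot> s)"
    using t by (auto simp: Hom_iff)
  also have "\<dots> = g \<cdot> s"
    unfolding r(2) using t by (auto simp: Hom_iff)
  finally have eq: "r \<cdot> g = g \<cdot> s" .
  have "(g \<cdot> s) \<cdot> f = Ident C A"
    unfolding eq[symmetric] using t r(2) by (auto simp: Hom_iff)
  moreover have "f \<cdot> (g \<cdot> s) = Ident C B"
    using t s(2) by (auto simp: Hom_iff)
  moreover have "g \<cdot> s \<in> Hom C B A"
    using t by (auto simp: Hom_iff)
  ultimately show ?thesis
    using is_isoI assms(1) by blast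
qed

end

section \<open>Sums, negatives and zero morphisms\<close>

context preadditive_category
begin

lemma Zero_simps [simp]:
  assumes "A \<in> Obj C" "B \<in> Obj C"
  shows "Zero C A B \<in> Arr C" "Dom C (Zero C A B) = A" "Cod C (Zero C A B) = B"
proof -
  interpret comm_group "hom_group C A B" using hom_comm_group assms .
  show "Zero C A B \<in> Arr C" "Dom C (Zero C A B) = A" "Cod C (Zero C A B) = B"
    using one_closed by (auto simp: hom_group_def Hom_iff)
qed

lemma Add_simps [simp]:
  assumes "f \<in> Arr C" "g \<in> Arr C" "Dom C f = Dom C g" "Cod C f = Cod C g"
  shows "Add C f g \<in> Arr C" "Dom C (Add C f g) = Dom C g" "Cod C (Add C f g) = Cod C g"
proof -
  interpret comm_group "hom_group C (Dom C f) (Cod C f)" by (rule hom_comm_group) (use assms in auto)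
  show "Add C f g \<in> Arr C" "Dom C (Add C f g) = Dom C g" "Cod C (Add C f g) = Cod C g"
    using m_closed[of f g] assms by (auto simp: hom_group_def Hom_iff)
qed

lemma Neg_simps [simp]:
  assumes "f \<in> Arr C"
  shows "Neg C f \<in> Arr C" "Dom C (Neg C f) = Dom C f" "Cod C (Neg C f) = Cod C f"
proof -
  interpret comm_group "hom_group C (Dom C f) (Cod C f)" by (rule hom_comm_group) (use assms in auto)
  show "Neg C f \<in> Arr C" "Dom C (Neg C f) = Dom C f" "Cod C (Neg C f) = Cod C f"
    using inv_closed[of f] assms by (auto simp: hom_group_def Hom_iff Neg_def)
qed

lemma Add_group:
  assumes "f \<in> Arr C" "g \<in> Arr C" "h \<in> Arr C" "Dom C f = Dom C g" "Cod C f = Cod C g"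
    "Dom C g = Dom C h" "Cod C g = Cod C h"
  shows Add_assoc: "Add C (Add C f g) h = Add C f (Add C g h)"
    and Add_comm: "Add C f g = Add C g f"
    and Add_lcomm: "Add C f (Add C g h) = Add C g (Add C f h)"
proof -
  interpret comm_group "hom_group C (Dom C f) (Cod C f)" by (rule hom_comm_group) (use assms in auto)
  show "Add C (Add C f g) h = Add C f (Add C g h)" "Add C f g = Add C g f"
    "Add C f (Add C g h) = Add C g (Add C f h)"
    using m_assoc[of f g h] m_comm[of f g] m_lcomm[of f g h] assms
    by (auto simp: hom_group_def Hom_iff)
qed

lemma Add_Neg [simp]:
  assumes "f \<in> Arr C"
  shows "Add C f (Neg C f) = Zero C (Dom C f) (Cod C f)"
    "Add C (Neg C f) f = Zero C (Dom C f) (Cod C f)"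
    "Neg C (Neg C f) = f"
proof -
  interpret comm_group "hom_group C (Dom C f) (Cod C f)" by (rule hom_comm_group) (use assms in auto)
  show "Add C f (Neg C f) = Zero C (Dom C f) (Cod C f)"
    "Add C (Neg C f) f = Zero C (Dom C f) (Cod C f)"
    using r_inv[of f] l_inv[of f] assms by (auto simp: hom_group_def Hom_iff Neg_def)
  show "Neg C (Neg C f) = f"
    using inv_inv[of f] assms Neg_simps[of f] by (auto simp: hom_group_def Hom_iff Neg_def)
qed

lemma Add_Zero [simp]:
  assumes "f \<in> Arr C" "Dom C f = A" "Cod C f = B"
  shows "Add C f (Zero C A B) = f" "Add C (Zero C A B) f = f"
proof -
  interpret comm_group "hom_group C (Dom C f) (Cod C f)" by (rule hom_comm_group) (use assms in auto)
  show "Add C f (Zero C A B) = f" "Add C (Zero C A B) f = f"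
    using r_one[of f] l_one[of f] assms by (auto simp: hom_group_def Hom_iff)
qed

lemma Add_cancel:
  assumes "f \<in> Arr C" "g \<in> Arr C" "h \<in> Arr C" "Dom C f = Dom C g" "Cod C f = Cod C g"
    "Dom C h = Dom C g" "Cod C h = Cod C g" "Add C f g = Add C f h"
  shows "g = h"
proof -
  interpret comm_group "hom_group C (Dom C f) (Cod C f)" by (rule hom_comm_group) (use assms in auto)
  show ?thesis
    using right_cancel[of f g h, unfolded hom_group_def, simplified]
      Add_comm[of f g g] Add_comm[of f h h] assms by (metis Hom_iff)
qed

lemma Neg_unique:
  assumes "f \<in> Arr C" "g \<in> Arr C" "Dom C f = Dom C g" "Cod C f = Cod C g"
    "Add C f g = Zero C (Dom C g) (Cod C g)"
  shows "g = Neg C f"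
  by (rule Add_cancel[of f]) (use assms in auto)

lemma Add_Neg_eq_Zero:
  assumes "f \<in> Arr C" "g \<in> Arr C" "Dom C f = Dom C g" "Cod C f = Cod C g"
    "Add C f (Neg C g) = Zero C (Dom C g) (Cod C g)"
  shows "f = g"
  using Neg_unique[of f "Neg C g"] assms by (metis Add_Neg(3) Neg_simps)

lemma Neg_inject: "\<lbrakk>Neg C f = Neg C g; f \<in> Arr C; g \<in> Arr C\<rbrakk> \<Longrightarrow> f = g"
  by (metis Add_Neg(3))

lemma Add_Neg_cancel [simp]:
  assumes "f \<in> Arr C" "g \<in> Arr C" "Dom C f = Dom C g" "Cod C f = Cod C g"
  shows "Add C f (Add C (Neg C f) g) = g" "Add C (Neg C f) (Add C f g) = g"
  using Add_assoc[of f "Neg C f" g] Add_assoc[of "Neg C f" f g] assms by auto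

lemma Comp_Add [simp]:
  assumes "f \<in> Arr C" "g \<in> Arr C" "Dom C f = Dom C g" "Cod C f = Cod C g" "h \<in> Arr C"
  shows "Dom C f = Cod C h \<Longrightarrow> Add C f g \<cdot> h = Add C (f \<cdot> h) (g \<cdot> h)"
    "Dom C h = Cod C f \<Longrightarrow> h \<cdot> Add C f g = Add C (h \<cdot> f) (h \<cdot> g)"
  using Comp_Add_left[of h "Dom C h" "Cod C h" f "Cod C f" g]
    Comp_Add_right[of f "Dom C f" "Cod C f" g h "Cod C h"] assms by (auto simp: Hom_iff)

lemma Comp_Zero [simp]:
  assumes "f \<in> Arr C" "A \<in> Obj C"
  shows "B = Dom C f \<Longrightarrow> f \<cdot> Zero C A B = Zero C A (Cod C f)"
    "B = Cod C f \<Longrightarrow> Zero C B A \<cdot> f = Zero C (Dom C f) A"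
proof -
  show "f \<cdot> Zero C A B = Zero C A (Cod C f)" if "B = Dom C f"
    by (rule Add_cancel[of "f \<cdot> Zero C A B"])
      (use assms that in \<open>simp_all flip: Comp_Add(2)\<close>)
  show "Zero C B A \<cdot> f = Zero C (Dom C f) A" if "B = Cod C f"
    by (rule Add_cancel[of "Zero C B A \<cdot> f"])
      (use assms that in \<open>simp_all flip: Comp_Add(1)\<close>)
qed

lemma Comp_Neg [simp]:
  assumes "f \<in> Arr C" "g \<in> Arr C" "Dom C g = Cod C f"
  shows "Neg C g \<cdot> f = Neg C (g \<cdot> f)" "g \<cdot> Neg C f = Neg C (g \<cdot> f)"
proof -
  show "Neg C g \<cdot> f = Neg C (g \<cdot> f)"
    by (rule Neg_unique) (use assms in \<open>simp_all flip: Comp_Add(1)\<close>)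
  show "g \<cdot> Neg C f = Neg C (g \<cdot> f)"
    by (rule Neg_unique) (use assms in \<open>simp_all flip: Comp_Add(2)\<close>)
qed

lemma Neg_Zero [simp]: "\<lbrakk>A \<in> Obj C; B \<in> Obj C\<rbrakk> \<Longrightarrow> Neg C (Zero C A B) = Zero C A B"
  using Neg_unique[of "Zero C A B" "Zero C A B"] by simp

section \<open>Zero objects and biproducts\<close>

lemma zero_object_iff:
  "is_zero_object C Z \<longleftrightarrow> Z \<in> Obj C \<and> Ident C Z = Zero C Z Z"
proof
  assume "is_zero_object C Z"
  then show "Z \<in> Obj C \<and> Ident C Z = Zero C Z Z"
    by (metis Hom_iff Ident_simps Zero_simps is_zero_object_def)
next
  assume Z: "Z \<in> Obj C \<and> Ident C Z = Zero C Z Z"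
  have "f = Zero C Z A" if "f \<in> Hom C Z A" for f A
    using that Z Comp_Ident(2)[of f Z] by (auto simp: Hom_iff)
  moreover have "f = Zero C A Z" if "f \<in> Hom C A Z" for f A
    using that Z Comp_Ident(1)[of f Z] by (auto simp: Hom_iff)
  moreover have "Zero C Z A \<in> Hom C Z A" "Zero C A Z \<in> Hom C A Z" if "A \<in> Obj C" for A
    using that Z by (auto simp: Hom_iff)
  ultimately show "is_zero_object C Z"
    using Z unfolding is_zero_object_def by blast
qed

lemma zero_object_arrows:
  assumes "is_zero_object C Z" "f \<in> Arr C"
  shows "Dom C f = Z \<Longrightarrow> f = Zero C Z (Cod C f)" "Cod C f = Z \<Longrightarrow> f = Zero C (Dom C f) Z"
  using assms Comp_Ident[of f Z] by (auto simp: zero_object_iff)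

text \<open>The case n = 2 of \<open>is_direct_sum\<close> with named injections and projections,
  which removes the index functions and \<open>finprod\<close>.\<close>

definition biproduct :: "'a \<Rightarrow> 'a \<Rightarrow> 'a \<Rightarrow> 'b \<Rightarrow> 'b \<Rightarrow> 'b \<Rightarrow> 'b \<Rightarrow> bool" where
  "biproduct A B S i p j q \<longleftrightarrow>
    i \<in> Hom C A S \<and> p \<in> Hom C S A \<and> j \<in> Hom C B S \<and> q \<in> Hom C S B \<and>
    p \<cdot> i = Ident C A \<and> q \<cdot> j = Ident C B \<and> p \<cdot> j = Zero C B A \<and> q \<cdot> i = Zero C A B \<and>
    Add C (i \<cdot> p) (j \<cdot> q) = Ident C S"

lemma biproduct_typing:
  assumes "biproduct A B S i p j q"
  shows "i \<in> Arr C" "Dom C i = A" "Cod C i = S" "p \<in> Arr C" "Dom C p = S" "Cod C p = A"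
    "j \<in> Arr C" "Dom C j = B" "Cod C j = S" "q \<in> Arr C" "Dom C q = S" "Cod C q = B"
    "A \<in> Obj C" "B \<in> Obj C" "S \<in> Obj C"
proof -
  show t: "i \<in> Arr C" "Dom C i = A" "Cod C i = S" "p \<in> Arr C" "Dom C p = S" "Cod C p = A"
    "j \<in> Arr C" "Dom C j = B" "Cod C j = S" "q \<in> Arr C" "Dom C q = S" "Cod C q = B"
    using assms by (auto simp: biproduct_def Hom_iff)
  show "A \<in> Obj C" "B \<in> Obj C" "S \<in> Obj C"
    using t Dom_Obj by metis+
qed

lemma biproduct_eqs:
  assumes "biproduct A B S i p j q"
  shows "p \<cdot> i = Ident C A" "q \<cdot> j = Ident C B" "p \<cdot> j = Zero C B A" "q \<cdot> i = Zero C A B"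
    "Add C (i \<cdot> p) (j \<cdot> q) = Ident C S"
  using assms by (auto simp: biproduct_def)

lemma biproduct_sym:
  assumes "biproduct A B S i p j q"
  shows "biproduct B A S j q i p"
  using assms Add_comm[of "i \<cdot> p" "j \<cdot> q" "j \<cdot> q"] by (auto simp: biproduct_def Hom_iff)

lemma direct_sum_2_iff:
  "is_direct_sum C 2 X S \<longleftrightarrow> (\<exists>i p j q. biproduct (X 0) (X 1) S i p j q)"
proof -
  have fin: "finprod (hom_group C S S) u {..<2} = Add C (u 0) (u 1)"
    if "S \<in> Obj C" "u 0 \<in> Hom C S S" "u 1 \<in> Hom C S S" for u :: "nat \<Rightarrow> _"
  proof -
    interpret comm_group "hom_group C S S" using hom_comm_group that by blast
    have carr: "carrier (hom_group C S S) = Hom C S S"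
      by (simp add: hom_group_def)
    have "{..<2} = insert 0 {1::nat}" by auto
    then have "finprod (hom_group C S S) u {..<2} = u 0 \<otimes>\<^bsub>hom_group C S S\<^esub> u 1"
      using that carr finprod_insert[of "{1}" 0 u] finprod_insert[of "{}" 1 u] by simp
    then show ?thesis by (simp add: hom_group_def)
  qed
  have all2: "(\<forall>k<2. P k) \<longleftrightarrow> P 0 \<and> P 1" for P :: "nat \<Rightarrow> bool"
    by (auto simp: less_2_cases_iff)
  show ?thesis
  proof
    assume "is_direct_sum C 2 X S"
    then obtain i p :: "nat \<Rightarrow> _" where S: "S \<in> Obj C" and ip: "i 0 \<in> Hom C (X 0) S" "p 0 \<in> Hom C S (X 0)"
        "i 1 \<in> Hom C (X 1) S" "p 1 \<in> Hom C S (X 1)"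
      and eqs: "p 0 \<cdot> i 0 = Ident C (X 0)" "p 1 \<cdot> i 1 = Ident C (X 1)"
        "p 0 \<cdot> i 1 = Zero C (X 1) (X 0)" "p 1 \<cdot> i 0 = Zero C (X 0) (X 1)"
      and sum: "finprod (hom_group C S S) (\<lambda>k. i k \<cdot> p k) {..<2} = Ident C S"
      unfolding is_direct_sum_def all2 by auto
    have "Add C (i 0 \<cdot> p 0) (i 1 \<cdot> p 1) = Ident C S"
      using fin[of "\<lambda>k. i k \<cdot> p k"] S ip sum Comp_Hom by metis
    then show "\<exists>i p j q. biproduct (X 0) (X 1) S i p j q"
      using ip eqs unfolding biproduct_def by blast
  next
    assume "\<exists>i p j q. biproduct (X 0) (X 1) S i p j q"
    then obtain i p j q where b: "biproduct (X 0) (X 1) S i p j q" by blast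
    have "S \<in> Obj C" "X 0 \<in> Obj C" "X 1 \<in> Obj C"
      using biproduct_typing[OF b] by auto
    then show "is_direct_sum C 2 X S"
      using b fin[of "\<lambda>k. (if k = 0 then i else j) \<cdot> (if k = 0 then p else q)"]
      unfolding is_direct_sum_def all2
      by (intro conjI exI[of _ "\<lambda>k. if k = 0 then i else j"] exI[of _ "\<lambda>k. if k = 0 then p else q"])
        (auto simp: biproduct_def Hom_iff)
  qed
qed

end

lemma (in additive_category) biproduct_exists:
  assumes "A \<in> Obj C" "B \<in> Obj C"
  obtains S i p j q where "biproduct A B S i p j q"
proof -
  obtain S where "is_direct_sum C 2 (\<lambda>k. if k = 0 then A else B) S"
    using direct_sum_exists[of 2 "\<lambda>k. if k = 0 then A else B"] assms by fastforce
  then show thesis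
    using that by (auto simp: direct_sum_2_iff)
qed

lemma (in preadditive_category) subcategory_biproduct:
  assumes "subcategory C \<D>" "biproduct A B S i p j q"
  shows "S \<in> \<D> \<longleftrightarrow> A \<in> \<D> \<and> B \<in> \<D>"
proof -
  have "is_direct_sum C 2 (\<lambda>k. if k = 0 then A else B) S"
    using assms(2) by (auto simp: direct_sum_2_iff)
  moreover have "(\<forall>k<2::nat. (if k = 0 then A else B) \<in> \<D>) \<longleftrightarrow> A \<in> \<D> \<and> B \<in> \<D>"
    by (auto simp: less_2_cases_iff)
  ultimately show ?thesis
    using assms(1) unfolding subcategory_def by blast
qed

text \<open>The empty direct sum: its identity is the empty sum 0, and closure under direct sums
  with n = 0 puts one and the same object into every subcategory.\<close>

lemma (in additive_category) zero_object_in_subcategory: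
  obtains Z where "is_zero_object C Z" "\<And>\<D>. subcategory C \<D> \<Longrightarrow> Z \<in> \<D>"
proof -
  obtain S where S: "is_direct_sum C 0 undefined S"
    using direct_sum_exists[of 0 undefined] by auto
  then obtain i p :: "nat \<Rightarrow> _" where "S \<in> Obj C"
      "finprod (hom_group C S S) (\<lambda>k. i k \<cdot> p k) {} = Ident C S"
    by (auto simp: is_direct_sum_def)
  moreover from this interpret comm_group "hom_group C S S"
    using hom_comm_group by blast
  have "finprod (hom_group C S S) (\<lambda>k. i k \<cdot> p k) {} = Zero C S S"
    unfolding finprod_empty by (simp add: hom_group_def)
  ultimately have "is_zero_object C S"
    by (simp add: zero_object_iff)
  moreover have "S \<in> \<D>" if "subcategory C \<D>" for \<D>
    using that S unfolding subcategory_def by (metis less_nat_zero_code)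
  ultimately show thesis using that by blast
qed

section \<open>Sextuples\<close>

context additive_endofunctor
begin

declare omap_Obj [simp] amap_Ident [simp]

lemma amap_simps [simp]:
  assumes "f \<in> Arr C"
  shows "amap T f \<in> Arr C" "Dom C (amap T f) = omap T (Dom C f)"
    "Cod C (amap T f) = omap T (Cod C f)"
  using amap_Hom[of f "Dom C f" "Cod C f"] assms by (auto simp: Hom_iff)

lemma amap_Comp' [simp]:
  "\<lbrakk>f \<in> Arr C; g \<in> Arr C; Dom C g = Cod C f\<rbrakk> \<Longrightarrow> amap T (g \<cdot> f) = amap T g \<cdot> amap T f"
  using amap_Comp[of f "Dom C f" "Cod C f" g "Cod C g"] by (auto simp: Hom_iff)

lemma amap_Add' [simp]:
  "\<lbrakk>f \<in> Arr C; g \<in> Arr C; Dom C f = Dom C g; Cod C f = Cod C g\<rbrakk>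
    \<Longrightarrow> amap T (Add C f g) = Add C (amap T f) (amap T g)"
  using amap_Add[of f "Dom C f" "Cod C f" g] by (auto simp: Hom_iff)

lemma amap_Zero [simp]:
  assumes "A \<in> Obj C" "B \<in> Obj C"
  shows "amap T (Zero C A B) = Zero C (omap T A) (omap T B)"
  by (rule Add_cancel[of "amap T (Zero C A B)"]) (use assms in \<open>simp_all flip: amap_Add'\<close>)

lemma amap_Neg [simp]: "f \<in> Arr C \<Longrightarrow> amap T (Neg C f) = Neg C (amap T f)"
  by (rule Neg_unique) (simp_all flip: amap_Add')

lemma zero_object_omap: "is_zero_object C Z \<Longrightarrow> is_zero_object C (omap T Z)"
  by (metis amap_Ident amap_Zero omap_Obj zero_object_iff)

lemma sextuple_morphism_Comp:
  assumes "sextuple_morphism C T (A, B, X, f, g, h) (A', B', X', f', g', h') (a, b, c)"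
    "sextuple_morphism C T (A', B', X', f', g', h') (A'', B'', X'', f'', g'', h'') (a', b', c')"
    "(A, B, X, f, g, h) \<in> sextuples C T" "(A', B', X', f', g', h') \<in> sextuples C T"
    "(A'', B'', X'', f'', g'', h'') \<in> sextuples C T"
  shows "sextuple_morphism C T (A, B, X, f, g, h) (A'', B'', X'', f'', g'', h'')
    (a' \<cdot> a, b' \<cdot> b, c' \<cdot> c)"
proof -
  have t: "f \<in> Hom C A B" "g \<in> Hom C B X" "h \<in> Hom C X (omap T A)"
    "f' \<in> Hom C A' B'" "g' \<in> Hom C B' X'" "h' \<in> Hom C X' (omap T A')"
    "f'' \<in> Hom C A'' B''" "g'' \<in> Hom C B'' X''" "h'' \<in> Hom C X'' (omap T A'')"
    "a \<in> Hom C A A'" "b \<in> Hom C B B'" "c \<in> Hom C X X'"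
    "a' \<in> Hom C A' A''" "b' \<in> Hom C B' B''" "c' \<in> Hom C X' X''"
    using assms by (auto simp: sextuples_def)
  have e: "b \<cdot> f = f' \<cdot> a" "c \<cdot> g = g' \<cdot> b" "amap T a \<cdot> h = h' \<cdot> c"
    "b' \<cdot> f' = f'' \<cdot> a'" "c' \<cdot> g' = g'' \<cdot> b'" "amap T a' \<cdot> h' = h'' \<cdot> c'"
    using assms by auto
  show ?thesis
    using t by (auto simp: Hom_iff e e(4-6)[THEN Comp_reassoc])
qed

lemma sextuple_morphism_inverse:
  assumes "sextuple_morphism C T (A, B, X, f, g, h) (A', B', X', f', g', h') (a, b, c)"
    "(A, B, X, f, g, h) \<in> sextuples C T" "(A', B', X', f', g', h') \<in> sextuples C T"
    "a' \<in> Hom C A' A" "a' \<cdot> a = Ident C A" "a \<cdot> a' = Ident C A'"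
    "b' \<in> Hom C B' B" "b' \<cdot> b = Ident C B" "b \<cdot> b' = Ident C B'"
    "c' \<in> Hom C X' X" "c' \<cdot> c = Ident C X" "c \<cdot> c' = Ident C X'"
  shows "sextuple_morphism C T (A', B', X', f', g', h') (A, B, X, f, g, h) (a', b', c')"
proof -
  have t: "f \<in> Hom C A B" "g \<in> Hom C B X" "h \<in> Hom C X (omap T A)"
    "f' \<in> Hom C A' B'" "g' \<in> Hom C B' X'" "h' \<in> Hom C X' (omap T A')"
    "a \<in> Hom C A A'" "b \<in> Hom C B B'" "c \<in> Hom C X X'" "a' \<in> Hom C A' A"
    "b' \<in> Hom C B' B" "c' \<in> Hom C X' X"
    using assms by (auto simp: sextuples_def)
  have e: "b \<cdot> f = f' \<cdot> a" "c \<cdot> g = g' \<cdot> b" "amap T a \<cdot> h = h' \<cdot> c"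
    using assms by auto
  \<comment> \<open>Inverts the vertical sides of a single commuting square. It serves all three
    squares; in the last one a vertical side is \<open>amap T a\<close>.\<close>
  have transfer: "y \<cdot> v = u \<cdot> x"
    if "u \<in> Hom C P R" "v \<in> Hom C P' R'" "x' \<in> Hom C P P'" "x \<in> Hom C P' P" "y' \<in> Hom C R R'"
      "y \<in> Hom C R' R" "x' \<cdot> x = Ident C P'" "y \<cdot> y' = Ident C R" "y' \<cdot> u = v \<cdot> x'"
    for u v x y x' y' P P' R R'
  proof -
    have "y \<cdot> v = y \<cdot> (v \<cdot> (x' \<cdot> x))"
      using that by (auto simp: Hom_iff)
    also have "\<dots> = y \<cdot> ((y' \<cdot> u) \<cdot> x)"
      unfolding that(9) using that(1-6) by (auto simp: Hom_iff)
    also have "\<dots> = (y \<cdot> y') \<cdot> (u \<cdot> x)"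
      using that(1-6) by (auto simp: Hom_iff)
    also have "\<dots> = u \<cdot> x"
      unfolding that(8) using that(1-6) by (auto simp: Hom_iff)
    finally show ?thesis .
  qed
  have "b' \<cdot> f' = f \<cdot> a'" "c' \<cdot> g' = g \<cdot> b'"
    using transfer[of f A B f' A' B' a a' b b'] transfer[of g B X g' B' X' b b' c c'] t e assms
    by auto
  moreover have "amap T a' \<cdot> amap T a = Ident C (omap T A)"
    using assms(5) t by (metis amap_Comp amap_Ident Hom_Obj)
  then have "amap T a' \<cdot> h' = h \<cdot> c'"
    using transfer[of h X "omap T A" h' X' "omap T A'" c c' "amap T a" "amap T a'"] t e assms
      amap_Hom by auto
  ultimately show ?thesis
    using t by auto
qed

lemma sextuple_isomorphic_refl:
  assumes "s \<in> sextuples C T"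
  shows "sextuple_isomorphic C T s s"
proof -
  obtain A B X f g h where s: "s = (A, B, X, f, g, h)" by (cases s)
  then have t: "f \<in> Hom C A B" "g \<in> Hom C B X" "h \<in> Hom C X (omap T A)"
    using assms by (auto simp: sextuples_def)
  then have "sextuple_morphism C T s s (Ident C A, Ident C B, Ident C X)"
    by (auto simp: s Hom_iff)
  moreover have "A \<in> Obj C" "B \<in> Obj C" "X \<in> Obj C"
    using t Hom_Obj by auto
  ultimately show ?thesis
    unfolding sextuple_isomorphic_def using is_iso_Ident by blast
qed

lemma sextuple_isomorphic_sym:
  assumes "sextuple_isomorphic C T s s'" "s \<in> sextuples C T" "s' \<in> sextuples C T"
  shows "sextuple_isomorphic C T s' s"
proof -
  obtain A B X f g h A' B' X' f' g' h'
    where s: "s = (A, B, X, f, g, h)" "s' = (A', B', X', f', g', h')" by (cases s, cases s')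
  obtain a b c where m: "sextuple_morphism C T s s' (a, b, c)" "is_iso C a" "is_iso C b" "is_iso C c"
    using assms sextuple_isomorphic_def by metis
  then have t: "a \<in> Hom C A A'" "b \<in> Hom C B B'" "c \<in> Hom C X X'"
    using s by auto
  obtain a' where a': "a' \<in> Hom C A' A" "a' \<cdot> a = Ident C A" "a \<cdot> a' = Ident C A'"
    using is_isoE m t by metis
  obtain b' where b': "b' \<in> Hom C B' B" "b' \<cdot> b = Ident C B" "b \<cdot> b' = Ident C B'"
    using is_isoE m t by metis
  obtain c' where c': "c' \<in> Hom C X' X" "c' \<cdot> c = Ident C X" "c \<cdot> c' = Ident C X'"
    using is_isoE m t by metis
  have "sextuple_morphism C T s' s (a', b', c')"
    unfolding s by (rule sextuple_morphism_inverse) (use m(1) assms(2,3) s a' b' c' in auto)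
  then show ?thesis
    unfolding sextuple_isomorphic_def using a' b' c' t is_isoI by metis
qed

lemma sextuple_isomorphic_trans:
  assumes "sextuple_isomorphic C T s s'" "sextuple_isomorphic C T s' s''"
    "s \<in> sextuples C T" "s' \<in> sextuples C T" "s'' \<in> sextuples C T"
  shows "sextuple_isomorphic C T s s''"
proof -
  obtain A B X f g h A' B' X' f' g' h' A'' B'' X'' f'' g'' h''
    where s: "s = (A, B, X, f, g, h)" "s' = (A', B', X', f', g', h')"
      "s'' = (A'', B'', X'', f'', g'', h'')" by (cases s, cases s', cases s'')
  obtain a b c where m: "sextuple_morphism C T s s' (a, b, c)" "is_iso C a" "is_iso C b" "is_iso C c"
    using assms sextuple_isomorphic_def by metis
  obtain a' b' c' where m': "sextuple_morphism C T s' s'' (a', b', c')"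
      "is_iso C a'" "is_iso C b'" "is_iso C c'"
    using assms sextuple_isomorphic_def by metis
  have t: "a \<in> Hom C A A'" "b \<in> Hom C B B'" "c \<in> Hom C X X'"
    "a' \<in> Hom C A' A''" "b' \<in> Hom C B' B''" "c' \<in> Hom C X' X''"
    using s m m' by auto
  have "sextuple_morphism C T s s'' (a' \<cdot> a, b' \<cdot> b, c' \<cdot> c)"
    using m(1) m'(1) assms(3-5) unfolding s by (rule sextuple_morphism_Comp)
  moreover have "is_iso C (a' \<cdot> a)" "is_iso C (b' \<cdot> b)" "is_iso C (c' \<cdot> c)"
    using is_iso_Comp m m' t by blast+
  ultimately show ?thesis
    unfolding sextuple_isomorphic_def by blast
qed

end

section \<open>Right triangulations without the octahedral axiom\<close>

text \<open>The results of this locale apply to \<open>\<Z>/\<D>\<close> before its octahedral axiom is known.\<close>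

locale right_pretriangulated = additive_endofunctor +
  fixes \<Sigma> :: "('a, 'b) sextuple set"
  assumes triangle_sextuple: "\<Sigma> \<subseteq> sextuples C T"
    and triangle_iso: "\<lbrakk>s \<in> \<Sigma>; s' \<in> sextuples C T; sextuple_isomorphic C T s s'\<rbrakk> \<Longrightarrow> s' \<in> \<Sigma>"
    and triangle_Ident: "\<lbrakk>is_zero_object C Z; A \<in> Obj C\<rbrakk>
        \<Longrightarrow> (Z, A, A, Zero C Z A, Ident C A, Zero C A (omap T Z)) \<in> \<Sigma>"
    and triangle_exists: "f \<in> Hom C A B \<Longrightarrow> \<exists>X g h. (A, B, X, f, g, h) \<in> \<Sigma>"
    and triangle_rotate: "(A, B, X, f, g, h) \<in> \<Sigma>
        \<Longrightarrow> (B, X, omap T A, g, h, Neg C (amap T f)) \<in> \<Sigma>"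
    and triangle_morphism: "\<lbrakk>(A, B, X, f, g, h) \<in> \<Sigma>; (A', B', X', f', g', h') \<in> \<Sigma>;
          a \<in> Hom C A A'; b \<in> Hom C B B'; b \<cdot> f = f' \<cdot> a\<rbrakk>
        \<Longrightarrow> \<exists>c. sextuple_morphism C T (A, B, X, f, g, h) (A', B', X', f', g', h') (a, b, c)"

sublocale right_triangulated \<subseteq> right_pretriangulated C T \<Sigma>
  by unfold_locales (fact triangles_sextuples TR0 TR1 TR2 TR3 TR4)+

context right_pretriangulated
begin

section \<open>Zero composites and weak cokernels\<close>

lemma triangle_typing:
  assumes "(A, B, X, f, g, h) \<in> \<Sigma>"
  shows "f \<in> Arr C" "g \<in> Arr C" "h \<in> Arr C" "Dom C f = A" "Cod C f = B" "Dom C g = B" "Cod C g = X"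
    "Dom C h = X" "Cod C h = omap T A" "A \<in> Obj C" "B \<in> Obj C" "X \<in> Obj C"
proof -
  show "f \<in> Arr C" "g \<in> Arr C" "h \<in> Arr C" "Dom C f = A" "Cod C f = B" "Dom C g = B" "Cod C g = X"
    "Dom C h = X" "Cod C h = omap T A"
    using assms triangle_sextuple by (auto simp: sextuples_def Hom_iff)
  then show "A \<in> Obj C" "B \<in> Obj C" "X \<in> Obj C"
    using Dom_Obj Cod_Obj by metis+
qed

lemma zero_object_exists: obtains Z where "is_zero_object C Z"
  using zero_object_in_subcategory by blast

text \<open>The rotation of TR(1). Its third object is \<open>omap T Z\<close>, which is again a
  zero object but need not be \<open>Z\<close> itself.\<close>

lemma triangle_Ident_zero:
  assumes "is_zero_object C Z" "A \<in> Obj C"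
  shows "(A, A, omap T Z, Ident C A, Zero C A (omap T Z), Zero C (omap T Z) (omap T A)) \<in> \<Sigma>"
  using triangle_rotate[OF triangle_Ident[OF assms]] assms by (simp add: zero_object_iff)

text \<open>Comparing A = A -> TZ with the given triangle through (1, f) makes
  \<open>g \<cdot> f\<close> factor through the zero object TZ.\<close>

lemma triangle_comp_zero_1:
  assumes "(A, B, X, f, g, h) \<in> \<Sigma>"
  shows "g \<cdot> f = Zero C A X"
proof -
  note t = triangle_typing[OF assms]
  obtain Z where Z: "is_zero_object C Z" by (rule zero_object_exists)
  obtain c where "sextuple_morphism C T
      (A, A, omap T Z, Ident C A, Zero C A (omap T Z), Zero C (omap T Z) (omap T A))
      (A, B, X, f, g, h) (Ident C A, f, c)"
    using triangle_morphism[OF triangle_Ident_zero[OF Z] assms, of A "Ident C A" f] t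
    by (auto simp: Hom_iff)
  then show ?thesis
    using t Z zero_object_omap[OF Z] by (auto simp: Hom_iff zero_object_iff)
qed

lemma triangle_comp_zero:
  assumes "(A, B, X, f, g, h) \<in> \<Sigma>"
  shows "g \<cdot> f = Zero C A X" "h \<cdot> g = Zero C B (omap T A)" "amap T f \<cdot> h = Zero C X (omap T B)"
proof -
  note r = triangle_rotate[OF assms] and t = triangle_typing[OF assms]
  show "g \<cdot> f = Zero C A X" "h \<cdot> g = Zero C B (omap T A)"
    using triangle_comp_zero_1 assms r by auto
  \<comment> \<open>Two rotations turn the first morphism into - T f; the sign is removed
    afterwards.\<close>
  have "Neg C (amap T f \<cdot> h) = Zero C X (omap T B)"
    using triangle_comp_zero_1[OF triangle_rotate[OF r]] t by simp
  then have "Neg C (Neg C (amap T f \<cdot> h)) = Zero C X (omap T B)"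
    using t by simp
  then show "amap T f \<cdot> h = Zero C X (omap T B)"
    using t by simp
qed

text \<open>TR(4), applied to (0, u) into the triangle Z -> Y = Y -> TZ with Z zero, returns the
  factorization as its third component.\<close>

lemma weak_cokernel_1:
  assumes "(A, B, X, f, g, h) \<in> \<Sigma>" "u \<in> Hom C B Y" "u \<cdot> f = Zero C A Y"
  obtains w where "w \<in> Hom C X Y" "u = w \<cdot> g"
proof -
  note t = triangle_typing[OF assms(1)] and u = assms(2,3)
  have Y: "Y \<in> Obj C"
    using u Hom_Obj by blast
  obtain Z where Z: "is_zero_object C Z" by (rule zero_object_exists)
  obtain c where "sextuple_morphism C T (A, B, X, f, g, h)
      (Z, Y, Y, Zero C Z Y, Ident C Y, Zero C Y (omap T Z)) (Zero C A Z, u, c)"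
    using triangle_morphism[OF assms(1) triangle_Ident[OF Z], of Y "Zero C A Z" u] t u Z Y
    by (auto simp: Hom_iff zero_object_iff)
  then have "c \<in> Hom C X Y" "c \<cdot> g = u"
    using Comp_Ident_left[OF u(1)] by auto
  then show thesis
    using that by blast
qed

lemma weak_cokernel_2:
  assumes "(A, B, X, f, g, h) \<in> \<Sigma>" "u \<in> Hom C X Y" "u \<cdot> g = Zero C B Y"
  obtains w where "w \<in> Hom C (omap T A) Y" "u = w \<cdot> h"
  using weak_cokernel_1[OF triangle_rotate[OF assms(1)] assms(2,3)] by blast

section \<open>Isomorphisms between triangles\<close>

text \<open>The endomorphism differs from the identity by a map of square zero.\<close>

lemma triangle_endo_iso:
  assumes "(A, B, X, f, g, h) \<in> \<Sigma>" "c \<in> Hom C X X" "c \<cdot> g = g" "h \<cdot> c = h"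
  shows "is_iso C c"
proof -
  note t = triangle_typing[OF assms(1)]
  have c: "c \<in> Arr C" "Dom C c = X" "Cod C c = X"
    using assms(2) by (auto simp: Hom_iff)
  \<comment> \<open>d = 1 - c kills g, hence is w h for some w; since h d = 0, it follows that d d =
    0.\<close>
  define d where "d = Add C (Ident C X) (Neg C c)"
  have d: "d \<in> Arr C" "Dom C d = X" "Cod C d = X"
    using c t by (auto simp: d_def)
  have dg: "d \<cdot> g = Zero C B X" and hd: "h \<cdot> d = Zero C X (omap T A)"
    using c t assms(3,4) by (auto simp: d_def)
  obtain w where w: "w \<in> Hom C (omap T A) X" "d = w \<cdot> h"
    by (rule weak_cokernel_2[OF assms(1) _ dg]) (use d in \<open>auto simp: Hom_iff\<close>)
  have dd: "d \<cdot> d = Zero C X X"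
    using w t hd d by (metis Comp_Zero(1) Comp_assoc Hom_iff)
  have "Add C d (Neg C (c \<cdot> d)) = Zero C X X"
    using dd c t d by (subst (asm) (1) d_def) simp
  then have cd: "c \<cdot> d = d"
    using Add_Neg_eq_Zero[of d "c \<cdot> d"] c d by simp
  have "Add C d (Neg C (d \<cdot> c)) = Zero C X X"
    using dd c t d by (subst (asm) (2) d_def) simp
  then have dc: "d \<cdot> c = d"
    using Add_Neg_eq_Zero[of d "d \<cdot> c"] c d by simp
  have "Add C c d = Ident C X"
    using c t Add_lcomm[of c "Ident C X" "Neg C c"] by (simp add: d_def)
  \<comment> \<open>Because d d = 0, the inverse of c = 1 - d is 1 + d.\<close>
  then show ?thesis
    by (intro is_isoI[of c X X "Add C (Ident C X) d"]) (use c d t cd dc in \<open>auto simp: Hom_iff\<close>)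
qed

text \<open>Completions in the two directions need not be mutually inverse, but both composites are
  endomorphisms fixing the second and third morphism, so \<open>triangle_endo_iso\<close> makes them
  invertible.\<close>

lemma triangle_morphism_iso:
  assumes "(A, B, X, f, g, h) \<in> \<Sigma>" "(A', B', X', f', g', h') \<in> \<Sigma>"
    "a \<in> Hom C A A'" "b \<in> Hom C B B'" "is_iso C a" "is_iso C b" "b \<cdot> f = f' \<cdot> a"
  obtains c where
    "sextuple_morphism C T (A, B, X, f, g, h) (A', B', X', f', g', h') (a, b, c)" "is_iso C c"
proof -
  obtain a' where a': "a' \<in> Hom C A' A" "a' \<cdot> a = Ident C A" "a \<cdot> a' = Ident C A'"
    using is_isoE assms by metis
  obtain b' where b': "b' \<in> Hom C B' B" "b' \<cdot> b = Ident C B" "b \<cdot> b' = Ident C B'"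
    using is_isoE assms by metis
  obtain c where c: "sextuple_morphism C T (A, B, X, f, g, h) (A', B', X', f', g', h') (a, b, c)"
    using triangle_morphism assms by blast
  note t = triangle_typing[OF assms(1)] triangle_typing[OF assms(2)]
  have "b' \<cdot> f' = (b' \<cdot> f') \<cdot> (a \<cdot> a')"
    using t a' b' by (auto simp: Hom_iff)
  also have "\<dots> = b' \<cdot> ((f' \<cdot> a) \<cdot> a')"
    using t a'(1) b'(1) assms(3,4) by (auto simp: Hom_iff)
  also have "\<dots> = (b' \<cdot> b) \<cdot> (f \<cdot> a')"
    unfolding assms(7)[symmetric] using t a'(1) b'(1) assms(3,4) by (auto simp: Hom_iff)
  also have "\<dots> = f \<cdot> a'"
    using t a' b' by (auto simp: Hom_iff)
  finally have "b' \<cdot> f' = f \<cdot> a'" .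
  then obtain c' where
    c': "sextuple_morphism C T (A', B', X', f', g', h') (A, B, X, f, g, h) (a', b', c')"
    using triangle_morphism assms(1,2) a' b' by blast
  note s = subsetD[OF triangle_sextuple]
  have "sextuple_morphism C T (A, B, X, f, g, h) (A, B, X, f, g, h) (a' \<cdot> a, b' \<cdot> b, c' \<cdot> c)"
    "sextuple_morphism C T (A', B', X', f', g', h') (A', B', X', f', g', h') (a \<cdot> a', b \<cdot> b', c \<cdot> c')"
    using sextuple_morphism_Comp[OF c c'] sextuple_morphism_Comp[OF c' c] s assms(1,2) by auto
  then have "is_iso C (c' \<cdot> c)" "is_iso C (c \<cdot> c')"
    using triangle_endo_iso[OF assms(1), of "c' \<cdot> c"] triangle_endo_iso[OF assms(2), of "c \<cdot> c'"] t
    by (auto simp: a' b')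
  then have "is_iso C c"
    using is_iso_of_composites[of c X X' c'] c c' by auto
  then show thesis using that c by blast
qed

section \<open>Triangles on split monomorphisms\<close>

text \<open>T f is again a split monomorphism and T f h = 0, which forces h = 0. Factorizations
  through g then become unique, and this turns the weak cokernel into a complement of A.\<close>

lemma split_mono_triangle:
  assumes "(A, B, X, f, g, h) \<in> \<Sigma>" "r \<in> Hom C B A" "r \<cdot> f = Ident C A"
  obtains s where "biproduct A X B f r s g" "h = Zero C X (omap T A)"
proof -
  note t = triangle_typing[OF assms(1)] and z = triangle_comp_zero[OF assms(1)]
  have r: "r \<in> Arr C" "Dom C r = B" "Cod C r = A"
    using assms(2) by (auto simp: Hom_iff)
  have "amap T r \<cdot> amap T f = Ident C (omap T A)"
    using assms(3) t r by (metis amap_Comp' amap_Ident)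
  then have "h = (amap T r \<cdot> amap T f) \<cdot> h"
    using t by simp
  also have "\<dots> = amap T r \<cdot> (amap T f \<cdot> h)"
    using t r by simp
  finally have h: "h = Zero C X (omap T A)"
    using z t r by simp
  \<comment> \<open>The idempotent 1 - f r of the complement; it kills f, so it factors through g,
    and the factor is the injection s.\<close>
  define e where "e = Add C (Ident C B) (Neg C (f \<cdot> r))"
  have e: "e \<in> Arr C" "Dom C e = B" "Cod C e = B"
    using t r by (auto simp: e_def)
  have ef: "e \<cdot> f = Zero C A B" and re: "r \<cdot> e = Zero C B A" and ge: "g \<cdot> e = g"
    using t r assms(3) z by (auto simp: e_def Comp_reassoc[OF assms(3)] Comp_reassoc[OF z(1)])
  obtain s where s: "s \<in> Hom C X B" "e = s \<cdot> g"
    by (rule weak_cokernel_1[OF assms(1) _ ef]) (use e in \<open>auto simp: Hom_iff\<close>)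
  have s': "s \<in> Arr C" "Dom C s = X" "Cod C s = B"
    using s by (auto simp: Hom_iff)
  \<comment> \<open>g is an epimorphism: whatever g kills factors through h = 0.\<close>
  have zero: "u = Zero C X V" if uV: "u \<in> Hom C X V" "u \<cdot> g = Zero C B V" for u V
  proof -
    obtain w where "w \<in> Hom C (omap T A) V" "u = w \<cdot> h"
      by (rule weak_cokernel_2[OF assms(1) uV])
    then show ?thesis
      using h t by (auto simp: Hom_iff)
  qed
  have "r \<cdot> s = Zero C X A"
    by (rule zero) (use s re s' r t in \<open>auto simp: Hom_iff\<close>)
  moreover have "Add C (g \<cdot> s) (Neg C (Ident C X)) = Zero C X X"
    by (rule zero) (use s ge s' r t in \<open>auto simp: Hom_iff\<close>)
  then have "g \<cdot> s = Ident C X"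
    using Add_Neg_eq_Zero[of "g \<cdot> s" "Ident C X"] t s' by simp
  moreover have "Add C (f \<cdot> r) (s \<cdot> g) = Ident C B"
    unfolding s(2)[symmetric] e_def
    using t r Add_lcomm[of "f \<cdot> r" "Ident C B" "Neg C (f \<cdot> r)"] by simp
  ultimately have "biproduct A X B f r s g"
    unfolding biproduct_def using t r s' assms(3) z by (auto simp: Hom_iff)
  then show thesis using that h by blast
qed

text \<open>The complement is the cone of the split monomorphism. This turns closure under direct
  summands into closure under retracts.\<close>

lemma retract_biproduct:
  assumes "f \<in> Hom C A B" "r \<in> Hom C B A" "r \<cdot> f = Ident C A"
  obtains X s g where "biproduct A X B f r s g"
proof -
  obtain X g h where tri: "(A, B, X, f, g, h) \<in> \<Sigma>"
    using triangle_exists[OF assms(1)] by blast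
  show thesis
    using split_mono_triangle[OF tri assms(2,3)] that by blast
qed

text \<open>The cone X of i is another complement of A with the same i and p, so q s identifies X
  with B.\<close>

lemma split_triangle:
  assumes b: "biproduct A B S i p j q"
  shows "(A, S, B, i, q, Zero C B (omap T A)) \<in> \<Sigma>"
proof -
  note t = biproduct_typing[OF b] and e = biproduct_eqs[OF b]
  obtain X g h where tri: "(A, S, X, i, g, h) \<in> \<Sigma>"
    using triangle_exists[of i A S] t by (auto simp: Hom_iff)
  obtain s where b': "biproduct A X S i p s g" and h: "h = Zero C X (omap T A)"
    by (rule split_mono_triangle[OF tri, of p]) (use t e in \<open>auto simp: Hom_iff\<close>)
  note tt = t biproduct_typing[OF b'] and e' = biproduct_eqs[OF b']
  \<comment> \<open>Both sides are the identity of S minus i p.\<close>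
  have jq: "j \<cdot> q = s \<cdot> g"
    by (rule Add_cancel[of "i \<cdot> p"]) (use tt e e' in auto)
  have gjq: "g \<cdot> (j \<cdot> q) = g"
    unfolding jq using tt e' by (simp add: Comp_reassoc[OF e'(2)])
  have qsg: "q \<cdot> (s \<cdot> g) = q"
    unfolding jq[symmetric] using tt e by (simp add: Comp_reassoc[OF e(2)])
  have "(g \<cdot> j) \<cdot> (q \<cdot> s) = (g \<cdot> (j \<cdot> q)) \<cdot> s" "(q \<cdot> s) \<cdot> (g \<cdot> j) = (q \<cdot> (s \<cdot> g)) \<cdot> j"
    using tt by simp_all
  then have inv: "(g \<cdot> j) \<cdot> (q \<cdot> s) = Ident C X" "(q \<cdot> s) \<cdot> (g \<cdot> j) = Ident C B"
    unfolding gjq qsg using e e' by simp_all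
  have "sextuple_isomorphic C T (A, S, X, i, g, h) (A, S, B, i, q, Zero C B (omap T A))"
    unfolding sextuple_isomorphic_def
  proof (intro exI conjI)
    show "sextuple_morphism C T (A, S, X, i, g, h) (A, S, B, i, q, Zero C B (omap T A))
        (Ident C A, Ident C S, q \<cdot> s)"
      using tt qsg h by (simp add: Hom_iff)
    show "is_iso C (q \<cdot> s)"
      by (rule is_isoI[of _ X B "g \<cdot> j"]) (use tt inv in \<open>auto simp: Hom_iff\<close>)
  qed (use tt in auto)
  moreover have "(A, S, B, i, q, Zero C B (omap T A)) \<in> sextuples C T"
    using tt by (auto simp: sextuples_def Hom_iff)
  ultimately show ?thesis
    using triangle_iso[OF tri] by blast
qed

end

section \<open>Closing a class of model triangles under isomorphism\<close>

lemma (in additive_endofunctor) is_iso_amap: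
  assumes "is_iso C f" "f \<in> Hom C A B"
  shows "is_iso C (amap T f)"
proof -
  obtain g where g: "g \<in> Hom C B A" "g \<cdot> f = Ident C A" "f \<cdot> g = Ident C B"
    using is_isoE assms by blast
  have "amap T g \<cdot> amap T f = Ident C (omap T A)" "amap T f \<cdot> amap T g = Ident C (omap T B)"
    using g assms(2) Hom_Obj by (metis amap_Comp amap_Ident)+
  then show ?thesis
    using is_isoI amap_Hom assms(2) g(1) by metis
qed

text \<open>Every axiom is checked on the generating class \<open>S0\<close> and transported along
  isomorphisms. \<open>exists\<close> permits an isomorphic target because in the quotient a
  morphism gets a \<D>-monic representative only after its target has been enlarged, and
  \<open>Ident\<close> asks for one zero object because any other is isomorphic to it.\<close>

lemma (in additive_endofunctor) right_pretriangulated_iso_closure: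
  assumes S: "S = {s \<in> sextuples C T. \<exists>s0\<in>S0. sextuple_isomorphic C T s0 s}"
    and S0: "S0 \<subseteq> sextuples C T"
    and Ident: "\<And>A. A \<in> Obj C \<Longrightarrow> \<exists>Z. is_zero_object C Z \<and>
        (Z, A, A, Zero C Z A, Ident C A, Zero C A (omap T Z)) \<in> S0"
    and exists: "\<And>f A B. f \<in> Hom C A B \<Longrightarrow> \<exists>B' X u g h.
        u \<in> Hom C B B' \<and> is_iso C u \<and> (A, B', X, u \<cdot> f, g, h) \<in> S0"
    and rotate: "\<And>A B X f g h. (A, B, X, f, g, h) \<in> S0 \<Longrightarrow>
        (B, X, omap T A, g, h, Neg C (amap T f)) \<in> S"
    and morphism: "\<And>A B X f g h A' B' X' f' g' h' a b. \<lbrakk>(A, B, X, f, g, h) \<in> S0;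
        (A', B', X', f', g', h') \<in> S0; a \<in> Hom C A A'; b \<in> Hom C B B'; b \<cdot> f = f' \<cdot> a\<rbrakk> \<Longrightarrow>
        \<exists>c. sextuple_morphism C T (A, B, X, f, g, h) (A', B', X', f', g', h') (a, b, c)"
  shows "right_pretriangulated C T S"
proof
  have S_iso: "s' \<in> S" if s: "s \<in> S" "s' \<in> sextuples C T" "sextuple_isomorphic C T s s'" for s s'
  proof -
    obtain s0 where s0: "s0 \<in> S0" "sextuple_isomorphic C T s0 s"
      using s S by blast
    then have "sextuple_isomorphic C T s0 s'"
      using sextuple_isomorphic_trans[of s0 s s'] S0 S s by blast
    then show ?thesis
      using S s0 s by blast
  qed
  have S0_S: "S0 \<subseteq> S"
    using S S0 sextuple_isomorphic_refl by blast
  have S_sext: "S \<subseteq> sextuples C T"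
    using S by blast
  have S_typing: "f \<in> Arr C" "g \<in> Arr C" "h \<in> Arr C" "Dom C f = A" "Cod C f = B" "Dom C g = B"
      "Cod C g = X" "Dom C h = X" "Cod C h = omap T A" "A \<in> Obj C" "B \<in> Obj C" "X \<in> Obj C"
    if "(A, B, X, f, g, h) \<in> S" for A B X f g h
  proof -
    show t: "f \<in> Arr C" "g \<in> Arr C" "h \<in> Arr C" "Dom C f = A" "Cod C f = B" "Dom C g = B"
      "Cod C g = X" "Dom C h = X" "Cod C h = omap T A"
      using that S_sext by (auto simp: sextuples_def Hom_iff)
    show "A \<in> Obj C" "B \<in> Obj C" "X \<in> Obj C"
      using t Dom_Obj Cod_Obj by metis+
  qed
  show "S \<subseteq> sextuples C T" by fact
  show "s' \<in> S" if "s \<in> S" "s' \<in> sextuples C T" "sextuple_isomorphic C T s s'" for s s'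
    using that by (rule S_iso)
  show "(Z, A, A, Zero C Z A, Ident C A, Zero C A (omap T Z)) \<in> S"
    if Z: "is_zero_object C Z" and A: "A \<in> Obj C" for Z A
  proof -
    obtain Z0 where Z0: "is_zero_object C Z0"
      and mem: "(Z0, A, A, Zero C Z0 A, Ident C A, Zero C A (omap T Z0)) \<in> S0"
      using Ident[OF A] by blast
    note z = Z[unfolded zero_object_iff] Z0[unfolded zero_object_iff]
    have "is_iso C (Zero C Z0 Z)"
      by (rule is_isoI[of _ Z0 Z "Zero C Z Z0"]) (use z in \<open>auto simp: Hom_iff\<close>)
    moreover have "sextuple_morphism C T (Z0, A, A, Zero C Z0 A, Ident C A, Zero C A (omap T Z0))
        (Z, A, A, Zero C Z A, Ident C A, Zero C A (omap T Z)) (Zero C Z0 Z, Ident C A, Ident C A)"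
      using z A by (auto simp: Hom_iff)
    moreover have "(Z, A, A, Zero C Z A, Ident C A, Zero C A (omap T Z)) \<in> sextuples C T"
      using z A by (auto simp: sextuples_def Hom_iff)
    ultimately show ?thesis
      using S_iso[OF subsetD[OF S0_S mem]] is_iso_Ident[OF A]
      unfolding sextuple_isomorphic_def by blast
  qed
  show "\<exists>X g h. (A, B, X, f, g, h) \<in> S" if f: "f \<in> Hom C A B" for f A B
  proof -
    obtain B' X u g h where u: "u \<in> Hom C B B'" "is_iso C u" and mem: "(A, B', X, u \<cdot> f, g, h) \<in> S0"
      using exists[OF f] by blast
    note t = S_typing[OF subsetD[OF S0_S mem]]
    obtain v where v: "v \<in> Hom C B' B" "v \<cdot> u = Ident C B" "u \<cdot> v = Ident C B'"
      using is_isoE u by blast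
    have "is_iso C v"
      using is_isoI v u(1) by blast
    moreover have "sextuple_morphism C T (A, B', X, u \<cdot> f, g, h) (A, B, X, f, g \<cdot> u, h)
        (Ident C A, v, Ident C X)"
      using t f u(1) v by (auto simp: Hom_iff Comp_reassoc[OF v(2)])
    moreover have "(A, B, X, f, g \<cdot> u, h) \<in> sextuples C T"
      using t f u(1) by (auto simp: sextuples_def Hom_iff)
    ultimately have "(A, B, X, f, g \<cdot> u, h) \<in> S"
      using S_iso[OF subsetD[OF S0_S mem]] is_iso_Ident t(10,12)
      unfolding sextuple_isomorphic_def by blast
    then show ?thesis by blast
  qed
  show "(B, X, omap T A, g, h, Neg C (amap T f)) \<in> S" if s: "(A, B, X, f, g, h) \<in> S" for A B X f g h
  proof -
    note t = S_typing[OF s]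
    obtain s0 where "s0 \<in> S0" "sextuple_isomorphic C T s0 (A, B, X, f, g, h)"
      using s S by blast
    then obtain A0 B0 X0 f0 g0 h0 where s0: "(A0, B0, X0, f0, g0, h0) \<in> S0"
      "sextuple_isomorphic C T (A0, B0, X0, f0, g0, h0) (A, B, X, f, g, h)"
      by (cases s0) blast
    note t0 = S_typing[OF subsetD[OF S0_S s0(1)]]
    obtain a b c where iso: "is_iso C a" "is_iso C b" "is_iso C c"
      and m: "sextuple_morphism C T (A0, B0, X0, f0, g0, h0) (A, B, X, f, g, h) (a, b, c)"
      using s0 unfolding sextuple_isomorphic_def by blast
    then have abc: "a \<in> Arr C" "Dom C a = A0" "Cod C a = A" "b \<in> Arr C" "Dom C b = B0" "Cod C b = B"
      and e: "b \<cdot> f0 = f \<cdot> a"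
      by (auto simp: Hom_iff)
    have "amap T (b \<cdot> f0) = amap T (f \<cdot> a)"
      using e by simp
    then have "amap T b \<cdot> amap T f0 = amap T f \<cdot> amap T a"
      using abc t t0 by simp
    then have "sextuple_morphism C T (B0, X0, omap T A0, g0, h0, Neg C (amap T f0))
        (B, X, omap T A, g, h, Neg C (amap T f)) (b, c, amap T a)"
      using m t t0 abc by (auto simp: Hom_iff)
    moreover have "is_iso C (amap T a)"
      using iso is_iso_amap[of a A0 A] abc by (auto simp: Hom_iff)
    moreover have "(B, X, omap T A, g, h, Neg C (amap T f)) \<in> sextuples C T"
      using t by (auto simp: sextuples_def Hom_iff)
    ultimately show ?thesis
      using S_iso[OF rotate[OF s0(1)]] iso unfolding sextuple_isomorphic_def by blast
  qed
  show "\<exists>c. sextuple_morphism C T (A, B, X, f, g, h) (A', B', X', f', g', h') (a, b, c)"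
    if s: "(A, B, X, f, g, h) \<in> S" and s': "(A', B', X', f', g', h') \<in> S"
      and ab: "a \<in> Hom C A A'" "b \<in> Hom C B B'" "b \<cdot> f = f' \<cdot> a"
    for A B X f g h A' B' X' f' g' h' a b
  proof -
    obtain s0 where s0: "s0 \<in> S0" "sextuple_isomorphic C T s0 (A, B, X, f, g, h)"
      using s S by blast
    obtain A0 B0 X0 f0 g0 h0 where s0_eq: "s0 = (A0, B0, X0, f0, g0, h0)" by (cases s0)
    obtain s1 where s1: "s1 \<in> S0" "sextuple_isomorphic C T s1 (A', B', X', f', g', h')"
      using s' S by blast
    obtain A1 B1 X1 f1 g1 h1 where s1_eq: "s1 = (A1, B1, X1, f1, g1, h1)" by (cases s1)
    note s0 = s0[unfolded s0_eq] and s1 = s1[unfolded s1_eq]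
    have sext: "(A0, B0, X0, f0, g0, h0) \<in> sextuples C T" "(A1, B1, X1, f1, g1, h1) \<in> sextuples C T"
      "(A, B, X, f, g, h) \<in> sextuples C T" "(A', B', X', f', g', h') \<in> sextuples C T"
      using s0 s1 S0 s s' S_sext by auto
    obtain x y z where m: "is_iso C x" "is_iso C y" "is_iso C z"
      "sextuple_morphism C T (A0, B0, X0, f0, g0, h0) (A, B, X, f, g, h) (x, y, z)"
      using s0 unfolding sextuple_isomorphic_def by blast
    have xy: "x \<in> Hom C A0 A" "y \<in> Hom C B0 B" "z \<in> Hom C X0 X"
      using m by auto
    obtain x' where x': "x' \<in> Hom C A A0" "x' \<cdot> x = Ident C A0" "x \<cdot> x' = Ident C A"
      using is_isoE m xy by metis
    obtain y' where y': "y' \<in> Hom C B B0" "y' \<cdot> y = Ident C B0" "y \<cdot> y' = Ident C B"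
      using is_isoE m xy by metis
    obtain z' where z': "z' \<in> Hom C X X0" "z' \<cdot> z = Ident C X0" "z \<cdot> z' = Ident C X"
      using is_isoE m xy by metis
    have m': "sextuple_morphism C T (A, B, X, f, g, h) (A0, B0, X0, f0, g0, h0) (x', y', z')"
      using m(4) sext(1,3) x' y' z' by (rule sextuple_morphism_inverse)
    obtain p q r where n: "is_iso C p" "is_iso C q" "is_iso C r"
      "sextuple_morphism C T (A1, B1, X1, f1, g1, h1) (A', B', X', f', g', h') (p, q, r)"
      using s1 unfolding sextuple_isomorphic_def by blast
    have pq: "p \<in> Hom C A1 A'" "q \<in> Hom C B1 B'" "r \<in> Hom C X1 X'"
      using n by auto
    obtain p' where p': "p' \<in> Hom C A' A1" "p' \<cdot> p = Ident C A1" "p \<cdot> p' = Ident C A'"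
      using is_isoE n pq by metis
    obtain q' where q': "q' \<in> Hom C B' B1" "q' \<cdot> q = Ident C B1" "q \<cdot> q' = Ident C B'"
      using is_isoE n pq by metis
    obtain r' where r': "r' \<in> Hom C X' X1" "r' \<cdot> r = Ident C X1" "r \<cdot> r' = Ident C X'"
      using is_isoE n pq by metis
    have n': "sextuple_morphism C T (A', B', X', f', g', h') (A1, B1, X1, f1, g1, h1) (p', q', r')"
      using n(4) sext(2,4) p' q' r' by (rule sextuple_morphism_inverse)
    note ty = sext[unfolded sextuples_def, simplified] xy pq ab x'(1) y'(1) p'(1) q'(1)
    have e: "q' \<cdot> f' = f1 \<cdot> p'" "y \<cdot> f0 = f \<cdot> x"
      using n' m by auto
    \<comment> \<open>The given square, conjugated to a square between the two model
      triangles.\<close>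
    have "(q' \<cdot> (b \<cdot> y)) \<cdot> f0 = f1 \<cdot> (p' \<cdot> (a \<cdot> x))"
      using ty by (auto simp: Hom_iff e Comp_reassoc[OF ab(3)] Comp_reassoc[OF e(1)])
    moreover have "p' \<cdot> (a \<cdot> x) \<in> Hom C A0 A1" "q' \<cdot> (b \<cdot> y) \<in> Hom C B0 B1"
      using ty by (auto simp: Hom_iff)
    ultimately obtain c0 where c0: "sextuple_morphism C T (A0, B0, X0, f0, g0, h0)
        (A1, B1, X1, f1, g1, h1) (p' \<cdot> (a \<cdot> x), q' \<cdot> (b \<cdot> y), c0)"
      using morphism[OF s0(1) s1(1)] by blast
    have "sextuple_morphism C T (A, B, X, f, g, h) (A1, B1, X1, f1, g1, h1)
        ((p' \<cdot> (a \<cdot> x)) \<cdot> x', (q' \<cdot> (b \<cdot> y)) \<cdot> y', c0 \<cdot> z')"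
      using m' c0 sext(3,1,2) by (rule sextuple_morphism_Comp)
    then have "sextuple_morphism C T (A, B, X, f, g, h) (A', B', X', f', g', h')
        (p \<cdot> ((p' \<cdot> (a \<cdot> x)) \<cdot> x'), q \<cdot> ((q' \<cdot> (b \<cdot> y)) \<cdot> y'), r \<cdot> (c0 \<cdot> z'))"
      using n(4) sext(3,2,4) by (rule sextuple_morphism_Comp)
    moreover have "p \<cdot> ((p' \<cdot> (a \<cdot> x)) \<cdot> x') = a" "q \<cdot> ((q' \<cdot> (b \<cdot> y)) \<cdot> y') = b"
      using ty by (auto simp: Hom_iff Comp_reassoc[OF p'(3)] Comp_reassoc[OF q'(3)] x' y')
    ultimately show ?thesis by metis
  qed
qed

text \<open>
  A triangle is determined up to isomorphism by its first morphism, so one octahedron suffices for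
  each composable pair.
\<close>

lemma (in right_pretriangulated) right_triangulated_of_octahedra:
  assumes octahedron: "\<And>X Y U a d. \<lbrakk>a \<in> Hom C X Y; d \<in> Hom C Y U\<rbrakk> \<Longrightarrow>
    \<exists>Y' U' y u d' Z b c V e f W g h l i.
      y \<in> Hom C Y Y' \<and> is_iso C y \<and> u \<in> Hom C U U' \<and> is_iso C u \<and> d' \<cdot> y = u \<cdot> d \<and>
      (X, Y', Z, y \<cdot> a, b, c) \<in> \<Sigma> \<and> (Y', U', V, d', e, f) \<in> \<Sigma> \<and>
      (X, U', W, d' \<cdot> (y \<cdot> a), g, h) \<in> \<Sigma> \<and> l \<in> Hom C Z W \<and> i \<in> Hom C W V \<and>
      l \<cdot> b = g \<cdot> d' \<and> h \<cdot> l = c \<and> i \<cdot> g = e \<and> f \<cdot> i = amap T (y \<cdot> a) \<cdot> h \<and>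
      (Z, W, V, l, i, amap T b \<cdot> f) \<in> \<Sigma>"
  shows "right_triangulated C T \<Sigma>"
proof unfold_locales
  fix X Y Z a b c U V d e f W g h
  assume 1: "(X, Y, Z, a, b, c) \<in> \<Sigma>" and 2: "(Y, U, V, d, e, f) \<in> \<Sigma>"
    and 3: "(X, U, W, d \<cdot> a, g, h) \<in> \<Sigma>"
  note t = triangle_typing[OF 1] triangle_typing[OF 2] triangle_typing(2,3,6-9,12)[OF 3]
  obtain Y' U' y u d' Z' b' c' V' e' f' W' g' h' l' i' where
    y: "y \<in> Hom C Y Y'" "is_iso C y" and u: "u \<in> Hom C U U'" "is_iso C u" and dy: "d' \<cdot> y = u \<cdot> d"
    and tri1: "(X, Y', Z', y \<cdot> a, b', c') \<in> \<Sigma>" and tri2: "(Y', U', V', d', e', f') \<in> \<Sigma>"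
    and tri3: "(X, U', W', d' \<cdot> (y \<cdot> a), g', h') \<in> \<Sigma>"
    and l': "l' \<in> Hom C Z' W'" and i': "i' \<in> Hom C W' V'" and
    o: "l' \<cdot> b' = g' \<cdot> d'" "h' \<cdot> l' = c'" "i' \<cdot> g' = e'" "f' \<cdot> i' = amap T (y \<cdot> a) \<cdot> h'"
    and tri4: "(Z', W', V', l', i', amap T b' \<cdot> f') \<in> \<Sigma>"
    using octahedron[of a X Y d U] t(1,4,5,13,16,17) unfolding Hom_iff by auto
  note t = t triangle_typing(2,3,6-9,12)[OF tri1] triangle_typing[OF tri2]
    triangle_typing(2,3,6-9,12)[OF tri3] l'[unfolded Hom_iff] i'[unfolded Hom_iff]
    y(1)[unfolded Hom_iff] u(1)[unfolded Hom_iff]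
  \<comment> \<open>z, v and w compare the given triangles with the model octahedron; their first
    two components are already prescribed by y and u.\<close>
  obtain z where z: "is_iso C z" and
    mz: "sextuple_morphism C T (X, Y, Z, a, b, c) (X, Y', Z', y \<cdot> a, b', c') (Ident C X, y, z)"
    by (rule triangle_morphism_iso[OF 1 tri1, of "Ident C X" y])
      (use t y in \<open>auto simp: Hom_iff\<close>)
  obtain v where v: "is_iso C v" and
    mv: "sextuple_morphism C T (Y, U, V, d, e, f) (Y', U', V', d', e', f') (y, u, v)"
    by (rule triangle_morphism_iso[OF 2 tri2, of y u])
      (use t y u dy in \<open>auto simp: Hom_iff\<close>)
  have "u \<cdot> (d \<cdot> a) = (d' \<cdot> (y \<cdot> a)) \<cdot> Ident C X"
    using t by (simp add: Comp_reassoc[OF dy])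
  then obtain w where w: "is_iso C w" and
    mw: "sextuple_morphism C T (X, U, W, d \<cdot> a, g, h) (X, U', W', d' \<cdot> (y \<cdot> a), g', h')
      (Ident C X, u, w)"
    using triangle_morphism_iso[OF 3 tri3, of "Ident C X" u] t u is_iso_Ident[of X]
    by (auto simp: Hom_iff)
  have zvw: "z \<in> Hom C Z Z'" "v \<in> Hom C V V'" "w \<in> Hom C W W'"
    and e: "z \<cdot> b = b' \<cdot> y" "c' \<cdot> z = c" "v \<cdot> e = e' \<cdot> u" "amap T y \<cdot> f = f' \<cdot> v" "w \<cdot> g = g' \<cdot> u"
      "h' \<cdot> w = h"
    using mz mv mw t by (auto simp: Hom_iff)
  obtain y' where y': "y' \<in> Hom C Y' Y" "y' \<cdot> y = Ident C Y"
    using is_isoE y by metis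
  obtain v' where v': "v' \<in> Hom C V' V" "v' \<cdot> v = Ident C V" "v \<cdot> v' = Ident C V'"
    using is_isoE v zvw by metis
  obtain w' where w': "w' \<in> Hom C W' W" "w' \<cdot> w = Ident C W" "w \<cdot> w' = Ident C W'"
    using is_isoE w zvw by metis
  note t = t zvw[unfolded Hom_iff] y'(1)[unfolded Hom_iff] v'(1)[unfolded Hom_iff]
    w'(1)[unfolded Hom_iff]
  \<comment> \<open>l' and i' are carried back along the comparison isomorphisms.\<close>
  define l where "l = w' \<cdot> (l' \<cdot> z)"
  define i where "i = v' \<cdot> (i' \<cdot> w)"
  have li: "l \<in> Hom C Z W" "i \<in> Hom C W V"
    using t by (auto simp: l_def i_def Hom_iff)
  have wl: "w \<cdot> l = l' \<cdot> z" and vi: "v \<cdot> i = i' \<cdot> w"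
    using t by (auto simp: l_def i_def Comp_reassoc[OF w'(3)] Comp_reassoc[OF v'(3)])
  have "l \<cdot> b = w' \<cdot> (w \<cdot> (g \<cdot> d))"
    using t by (simp add: l_def e Comp_reassoc[OF o(1)] dy Comp_reassoc[OF e(5)])
  then have lb: "l \<cdot> b = g \<cdot> d"
    using t by (simp add: Comp_reassoc[OF w'(2)])
  have "h \<cdot> l = (h' \<cdot> w) \<cdot> l"
    using e by simp
  also have "\<dots> = h' \<cdot> (w \<cdot> l)"
    using t li by (auto simp: Hom_iff)
  also have "\<dots> = c"
    unfolding wl using t by (simp add: Comp_reassoc[OF o(2)] e)
  finally have hl: "h \<cdot> l = c" .
  have "i \<cdot> g = v' \<cdot> (v \<cdot> e)"
    using t by (simp add: i_def e Comp_reassoc[OF o(3)])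
  then have ig: "i \<cdot> g = e"
    using t by (simp add: Comp_reassoc[OF v'(2)])
  have "amap T y' \<cdot> amap T y = Ident C (omap T Y)"
    using y' t by (metis amap_Comp' amap_Ident)
  note Ty = Comp_reassoc[OF this]
  \<comment> \<open>The model gives this identity only after composing with T y, which can be
    cancelled because T y' is a left inverse.\<close>
  have "amap T y \<cdot> (f \<cdot> i) = (f' \<cdot> v) \<cdot> i"
    unfolding e(4)[symmetric] using t li by (auto simp: Hom_iff)
  also have "\<dots> = f' \<cdot> (v \<cdot> i)"
    using t li by (auto simp: Hom_iff)
  also have "\<dots> = amap T (y \<cdot> a) \<cdot> (h' \<cdot> w)"
    unfolding vi using t by (simp add: Comp_reassoc[OF o(4)])
  also have "\<dots> = amap T y \<cdot> (amap T a \<cdot> h)"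
    unfolding e(6) using t by simp
  finally have "amap T y' \<cdot> (amap T y \<cdot> (f \<cdot> i)) = amap T y' \<cdot> (amap T y \<cdot> (amap T a \<cdot> h))"
    by simp
  then have fi: "f \<cdot> i = amap T a \<cdot> h"
    using t li by (simp add: Ty Hom_iff)
  have "amap T (z \<cdot> b) = amap T (b' \<cdot> y)"
    using e by simp
  then have Tzb: "amap T z \<cdot> amap T b = amap T b' \<cdot> amap T y"
    using t by simp
  have "sextuple_morphism C T (Z, W, V, l, i, amap T b \<cdot> f)
      (Z', W', V', l', i', amap T b' \<cdot> f') (z, w, v)"
    using t wl vi by (simp add: Hom_iff Comp_reassoc[OF Tzb] e)
  then have "sextuple_isomorphic C T (Z, W, V, l, i, amap T b \<cdot> f)
      (Z', W', V', l', i', amap T b' \<cdot> f')"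
    unfolding sextuple_isomorphic_def using z w v by blast
  moreover have s: "(Z, W, V, l, i, amap T b \<cdot> f) \<in> sextuples C T"
    using t li by (simp add: sextuples_def Hom_iff)
  ultimately have "(Z, W, V, l, i, amap T b \<cdot> f) \<in> \<Sigma>"
    using triangle_iso[OF tri4] sextuple_isomorphic_sym[OF _ s] triangle_sextuple tri4 by blast
  then show "\<exists>l i. l \<in> Hom C Z W \<and> i \<in> Hom C W V \<and> l \<cdot> b = g \<cdot> d \<and> h \<cdot> l = c \<and> i \<cdot> g = e \<and>
      f \<cdot> i = amap T a \<cdot> h \<and> (Z, W, V, l, i, amap T b \<cdot> f) \<in> \<Sigma>"
    using li lb hl ig fi by blast
qed (fact triangle_sextuple triangle_iso triangle_Ident triangle_exists triangle_rotate
  triangle_morphism)+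

section \<open>The quotient by an ideal of morphisms\<close>

lemma is_direct_sumI:
  assumes "S \<in> Obj C" "\<And>k. k < n \<Longrightarrow> X k \<in> Obj C"
    "\<And>k. k < n \<Longrightarrow> i k \<in> Hom C (X k) S" "\<And>k. k < n \<Longrightarrow> p k \<in> Hom C S (X k)"
    "\<And>j k. \<lbrakk>j < n; k < n\<rbrakk> \<Longrightarrow> p j \<cdot>\<^bsub>C\<^esub> i k = (if j = k then Ident C (X k) else Zero C (X k) (X j))"
    "finprod (hom_group C S S) (\<lambda>k. i k \<cdot>\<^bsub>C\<^esub> p k) {..<n} = Ident C S"
  shows "is_direct_sum C n X S"
  unfolding is_direct_sum_def
  by (rule conjI, fact, rule conjI, use assms in blast, rule exI[of _ i], rule exI[of _ p])
    (use assms in blast)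

locale ideal_quotient = additive_category +
  fixes \<Z> \<D> :: "'a set"
  assumes subcat_D: "subcategory C \<D>" and subcat_Z: "subcategory C \<Z>" and D_Z: "\<D> \<subseteq> \<Z>"
begin

abbreviation "Q \<equiv> quotient_cat C \<Z> \<D>"

lemma Z_Obj [simp]: "A \<in> \<Z> \<Longrightarrow> A \<in> Obj C"
  using subcat_Z by (auto simp: subcategory_def)

lemma D_Obj: "A \<in> \<D> \<Longrightarrow> A \<in> Obj C"
  using D_Z by auto

section \<open>Morphisms that factor through \<D>, and their cosets\<close>

lemma factoringI:
  assumes "u \<in> Arr C" "v \<in> Arr C" "Cod C u \<in> \<D>" "Dom C v = Cod C u" "Dom C u = A" "Cod C v = B"
    "f = v \<cdot> u"
  shows "f \<in> factoring C \<D> A B"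
  using assms unfolding factoring_def Hom_iff by blast

lemma factoringE:
  assumes "f \<in> factoring C \<D> A B"
  obtains E u v where "E \<in> \<D>" "u \<in> Arr C" "Dom C u = A" "Cod C u = E" "v \<in> Arr C" "Dom C v = E"
    "Cod C v = B" "f = v \<cdot> u"
  using assms unfolding factoring_def Hom_iff by blast

lemma factoring_Hom: "f \<in> factoring C \<D> A B \<Longrightarrow> f \<in> Arr C \<and> Dom C f = A \<and> Cod C f = B"
  by (auto elim!: factoringE)

text \<open>A sum of two such morphisms factors through the biproduct of the two intermediate
  objects, which lies in \<D> again.\<close>

lemma factoring_subgroup:
  assumes "A \<in> Obj C" "B \<in> Obj C"
  shows "subgroup (factoring C \<D> A B) (hom_group C A B)"
proof -
  interpret comm_group "hom_group C A B" using hom_comm_group assms .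
  have inv_eq: "inv\<^bsub>hom_group C A B\<^esub> f = Neg C f" if "f \<in> factoring C \<D> A B" for f
    using factoring_Hom[OF that] by (auto simp: Neg_def)
  show ?thesis
  proof (rule subgroupI)
    show "factoring C \<D> A B \<subseteq> carrier (hom_group C A B)"
      using factoring_Hom by (auto simp: hom_group_def Hom_iff)
    obtain Z where Z: "is_zero_object C Z" "Z \<in> \<D>"
      using zero_object_in_subcategory subcat_D by metis
    have "Zero C A B \<in> factoring C \<D> A B"
      by (rule factoringI[of "Zero C A Z" "Zero C Z B"]) (use Z assms D_Obj in auto)
    then show "factoring C \<D> A B \<noteq> {}" by blast
    show "inv\<^bsub>hom_group C A B\<^esub> f \<in> factoring C \<D> A B" if f: "f \<in> factoring C \<D> A B" for f
    proof -
      obtain E u v where "E \<in> \<D>" "u \<in> Arr C" "Dom C u = A" "Cod C u = E" "v \<in> Arr C" "Dom C v = E"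
        "Cod C v = B" "f = v \<cdot> u"
        using f by (rule factoringE)
      then have "Neg C f \<in> factoring C \<D> A B"
        by (intro factoringI[of u "Neg C v"]) auto
      then show ?thesis
        using inv_eq f by simp
    qed
    show "f \<otimes>\<^bsub>hom_group C A B\<^esub> g \<in> factoring C \<D> A B"
      if f: "f \<in> factoring C \<D> A B" and g: "g \<in> factoring C \<D> A B" for f g
    proof -
      obtain E u v where *: "E \<in> \<D>" "u \<in> Arr C" "Dom C u = A" "Cod C u = E" "v \<in> Arr C"
        "Dom C v = E" "Cod C v = B" "f = v \<cdot> u"
        using f by (rule factoringE)
      obtain E' u' v' where uv': "E' \<in> \<D>" "u' \<in> Arr C" "Dom C u' = A" "Cod C u' = E'" "v' \<in> Arr C"
        "Dom C v' = E'" "Cod C v' = B" "g = v' \<cdot> u'"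
        using g by (rule factoringE)
      obtain S i p j q where b: "biproduct E E' S i p j q"
        using biproduct_exists D_Obj *(1) uv'(1) by metis
      note t = biproduct_typing[OF b] and e = biproduct_eqs[OF b]
      have "S \<in> \<D>"
        using subcategory_biproduct[OF subcat_D b] * uv' by blast
      moreover have "Add C (v \<cdot> p) (v' \<cdot> q) \<cdot> Add C (i \<cdot> u) (j \<cdot> u') = Add C f g"
        using t * uv' assms by (simp add: e(1-4)[THEN Comp_reassoc])
      ultimately have "Add C f g \<in> factoring C \<D> A B"
        using t * uv'
        by (intro factoringI[of "Add C (i \<cdot> u) (j \<cdot> u')" "Add C (v \<cdot> p) (v' \<cdot> q)"]) auto
      then show ?thesis
        by (simp add: hom_group_def)
    qed
  qed
qed

lemma cls_eq_coset:
  "f \<in> Hom C A B \<Longrightarrow> cls C \<D> f = factoring C \<D> A B #>\<^bsub>hom_group C A B\<^esub> f"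
  by (simp add: cls_def Hom_iff)

lemma mem_cls_iff:
  assumes "f \<in> Arr C"
  shows "g \<in> cls C \<D> f \<longleftrightarrow> g \<in> Arr C \<and> Dom C g = Dom C f \<and> Cod C g = Cod C f \<and>
    Add C g (Neg C f) \<in> factoring C \<D> (Dom C f) (Cod C f)"
proof -
  let ?G = "hom_group C (Dom C f) (Cod C f)" and ?H = "factoring C \<D> (Dom C f) (Cod C f)"
  interpret comm_group ?G by (rule hom_comm_group) (use assms in auto)
  interpret subgroup ?H ?G
    by (rule factoring_subgroup) (use assms in auto)
  have carrier: "carrier ?G = Hom C (Dom C f) (Cod C f)"
    by (simp add: hom_group_def)
  then have f: "f \<in> carrier ?G"
    using assms by (simp add: Hom_iff)
  have "g \<in> cls C \<D> f \<longleftrightarrow> g \<in> carrier ?G \<and> g \<otimes>\<^bsub>?G\<^esub> inv\<^bsub>?G\<^esub> f \<in> ?H"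
    using rcos_module[OF is_group f] elemrcos_carrier[OF is_group f] unfolding cls_def by blast
  moreover have "inv\<^bsub>?G\<^esub> f = Neg C f" "g \<otimes>\<^bsub>?G\<^esub> Neg C f = Add C g (Neg C f)"
    by (simp_all add: Neg_def hom_group_def)
  ultimately show ?thesis
    by (simp add: carrier Hom_iff)
qed

lemma cls_self:
  assumes "f \<in> Arr C"
  shows "f \<in> cls C \<D> f"
proof -
  have "Zero C (Dom C f) (Cod C f) \<in> factoring C \<D> (Dom C f) (Cod C f)"
    using subgroup.one_closed[OF factoring_subgroup, of "Dom C f" "Cod C f"] assms
    by (simp add: hom_group_def)
  then show ?thesis
    using assms by (simp add: mem_cls_iff)
qed

lemma cls_eq_iff:
  assumes "f \<in> Arr C" "g \<in> Arr C" "Dom C f = Dom C g" "Cod C f = Cod C g"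
  shows "cls C \<D> f = cls C \<D> g \<longleftrightarrow> Add C f (Neg C g) \<in> factoring C \<D> (Dom C g) (Cod C g)"
proof -
  interpret comm_group "hom_group C (Dom C g) (Cod C g)"
    by (rule hom_comm_group) (use assms in auto)
  have "cls C \<D> f = cls C \<D> g \<longleftrightarrow> f \<in> cls C \<D> g"
    using cls_self[OF assms(1)] factoring_subgroup[of "Dom C g" "Cod C g"] assms
      repr_independence[of f "factoring C \<D> (Dom C g) (Cod C g)" g]
    unfolding cls_def by (auto simp: hom_group_def Hom_iff)
  then show ?thesis
    using assms by (simp add: mem_cls_iff)
qed

lemma cls_eqI:
  assumes "f \<in> Arr C" "g \<in> Arr C" "Dom C f = Dom C g" "Cod C f = Cod C g"
    "u \<in> Arr C" "v \<in> Arr C" "Cod C u \<in> \<D>" "Dom C v = Cod C u" "Dom C u = Dom C g" "Cod C v = Cod C g"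
    "f = Add C g (v \<cdot> u)"
  shows "cls C \<D> f = cls C \<D> g"
proof -
  have "Add C f (Neg C g) = v \<cdot> u"
    using assms Add_comm[of g "v \<cdot> u" g] by (simp add: Add_assoc)
  then show ?thesis
    using assms by (subst cls_eq_iff) (auto intro!: factoringI[of u v])
qed

lemma cls_eqE:
  assumes "cls C \<D> f = cls C \<D> g" "f \<in> Arr C" "g \<in> Arr C" "Dom C f = Dom C g" "Cod C f = Cod C g"
  obtains u v where "u \<in> Arr C" "v \<in> Arr C" "Cod C u \<in> \<D>" "Dom C v = Cod C u" "Dom C u = Dom C g"
    "Cod C v = Cod C g" "f = Add C g (v \<cdot> u)"
proof -
  have "Add C f (Neg C g) \<in> factoring C \<D> (Dom C g) (Cod C g)"
    using assms by (simp add: cls_eq_iff)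
  then obtain E u v where *: "E \<in> \<D>" "u \<in> Arr C" "Dom C u = Dom C g" "Cod C u = E" "v \<in> Arr C"
    "Dom C v = E" "Cod C v = Cod C g" "Add C f (Neg C g) = v \<cdot> u"
    by (rule factoringE)
  have "f = Add C g (v \<cdot> u)"
    unfolding *(8)[symmetric] using assms Add_lcomm[of g f "Neg C g"] by simp
  then show thesis
    using that * by blast
qed

lemma cls_eq_endpoints:
  assumes "cls C \<D> f = cls C \<D> g" "f \<in> Arr C" "g \<in> Arr C"
  shows "Dom C f = Dom C g" "Cod C f = Cod C g"
  using assms cls_self[of f] by (auto simp: mem_cls_iff)

lemma cls_mem_eq:
  assumes "g \<in> cls C \<D> f" "f \<in> Arr C"
  shows "cls C \<D> g = cls C \<D> f"
  using assms by (simp add: mem_cls_iff cls_eq_iff)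

text \<open>[\<D>] is a two-sided ideal; the two factors are exchanged one at a time.\<close>

lemma cls_Comp_cong:
  assumes "cls C \<D> f = cls C \<D> f'" "cls C \<D> g = cls C \<D> g'" "f \<in> Arr C" "f' \<in> Arr C" "g \<in> Arr C"
    "g' \<in> Arr C" "Dom C g = Cod C f"
  shows "cls C \<D> (g \<cdot> f) = cls C \<D> (g' \<cdot> f')"
proof -
  have p: "Dom C f = Dom C f'" "Cod C f = Cod C f'" "Dom C g = Dom C g'" "Cod C g = Cod C g'"
    using cls_eq_endpoints assms by blast+
  obtain u v where uv: "u \<in> Arr C" "v \<in> Arr C" "Cod C u \<in> \<D>" "Dom C v = Cod C u"
    "Dom C u = Dom C f'" "Cod C v = Cod C f'" "f = Add C f' (v \<cdot> u)"
    by (rule cls_eqE[OF assms(1)]) (use assms p in auto)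
  obtain x y where xy: "x \<in> Arr C" "y \<in> Arr C" "Cod C x \<in> \<D>" "Dom C y = Cod C x"
    "Dom C x = Dom C g'" "Cod C y = Cod C g'" "g = Add C g' (y \<cdot> x)"
    by (rule cls_eqE[OF assms(2)]) (use assms p in auto)
  have "cls C \<D> (g \<cdot> f) = cls C \<D> (g \<cdot> f')"
    by (rule cls_eqI[of _ _ u "g \<cdot> v"]) (use assms p uv(1-6) in \<open>auto simp: uv(7)\<close>)
  also have "\<dots> = cls C \<D> (g' \<cdot> f')"
    by (rule cls_eqI[of _ _ "x \<cdot> f'" y]) (use assms p xy(1-6) in \<open>auto simp: xy(7)\<close>)
  finally show ?thesis .
qed

section \<open>The quotient as an additive category\<close>

lemma Obj_Q [simp]: "Obj Q = \<Z>"
  by (simp add: quotient_cat_def)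

lemma Dom_Q [simp]: "f \<in> Arr C \<Longrightarrow> Dom Q (cls C \<D> f) = Dom C f"
  and Cod_Q [simp]: "f \<in> Arr C \<Longrightarrow> Cod Q (cls C \<D> f) = Cod C f"
proof -
  assume f: "f \<in> Arr C"
  then have "(SOME g. g \<in> cls C \<D> f) \<in> cls C \<D> f"
    using cls_self someI by metis
  then show "Dom Q (cls C \<D> f) = Dom C f" "Cod Q (cls C \<D> f) = Cod C f"
    using f by (auto simp: quotient_cat_def mem_cls_iff)
qed

lemma rcosets_factoring:
  "rcosets\<^bsub>hom_group C A B\<^esub> factoring C \<D> A B = cls C \<D> ` Hom C A B"
proof -
  have "carrier (hom_group C A B) = Hom C A B"
    by (simp add: hom_group_def)
  then show ?thesis
    unfolding RCOSETS_def by (auto simp: cls_eq_coset)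
qed

lemma Arr_Q_iff: "F \<in> Arr Q \<longleftrightarrow> (\<exists>f\<in>Arr C. Dom C f \<in> \<Z> \<and> Cod C f \<in> \<Z> \<and> F = cls C \<D> f)"
proof -
  have "Arr Q = (\<Union>X\<in>\<Z>. \<Union>Y\<in>\<Z>. cls C \<D> ` Hom C X Y)"
    by (simp add: quotient_cat_def FactGroup_def rcosets_factoring)
  then have "F \<in> Arr Q \<longleftrightarrow> (\<exists>X\<in>\<Z>. \<exists>Y\<in>\<Z>. \<exists>f\<in>Hom C X Y. F = cls C \<D> f)"
    by (simp add: image_iff)
  then show ?thesis
    unfolding Bex_def Hom_iff by metis
qed

lemma cls_Arr [simp]: "\<lbrakk>f \<in> Arr C; Dom C f \<in> \<Z>; Cod C f \<in> \<Z>\<rbrakk> \<Longrightarrow> cls C \<D> f \<in> Arr Q"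
  by (auto simp: Arr_Q_iff)

lemma Hom_Q_iff:
  "F \<in> Hom Q A B \<longleftrightarrow> A \<in> \<Z> \<and> B \<in> \<Z> \<and> (\<exists>f\<in>Hom C A B. F = cls C \<D> f)"
proof
  assume "F \<in> Hom Q A B"
  then have F: "F \<in> Arr Q" "Dom Q F = A" "Cod Q F = B"
    by (auto simp: Hom_iff)
  then obtain f where f: "f \<in> Arr C" "Dom C f \<in> \<Z>" "Cod C f \<in> \<Z>" "F = cls C \<D> f"
    by (auto simp: Arr_Q_iff)
  with F have "Dom C f = A" "Cod C f = B"
    by auto
  with f show "A \<in> \<Z> \<and> B \<in> \<Z> \<and> (\<exists>f\<in>Hom C A B. F = cls C \<D> f)"
    by (auto simp: Hom_iff)
next
  assume "A \<in> \<Z> \<and> B \<in> \<Z> \<and> (\<exists>f\<in>Hom C A B. F = cls C \<D> f)"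
  then obtain f where f: "A \<in> \<Z>" "B \<in> \<Z>" "f \<in> Arr C" "Dom C f = A" "Cod C f = B" "F = cls C \<D> f"
    by (auto simp: Hom_iff)
  then show "F \<in> Hom Q A B"
    by (simp add: Hom_iff)
qed

lemma Hom_QE:
  assumes "F \<in> Hom Q A B"
  obtains f where "f \<in> Arr C" "Dom C f = A" "Cod C f = B" "A \<in> \<Z>" "B \<in> \<Z>" "F = cls C \<D> f"
  using assms by (auto simp: Hom_Q_iff Hom_iff[of _ C])

lemma Ident_Q [simp]: "Ident Q A = cls C \<D> (Ident C A)"
  by (simp add: quotient_cat_def)

lemma Comp_Q [simp]:
  assumes "f \<in> Arr C" "g \<in> Arr C" "Dom C g = Cod C f"
  shows "cls C \<D> g \<cdot>\<^bsub>Q\<^esub> cls C \<D> f = cls C \<D> (g \<cdot> f)"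
proof -
  have "cls C \<D> (g' \<cdot> f') = cls C \<D> (g \<cdot> f)" if "g' \<in> cls C \<D> g" "f' \<in> cls C \<D> f" for g' f'
    by (rule cls_Comp_cong) (use that assms cls_mem_eq in \<open>auto simp: mem_cls_iff\<close>)
  moreover have "g \<in> cls C \<D> g" "f \<in> cls C \<D> f"
    using assms cls_self by auto
  moreover have "cls C \<D> g \<cdot>\<^bsub>Q\<^esub> cls C \<D> f = (\<Union>g'\<in>cls C \<D> g. \<Union>f'\<in>cls C \<D> f. cls C \<D> (g' \<cdot> f'))"
    by (simp add: quotient_cat_def)
  ultimately show ?thesis
    by blast
qed

text \<open>The group laws in the quotient are then those of factor groups and need no separate
  proof.\<close>

lemma hom_group_Q:
  assumes "A \<in> \<Z>" "B \<in> \<Z>"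
  shows "hom_group Q A B = hom_group C A B Mod factoring C \<D> A B"
proof -
  have "Hom Q A B = rcosets\<^bsub>hom_group C A B\<^esub> factoring C \<D> A B"
    using assms by (auto simp: Hom_Q_iff rcosets_factoring)
  moreover have "Add Q = set_mult (hom_group C A B)"
    by (intro ext) (auto simp: quotient_cat_def set_mult_def hom_group_def)
  moreover have "Zero Q A B = factoring C \<D> A B"
    by (simp add: quotient_cat_def)
  ultimately show ?thesis
    by (simp add: hom_group_def FactGroup_def)
qed

lemma Add_Q [simp]:
  assumes "f \<in> Arr C" "g \<in> Arr C" "Dom C f = Dom C g" "Cod C f = Cod C g"
  shows "Add Q (cls C \<D> f) (cls C \<D> g) = cls C \<D> (Add C f g)"
proof -
  let ?G = "hom_group C (Dom C g) (Cod C g)" and ?H = "factoring C \<D> (Dom C g) (Cod C g)"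
  interpret comm_group ?G by (rule hom_comm_group) (use assms in auto)
  interpret normal ?H ?G
    by (intro subgroup_imp_normal factoring_subgroup) (use assms in auto)
  have "(?H #>\<^bsub>?G\<^esub> f) <#>\<^bsub>?G\<^esub> (?H #>\<^bsub>?G\<^esub> g) = ?H #>\<^bsub>?G\<^esub> (f \<otimes>\<^bsub>?G\<^esub> g)"
    using assms by (intro rcos_sum) (auto simp: hom_group_def Hom_iff)
  moreover have "Add Q = set_mult ?G"
    by (intro ext) (auto simp: quotient_cat_def set_mult_def hom_group_def)
  moreover have "f \<otimes>\<^bsub>?G\<^esub> g = Add C f g"
    by (simp add: hom_group_def)
  ultimately show ?thesis
    using assms by (simp add: cls_def)
qed

lemma Zero_Q [simp]:
  assumes "A \<in> \<Z>" "B \<in> \<Z>"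
  shows "Zero Q A B = cls C \<D> (Zero C A B)"
proof -
  interpret comm_group "hom_group C A B" by (rule hom_comm_group) (use assms in auto)
  have "factoring C \<D> A B #>\<^bsub>hom_group C A B\<^esub> \<one>\<^bsub>hom_group C A B\<^esub> = factoring C \<D> A B"
    using coset_join2 factoring_subgroup[of A B] assms subgroup.one_closed by force
  then have "cls C \<D> (Zero C A B) = factoring C \<D> A B"
    using assms by (simp add: cls_def hom_group_def)
  then show ?thesis
    by (simp add: quotient_cat_def)
qed

text \<open>Needed for the sum condition of a direct sum of n objects; the induction step is
  \<open>Add_Q\<close>.\<close>

lemma finprod_cls:
  fixes n :: nat
  assumes "S \<in> \<Z>" "\<And>k. k < n \<Longrightarrow> u k \<in> Hom C S S"
  shows "finprod (hom_group Q S S) (\<lambda>k. cls C \<D> (u k)) {..<n} =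
    cls C \<D> (finprod (hom_group C S S) u {..<n})"
proof -
  interpret G: comm_group "hom_group C S S" by (rule hom_comm_group) (use assms in auto)
  interpret H: comm_group "hom_group Q S S"
    using assms G.abelian_FactGroup[OF factoring_subgroup] by (simp add: hom_group_Q)
  have carrier: "carrier (hom_group C S S) = Hom C S S" "carrier (hom_group Q S S) = Hom Q S S"
    by (simp_all add: hom_group_def)
  show ?thesis
    using assms(2)
  proof (induction n)
    case 0
    have "\<one>\<^bsub>hom_group Q S S\<^esub> = cls C \<D> \<one>\<^bsub>hom_group C S S\<^esub>"
      using assms(1) by (simp add: hom_group_def)
    then show ?case by simp
  next
    case (Suc n)
    let ?s = "finprod (hom_group C S S) u {..<n}"
    have u: "u \<in> {..<n} \<rightarrow> carrier (hom_group C S S)" "u n \<in> carrier (hom_group C S S)"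
      using Suc.prems by (auto simp: carrier)
    have s: "?s \<in> Hom C S S"
      using G.finprod_closed[OF u(1)] carrier by simp
    have cu: "(\<lambda>k. cls C \<D> (u k)) \<in> {..<n} \<rightarrow> carrier (hom_group Q S S)"
      "cls C \<D> (u n) \<in> carrier (hom_group Q S S)"
      using u assms(1) unfolding carrier Pi_iff Hom_Q_iff by blast+
    have "finprod (hom_group Q S S) (\<lambda>k. cls C \<D> (u k)) {..<Suc n} =
        Add Q (cls C \<D> (u n)) (cls C \<D> ?s)"
      unfolding lessThan_Suc using H.finprod_insert[OF _ _ cu] Suc
      by (simp add: hom_group_def[of Q] del: Add_Q)
    also have "\<dots> = cls C \<D> (Add C (u n) ?s)"
      using u s by (auto simp: carrier Hom_iff)
    also have "\<dots> = cls C \<D> (finprod (hom_group C S S) u {..<Suc n})"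
      unfolding lessThan_Suc using G.finprod_insert[OF _ _ u]
      by (simp add: hom_group_def)
    finally show ?case .
  qed
qed

text \<open>Every identity is read off from representatives. A direct sum in the original category
  stays in \<Z>, and the classes of its injections and projections make it one in the
  quotient.\<close>

lemma additive_category_Q: "additive_category Q"
proof (intro additive_category.intro preadditive_category.intro category.intro
    preadditive_category_axioms.intro additive_category_axioms.intro)
  fix F G H A B A' B'
  show "Dom Q F \<in> Obj Q" "Cod Q F \<in> Obj Q" if "F \<in> Arr Q"
    using that by (auto simp: Arr_Q_iff)
  show "Ident Q A \<in> Hom Q A A" if "A \<in> Obj Q"
    using that by (auto simp: Hom_Q_iff intro!: bexI[of _ "Ident C A"] Ident_Hom)
  show "G \<cdot>\<^bsub>Q\<^esub> F \<in> Hom Q A A'" if "F \<in> Hom Q A B" "G \<in> Hom Q B A'"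
    using that by (elim Hom_QE) (simp add: Hom_iff)
  show "H \<cdot>\<^bsub>Q\<^esub> G \<cdot>\<^bsub>Q\<^esub> F = H \<cdot>\<^bsub>Q\<^esub> (G \<cdot>\<^bsub>Q\<^esub> F)"
    if "F \<in> Hom Q A B" "G \<in> Hom Q B A'" "H \<in> Hom Q A' B'"
    using that by (auto elim!: Hom_QE)
  show "Ident Q B \<cdot>\<^bsub>Q\<^esub> F = F" "F \<cdot>\<^bsub>Q\<^esub> Ident Q A = F" if "F \<in> Hom Q A B"
    using that by (auto elim!: Hom_QE)
  show "comm_group (hom_group Q A B)" if "A \<in> Obj Q" "B \<in> Obj Q"
    using that comm_group.abelian_FactGroup[OF hom_comm_group factoring_subgroup]
    by (auto simp: hom_group_Q)
  show "Add Q G H \<cdot>\<^bsub>Q\<^esub> F = Add Q (G \<cdot>\<^bsub>Q\<^esub> F) (H \<cdot>\<^bsub>Q\<^esub> F)"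
    if "F \<in> Hom Q A B" "G \<in> Hom Q B A'" "H \<in> Hom Q B A'"
    using that by (auto elim!: Hom_QE)
  show "H \<cdot>\<^bsub>Q\<^esub> Add Q F G = Add Q (H \<cdot>\<^bsub>Q\<^esub> F) (H \<cdot>\<^bsub>Q\<^esub> G)"
    if "F \<in> Hom Q A B" "G \<in> Hom Q A B" "H \<in> Hom Q B A'"
    using that by (auto elim!: Hom_QE)
next
  fix n :: nat and X
  assume X: "\<And>k. k < n \<Longrightarrow> X k \<in> Obj Q"
  then obtain S where S: "is_direct_sum C n X S"
    using direct_sum_exists[of n X] by auto
  then obtain i p where "S \<in> Obj C" and ip: "\<And>k. k < n \<Longrightarrow> i k \<in> Hom C (X k) S \<and> p k \<in> Hom C S (X k)"
    and e: "\<And>j k. \<lbrakk>j < n; k < n\<rbrakk> \<Longrightarrow>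
      p j \<cdot> i k = (if j = k then Ident C (X k) else Zero C (X k) (X j))"
    and sum: "finprod (hom_group C S S) (\<lambda>k. i k \<cdot> p k) {..<n} = Ident C S"
    unfolding is_direct_sum_def by blast
  have "\<forall>k<n. X k \<in> \<Z>"
    using X by simp
  then have SZ: "S \<in> \<Z>"
    using S subcat_Z unfolding subcategory_def by blast
  have ipk: "i k \<cdot> p k \<in> Hom C S S" if "k < n" for k
    using ip[OF that] Comp_Hom by blast
  have "is_direct_sum Q n X S"
  proof (rule is_direct_sumI[of _ _ _ _ "\<lambda>k. cls C \<D> (i k)" "\<lambda>k. cls C \<D> (p k)"])
    show "S \<in> Obj Q"
      using SZ by simp
    show "X k \<in> Obj Q" if "k < n" for k
      using X that by blast
    show "cls C \<D> (i k) \<in> Hom Q (X k) S" "cls C \<D> (p k) \<in> Hom Q S (X k)" if "k < n" for k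
      using ip[OF that] SZ X[OF that] by (auto simp: Hom_Q_iff)
    show "cls C \<D> (p j) \<cdot>\<^bsub>Q\<^esub> cls C \<D> (i k) = (if j = k then Ident Q (X k) else Zero Q (X k) (X j))"
      if "j < n" "k < n" for j k
      using e[OF that] ip[OF that(1)] ip[OF that(2)] X[OF that(1)] X[OF that(2)]
      by (auto simp: Hom_iff)
    have "finprod (hom_group Q S S) (\<lambda>k. cls C \<D> (i k) \<cdot>\<^bsub>Q\<^esub> cls C \<D> (p k)) {..<n} =
        finprod (hom_group Q S S) (\<lambda>k. cls C \<D> (i k \<cdot> p k)) {..<n}"
    proof (rule comm_monoid.finprod_cong')
      show "comm_monoid (hom_group Q S S)"
        using comm_group.abelian_FactGroup[OF hom_comm_group factoring_subgroup, of S S] SZ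
        by (simp add: hom_group_Q comm_group_def)
      show "(\<lambda>k. cls C \<D> (i k \<cdot> p k)) \<in> {..<n} \<rightarrow> carrier (hom_group Q S S)"
        using ipk SZ by (fastforce simp: hom_group_def Hom_Q_iff)
    qed (use ip in \<open>auto simp: Hom_iff\<close>)
    also have "\<dots> = Ident Q S"
      using finprod_cls[OF SZ, of n "\<lambda>k. i k \<cdot> p k"] ipk sum by simp
    finally show "finprod (hom_group Q S S) (\<lambda>k. cls C \<D> (i k) \<cdot>\<^bsub>Q\<^esub> cls C \<D> (p k)) {..<n} = Ident Q S" .
  qed
  then show "\<exists>S. is_direct_sum Q n X S" ..
qed

lemma Neg_Q [simp]:
  assumes "f \<in> Arr C" "Dom C f \<in> \<Z>" "Cod C f \<in> \<Z>"
  shows "Neg Q (cls C \<D> f) = cls C \<D> (Neg C f)"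
proof -
  interpret Q: additive_category Q by (rule additive_category_Q)
  show ?thesis
    by (rule sym, rule Q.Neg_unique) (use assms in auto)
qed

section \<open>Isomorphisms in the quotient\<close>

lemma cls_iso:
  assumes "f \<in> Hom C A B" "g \<in> Hom C B A" "A \<in> \<Z>" "B \<in> \<Z>"
    "cls C \<D> (g \<cdot> f) = cls C \<D> (Ident C A)" "cls C \<D> (f \<cdot> g) = cls C \<D> (Ident C B)"
  shows "is_iso Q (cls C \<D> f)"
proof -
  interpret Q: additive_category Q by (rule additive_category_Q)
  show ?thesis
    by (rule Q.is_isoI[of _ A B "cls C \<D> g"]) (use assms in \<open>auto simp: Hom_Q_iff Hom_iff\<close>)
qed

text \<open>The identity of S differs from i p by j q, which factors through E in \<D>; so a summand
  from \<D> becomes invisible.\<close>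

lemma cls_projection_iso:
  assumes "biproduct A E S i p j q" "A \<in> \<Z>" "E \<in> \<D>"
  shows "is_iso Q (cls C \<D> p)" "is_iso Q (cls C \<D> i)" "cls C \<D> (i \<cdot> p) = cls C \<D> (Ident C S)"
proof -
  note t = biproduct_typing[OF assms(1)] and e = biproduct_eqs[OF assms(1)]
  have S: "S \<in> \<Z>"
    using subcategory_biproduct[OF subcat_Z assms(1)] assms D_Z by blast
  show *: "cls C \<D> (i \<cdot> p) = cls C \<D> (Ident C S)"
    by (rule sym, rule cls_eqI[of _ _ q j]) (use t e assms in auto)
  show "is_iso Q (cls C \<D> p)"
    by (rule cls_iso[of _ S A i]) (use t e * S assms in \<open>auto simp: Hom_iff\<close>)
  show "is_iso Q (cls C \<D> i)"
    by (rule cls_iso[of _ A S p]) (use t e * S assms in \<open>auto simp: Hom_iff\<close>)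
qed

end

section \<open>The shift functor of the quotient\<close>

lemma monic_wrtE:
  assumes "monic_wrt C \<D> f" "u \<in> Arr C" "Dom C u = Dom C f" "Cod C u \<in> \<D>"
  obtains w where "w \<in> Arr C" "Dom C w = Cod C f" "Cod C w = Cod C u" "w \<cdot>\<^bsub>C\<^esub> f = u"
proof -
  have "u \<in> (\<lambda>u. u \<cdot>\<^bsub>C\<^esub> f) ` Hom C (Cod C f) (Cod C u)"
    using assms by (auto simp: monic_wrt_def Hom_def)
  then show thesis
    using that by (auto simp: Hom_iff)
qed

lemma (in category) monic_wrtI:
  assumes "f \<in> Arr C"
    "\<And>u. \<lbrakk>u \<in> Arr C; Dom C u = Dom C f; Cod C u \<in> \<D>\<rbrakk> \<Longrightarrow>
      \<exists>w\<in>Arr C. Dom C w = Cod C f \<and> Cod C w = Cod C u \<and> u = w \<cdot> f"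
  shows "monic_wrt C \<D> f"
  unfolding monic_wrt_def
proof (intro conjI ballI equalityI subsetI)
  fix D u
  assume D: "D \<in> \<D>"
  show "u \<in> Hom C (Dom C f) D" if "u \<in> (\<lambda>u. u \<cdot> f) ` Hom C (Cod C f) D"
    using that assms(1) by (auto simp: Hom_iff)
  show "u \<in> (\<lambda>u. u \<cdot> f) ` Hom C (Cod C f) D" if "u \<in> Hom C (Dom C f) D"
    using that assms(2)[of u] D by (auto simp: Hom_iff image_iff)
qed (fact assms(1))

locale mutation = right_triangulated C T \<Sigma> + ideal_quotient C \<Z> \<D>
  for C :: "('o, 'm) precat" (structure) and T \<Sigma> \<Z> \<D> +
  fixes K :: "('o, 'm) triangle_choice"
  assumes unrotate: "\<lbrakk>f \<in> Hom C A B; g \<in> Hom C B X; h \<in> Hom C X (omap T A);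
        (B, X, omap T A, g, h, Neg C (amap T f)) \<in> \<Sigma>\<rbrakk> \<Longrightarrow> (A, B, X, f, g, h) \<in> \<Sigma>"
    and factor: "factor_through_epic C T \<D>"
    and extension: "extension_closed \<Sigma> \<Z>"
    and fixed: "fixed_triangles C \<Sigma> \<Z> \<D> K"
begin

abbreviation "\<sigma> \<equiv> sigma_functor C T \<D> K"

lemma fixed_in:
  assumes "M \<in> \<Z>"
  shows "(M, mid K M, sig K M, alpha K M, beta K M, gamma K M) \<in> \<Sigma>"
    and sig_Z [simp]: "sig K M \<in> \<Z>" and mid_D [simp]: "mid K M \<in> \<D>"
    and alpha_monic: "monic_wrt C \<D> (alpha K M)"
  using assms fixed by (auto simp: fixed_triangles_def fixed_triangle_def left_approx_def)

lemma fixed_typing [simp]: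
  assumes "M \<in> \<Z>"
  shows "alpha K M \<in> Arr C" "beta K M \<in> Arr C" "gamma K M \<in> Arr C" "Dom C (alpha K M) = M"
    "Cod C (alpha K M) = mid K M" "Dom C (beta K M) = mid K M" "Cod C (beta K M) = sig K M"
    "Dom C (gamma K M) = sig K M" "Cod C (gamma K M) = omap T M" "mid K M \<in> Obj C"
  using triangle_typing[OF fixed_in(1)[OF assms]] by auto

section \<open>Faithfulness of T and weak kernels\<close>

text \<open>
  If \<open>Tf = 0\<close>, undoing the rotation of the split triangle on \<open>B \<oplus> TA\<close> makes \<open>B \<rightarrow> B \<oplus> TA\<close> kill \<open>f\<close>.
\<close>

lemma amap_faithful_zero:
  assumes "f \<in> Arr C" "amap T f = Zero C (omap T (Dom C f)) (omap T (Cod C f))"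
  shows "f = Zero C (Dom C f) (Cod C f)"
proof -
  define A B where "A = Dom C f" and "B = Cod C f"
  note AB = A_def[symmetric] B_def[symmetric]
  have O: "A \<in> Obj C" "B \<in> Obj C"
    using assms by (auto simp: A_def B_def)
  obtain S i p j q where b: "biproduct B (omap T A) S i p j q"
    using biproduct_exists O omap_Obj by metis
  note t = biproduct_typing[OF b] and e = biproduct_eqs[OF b]
  \<comment> \<open>The rotation of this sextuple ends in - T f = 0, so it is exactly the split
    triangle.\<close>
  have "(A, B, S, f, i, q) \<in> \<Sigma>"
    by (rule unrotate) (use split_triangle[OF b] t assms O AB in \<open>auto simp: Hom_iff\<close>)
  then have "i \<cdot> f = Zero C A S"
    by (rule triangle_comp_zero(1))
  then have "p \<cdot> (i \<cdot> f) = Zero C A B"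
    using t O by simp
  then show ?thesis
    using t assms(1) AB by (simp add: Comp_reassoc[OF e(1)])
qed

lemma amap_faithful:
  assumes "f \<in> Arr C" "g \<in> Arr C" "Dom C f = Dom C g" "Cod C f = Cod C g" "amap T f = amap T g"
  shows "f = g"
proof -
  have "Add C f (Neg C g) = Zero C (Dom C g) (Cod C g)"
    using amap_faithful_zero[of "Add C f (Neg C g)"] assms by simp
  then show ?thesis
    by (rule Add_Neg_eq_Zero[OF assms(1-4)])
qed

text \<open>Composing with the identity of TX or TY shows trivially that \<open>c\<close> factors
  through an object of T\<D>; factor-through-epic at n = 1 then supplies a preimage.\<close>

lemma amap_lift:
  assumes "c \<in> Arr C" "Dom C c = omap T X" "Cod C c = omap T Y" "X \<in> Obj C" "Y \<in> Obj C"
    "X \<in> \<D> \<or> Y \<in> \<D>"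
  obtains c' where "c' \<in> Arr C" "Dom C c' = X" "Cod C c' = Y" "amap T c' = c"
proof -
  have "c \<in> factoring C ((omap T ^^ 1) ` \<D>) (omap T X) (omap T Y)"
  proof (cases "X \<in> \<D>")
    case True
    have "c = c \<cdot> Ident C (omap T X)"
      using assms by simp
    moreover have "Ident C (omap T X) \<in> Hom C (omap T X) (omap T X)" "c \<in> Hom C (omap T X) (omap T Y)"
      using assms by (auto simp: Hom_iff)
    ultimately show ?thesis
      unfolding factoring_def using True by auto
  next
    case False
    then have "Y \<in> \<D>" using assms by blast
    moreover have "c = Ident C (omap T Y) \<cdot> c"
      using assms by simp
    moreover have "Ident C (omap T Y) \<in> Hom C (omap T Y) (omap T Y)" "c \<in> Hom C (omap T X) (omap T Y)"
      using assms by (auto simp: Hom_iff)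
    ultimately show ?thesis
      unfolding factoring_def by auto
  qed
  then obtain c' where "c' \<in> factoring C ((omap T ^^ (1 - 1)) ` \<D>) X Y" "amap T c' = c"
    using factor assms(4,5) unfolding factor_through_epic_def by (metis zero_less_one)
  then show thesis
    using that factoring_Hom[of c' X Y] by auto
qed

text \<open>TR(4) between the rotations of Y -> TZ -> TY, with Z zero, and of the given triangle
  yields only a shifted factorization T u = T f c with c from TY to TA. Lifting c and faithfulness
  of T remove the shift.\<close>

lemma weak_kernel:
  assumes tri: "(A, B, X, f, g, h) \<in> \<Sigma>" and u: "u \<in> Arr C" "Cod C u = B"
    and gu: "g \<cdot> u = Zero C (Dom C u) X" and D: "A \<in> \<D> \<or> Dom C u \<in> \<D>"
  obtains v where "v \<in> Arr C" "Dom C v = Dom C u" "Cod C v = A" "u = f \<cdot> v"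
proof -
  note t = triangle_typing[OF tri]
  define Y where "Y = Dom C u"
  have Y: "Y \<in> Obj C" "Dom C u = Y"
    using u by (auto simp: Y_def)
  obtain Z where Z: "is_zero_object C Z" by (rule zero_object_exists)
  note TZ = zero_object_omap[OF Z, unfolded zero_object_iff]
  obtain c where c: "sextuple_morphism C T
      (Y, omap T Z, omap T Y, Zero C Y (omap T Z), Zero C (omap T Z) (omap T Y),
        Neg C (amap T (Ident C Y)))
      (B, X, omap T A, g, h, Neg C (amap T f)) (u, Zero C (omap T Z) X, c)"
    using triangle_morphism[OF triangle_rotate[OF triangle_Ident_zero[OF Z Y(1)]] triangle_rotate[OF tri],
        of u "Zero C (omap T Z) X"] u Y t gu TZ
    by (auto simp: Hom_iff)
  then have c': "c \<in> Arr C" "Dom C c = omap T Y" "Cod C c = omap T A"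
    and "Neg C (amap T u) = Neg C (amap T f \<cdot> c)"
    using t u Y by (auto simp: Hom_iff)
  then have Tu: "amap T u = amap T f \<cdot> c"
    using t u by (metis Add_Neg(3) amap_simps Comp_simps(1))
  obtain v where v: "v \<in> Arr C" "Dom C v = Y" "Cod C v = A" "amap T v = c"
    by (rule amap_lift[of c Y A]) (use c' t Y D in auto)
  have "u = f \<cdot> v"
    by (rule amap_faithful) (use u v t Y Tu in auto)
  then show thesis
    using that v Y by blast
qed

section \<open>Well-definedness and functoriality of \<sigma>\<close>

text \<open>The difference is killed by \<open>gamma K N\<close>. In the rotated triangle
  \<open>beta K N\<close> precedes that morphism and starts in \<D>, so the weak kernel property
  factors the difference through \<open>mid K N\<close>.\<close>

lemma sig_cls_unique:
  assumes "N \<in> \<Z>" "u \<in> Arr C" "v \<in> Arr C" "Dom C u = Dom C v" "Cod C u = sig K N" "Cod C v = sig K N"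
    "gamma K N \<cdot> u = gamma K N \<cdot> v"
  shows "cls C \<D> u = cls C \<D> v"
proof -
  define w where "w = Add C u (Neg C v)"
  have w: "w \<in> Arr C" "Dom C w = Dom C v" "Cod C w = sig K N" "gamma K N \<cdot> w = Zero C (Dom C w) (omap T N)"
    using assms by (auto simp: w_def)
  obtain x where x: "x \<in> Arr C" "Dom C x = Dom C w" "Cod C x = mid K N" "w = beta K N \<cdot> x"
    by (rule weak_kernel[OF triangle_rotate[OF fixed_in(1)[OF assms(1)]] w(1,3,4)
          disjI1[OF mid_D[OF assms(1)]]])
  show ?thesis
    by (rule cls_eqI[of _ _ x "beta K N"])
      (use assms w x Add_lcomm[of v u "Neg C v"] in \<open>auto simp: w_def simp flip: x(4)\<close>)
qed

lemma sig_lift_exists: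
  assumes "m \<in> Arr C" "Dom C m \<in> \<Z>" "Cod C m \<in> \<Z>"
  obtains g m' where "sextuple_morphism C T (fixed_triangle K (Dom C m)) (fixed_triangle K (Cod C m))
    (m, g, m')"
proof -
  obtain g where g: "g \<in> Arr C" "Dom C g = mid K (Dom C m)" "Cod C g = mid K (Cod C m)"
    "g \<cdot> alpha K (Dom C m) = alpha K (Cod C m) \<cdot> m"
    by (rule monic_wrtE[OF alpha_monic[OF assms(2)], of "alpha K (Cod C m) \<cdot> m"]) (use assms in auto)
  show thesis
    using triangle_morphism[OF fixed_in(1)[OF assms(2)] fixed_in(1)[OF assms(3)], of m g] g assms(1) that
    unfolding fixed_triangle_def by (auto simp: Hom_iff)
qed

text \<open>One equation after \<open>gamma\<close> pins down the value: every completion of every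
  representative satisfies the same equation, so \<open>sig_cls_unique\<close> applies.\<close>

lemma amap_sigma:
  assumes "m \<in> Arr C" "Dom C m \<in> \<Z>" "Cod C m \<in> \<Z>" "m' \<in> Arr C" "Dom C m' = sig K (Dom C m)"
    "Cod C m' = sig K (Cod C m)" "gamma K (Cod C m) \<cdot> m' = amap T m \<cdot> gamma K (Dom C m)"
  shows "amap \<sigma> (cls C \<D> m) = cls C \<D> m'"
proof -
  let ?M = "Dom C m" and ?N = "Cod C m"
  have eq: "cls C \<D> k' = cls C \<D> m'"
    if k: "k \<in> cls C \<D> m" and mor: "sextuple_morphism C T (fixed_triangle K (Dom C k))
      (fixed_triangle K (Cod C k)) (k, g, k')" for k k' g
  proof -
    have k1: "k \<in> Arr C" "Dom C k = ?M" "Cod C k = ?N"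
      using k assms(1) by (auto simp: mem_cls_iff)
    obtain u v where uv: "u \<in> Arr C" "v \<in> Arr C" "Cod C u \<in> \<D>" "Dom C v = Cod C u"
      "Dom C u = ?M" "Cod C v = ?N" "k = Add C m (v \<cdot> u)"
      by (rule cls_eqE[of k m]) (use k k1 assms(1) cls_mem_eq[OF k] in auto)
    \<comment> \<open>The error v u between representatives disappears after composing T of it with
      \<open>gamma\<close>: u extends along \<open>alpha\<close>, and T of \<open>alpha\<close>
      after \<open>gamma\<close> is zero.\<close>
    obtain x where x: "x \<in> Arr C" "Dom C x = mid K ?M" "Cod C x = Cod C u" "x \<cdot> alpha K ?M = u"
      by (rule monic_wrtE[OF alpha_monic[OF assms(2)] uv(1)]) (use uv assms in auto)
    have k': "k' \<in> Arr C" "Dom C k' = sig K ?M" "Cod C k' = sig K ?N"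
      "gamma K ?N \<cdot> k' = amap T k \<cdot> gamma K ?M"
      using mor k1 by (auto simp: fixed_triangle_def Hom_iff)
    have "amap T u \<cdot> gamma K ?M = amap T x \<cdot> (amap T (alpha K ?M) \<cdot> gamma K ?M)"
      unfolding x(4)[symmetric] using x(1-3) assms by simp
    also have "\<dots> = Zero C (sig K ?M) (omap T (Cod C u))"
      using triangle_comp_zero(3)[OF fixed_in(1)[OF assms(2)]] x(1-3) assms by simp
    finally have "amap T k \<cdot> gamma K ?M = amap T m \<cdot> gamma K ?M"
      using uv assms by simp
    then show ?thesis
      using k' assms by (intro sig_cls_unique[of ?N]) auto
  qed
  obtain g k' where "sextuple_morphism C T (fixed_triangle K ?M) (fixed_triangle K ?N) (m, g, k')"
    using sig_lift_exists assms by blast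
  moreover have "m \<in> cls C \<D> m"
    using cls_self assms by blast
  \<comment> \<open>The union defining \<sigma> on morphisms runs over a nonempty family with a
    single value.\<close>
  ultimately have "{cls C \<D> k' |k k' g. k \<in> cls C \<D> m \<and>
       sextuple_morphism C T (fixed_triangle K (Dom C k)) (fixed_triangle K (Cod C k)) (k, g, k')} =
    {cls C \<D> m'}"
    using eq by blast
  then show ?thesis
    by (simp add: sigma_functor_def)
qed

lemma sigma_lift:
  assumes "m \<in> Arr C" "Dom C m \<in> \<Z>" "Cod C m \<in> \<Z>"
  obtains m' where "m' \<in> Arr C" "Dom C m' = sig K (Dom C m)" "Cod C m' = sig K (Cod C m)"
    "gamma K (Cod C m) \<cdot> m' = amap T m \<cdot> gamma K (Dom C m)" "amap \<sigma> (cls C \<D> m) = cls C \<D> m'"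
proof -
  obtain g m' where "sextuple_morphism C T (fixed_triangle K (Dom C m)) (fixed_triangle K (Cod C m))
      (m, g, m')"
    using sig_lift_exists[OF assms] .
  then have m': "m' \<in> Arr C" "Dom C m' = sig K (Dom C m)" "Cod C m' = sig K (Cod C m)"
    "gamma K (Cod C m) \<cdot> m' = amap T m \<cdot> gamma K (Dom C m)"
    by (auto simp: fixed_triangle_def Hom_iff)
  then show thesis
    using that amap_sigma[OF assms] by blast
qed

lemma omap_sigma [simp]: "omap \<sigma> M = sig K M"
  by (simp add: sigma_functor_def)

sublocale Q: additive_category Q
  by (rule additive_category_Q)

text \<open>By \<open>amap_sigma\<close> each law only has to be checked after \<open>gamma\<close>,
  where it is the corresponding law for T.\<close>

sublocale Q: additive_endofunctor Q \<sigma>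
proof
  fix A B A' F G
  show "omap \<sigma> A \<in> Obj Q" if "A \<in> Obj Q"
    using that by simp
  show "amap \<sigma> F \<in> Hom Q (omap \<sigma> A) (omap \<sigma> B)" if F: "F \<in> Hom Q A B"
  proof -
    obtain f where f: "f \<in> Arr C" "Dom C f = A" "Cod C f = B" "A \<in> \<Z>" "B \<in> \<Z>" "F = cls C \<D> f"
      using F by (rule Hom_QE)
    obtain f' where "f' \<in> Arr C" "Dom C f' = sig K A" "Cod C f' = sig K B" "amap \<sigma> F = cls C \<D> f'"
      using sigma_lift[of f] f by auto
    then show ?thesis
      using f by (simp add: Hom_iff)
  qed
  show "amap \<sigma> (Ident Q A) = Ident Q (omap \<sigma> A)" if "A \<in> Obj Q"
    using that by (simp add: amap_sigma)
  show "amap \<sigma> (G \<cdot>\<^bsub>Q\<^esub> F) = amap \<sigma> G \<cdot>\<^bsub>Q\<^esub> amap \<sigma> F" if F: "F \<in> Hom Q A B" and G: "G \<in> Hom Q B A'"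
  proof -
    obtain f where f: "f \<in> Arr C" "Dom C f = A" "Cod C f = B" "A \<in> \<Z>" "B \<in> \<Z>" "F = cls C \<D> f"
      using F by (rule Hom_QE)
    obtain g where g: "g \<in> Arr C" "Dom C g = B" "Cod C g = A'" "B \<in> \<Z>" "A' \<in> \<Z>" "G = cls C \<D> g"
      using G by (rule Hom_QE)
    obtain f' where f': "f' \<in> Arr C" "Dom C f' = sig K A" "Cod C f' = sig K B"
      "gamma K B \<cdot> f' = amap T f \<cdot> gamma K A" "amap \<sigma> F = cls C \<D> f'"
      using sigma_lift[of f] f by auto
    obtain g' where g': "g' \<in> Arr C" "Dom C g' = sig K B" "Cod C g' = sig K A'"
      "gamma K A' \<cdot> g' = amap T g \<cdot> gamma K B" "amap \<sigma> G = cls C \<D> g'"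
      using sigma_lift[of g] g by auto
    have "amap \<sigma> (cls C \<D> (g \<cdot> f)) = cls C \<D> (g' \<cdot> f')"
      by (rule amap_sigma) (use f g f' g' in \<open>auto simp: Comp_reassoc[OF g'(4)]\<close>)
    then show ?thesis
      using f g f' g' by simp
  qed
  show "amap \<sigma> (Add Q F G) = Add Q (amap \<sigma> F) (amap \<sigma> G)" if F: "F \<in> Hom Q A B" and G: "G \<in> Hom Q A B"
  proof -
    obtain f where f: "f \<in> Arr C" "Dom C f = A" "Cod C f = B" "A \<in> \<Z>" "B \<in> \<Z>" "F = cls C \<D> f"
      using F by (rule Hom_QE)
    obtain g where g: "g \<in> Arr C" "Dom C g = A" "Cod C g = B" "A \<in> \<Z>" "B \<in> \<Z>" "G = cls C \<D> g"
      using G by (rule Hom_QE)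
    obtain f' where f': "f' \<in> Arr C" "Dom C f' = sig K A" "Cod C f' = sig K B"
      "gamma K B \<cdot> f' = amap T f \<cdot> gamma K A" "amap \<sigma> F = cls C \<D> f'"
      using sigma_lift[of f] f by auto
    obtain g' where g': "g' \<in> Arr C" "Dom C g' = sig K A" "Cod C g' = sig K B"
      "gamma K B \<cdot> g' = amap T g \<cdot> gamma K A" "amap \<sigma> G = cls C \<D> g'"
      using sigma_lift[of g] g by auto
    have "amap \<sigma> (cls C \<D> (Add C f g)) = cls C \<D> (Add C f' g')"
      by (rule amap_sigma) (use f g f' g' in auto)
    then show ?thesis
      using f g f' g' by simp
  qed
qed

end

section \<open>Triangles in the quotient\<close>

context mutation
begin

abbreviation "standard \<equiv> standard_quotient_triangles C T \<Sigma> \<Z> \<D> K"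

section \<open>Cones of \<D>-monic morphisms\<close>

lemma retract_Z:
  assumes "f \<in> Hom C A B" "r \<in> Hom C B A" "r \<cdot> f = Ident C A" "B \<in> \<Z>"
  shows "A \<in> \<Z>"
  using retract_biproduct[OF assms(1-3)] subcategory_biproduct[OF subcat_Z] assms(4) by metis

lemma D_Z' [simp]: "A \<in> \<D> \<Longrightarrow> A \<in> \<Z>"
  using D_Z by blast

text \<open>
  The octahedron on \<open>M \<rightarrow> N \<oplus> D\<^sub>M \<rightarrow> D\<^sub>M\<close>, whose composite is \<open>\<alpha>\<^sub>M\<close>, exhibits the cone as an
  extension of \<open>\<sigma>M\<close> by \<open>N\<close>.
\<close>

lemma cone_alpha_Z:
  assumes "M \<in> \<Z>" "N \<in> \<Z>" and b: "biproduct N (mid K M) S i p j q"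
    and tri: "(M, S, P, a, c, \<phi>) \<in> \<Sigma>" and qa: "q \<cdot> a = alpha K M"
  shows "P \<in> \<Z>"
proof -
  note t = biproduct_typing[OF b] triangle_typing[OF tri]
  have fixed_M: "(M, mid K M, sig K M, q \<cdot> a, beta K M, gamma K M) \<in> \<Sigma>"
    using fixed_in(1)[OF assms(1)] qa by simp
  obtain l i' where li: "l \<in> Hom C P (sig K M)" "i' \<in> Hom C (sig K M) (omap T N)"
    and oct: "(P, sig K M, omap T N, l, i', amap T c \<cdot> Neg C (amap T i)) \<in> \<Sigma>"
    using TR5[OF tri triangle_rotate[OF split_triangle[OF b]] fixed_M] by blast
  \<comment> \<open>The octahedral triangle P -> \<sigma>M -> TN ends in - T (c i), so it can be
    rotated back to begin at N.\<close>
  have "(N, P, sig K M, c \<cdot> i, l, i') \<in> \<Sigma>"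
    by (rule unrotate) (use oct li t in \<open>auto simp: Hom_iff\<close>)
  then show ?thesis
    using extension assms(2) sig_Z[OF assms(1)] unfolding extension_closed_def by blast
qed

text \<open>Enlarging the target by \<open>mid K M\<close> produces a morphism to which
  \<open>cone_alpha_Z\<close> applies. The enlargement is a split monomorphism over M, which makes P
  a retract of the new cone.\<close>

lemma monic_cone_Z:
  assumes "M \<in> \<Z>" "N \<in> \<Z>" and tri: "(M, N, P, m, c, \<phi>) \<in> \<Sigma>" and "monic_wrt C \<D> m"
  shows "P \<in> \<Z>"
proof -
  note t = triangle_typing[OF tri]
  obtain n where n: "n \<in> Arr C" "Dom C n = N" "Cod C n = mid K M" "n \<cdot> m = alpha K M"
    by (rule monic_wrtE[OF assms(4), of "alpha K M"]) (use assms t in auto)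
  obtain S i p j q where b: "biproduct N (mid K M) S i p j q"
    by (rule biproduct_exists[OF Z_Obj[OF assms(2)] fixed_typing(10)[OF assms(1)]])
  note t = t biproduct_typing[OF b] and e = biproduct_eqs[OF b]
  \<comment> \<open>s = (1, n): the first component keeps it split by p, the second gives q s m = n
    m = \<alpha>.\<close>
  define s where "s = Add C i (j \<cdot> n)"
  have s: "s \<in> Arr C" "Dom C s = N" "Cod C s = S"
    using t n by (auto simp: s_def)
  have ps: "p \<cdot> s = Ident C N" and qsm: "q \<cdot> (s \<cdot> m) = alpha K M"
    using t n assms by (auto simp: s_def e n(4) e(1-4)[THEN Comp_reassoc])
  obtain P' b' \<psi> where tri': "(M, S, P', s \<cdot> m, b', \<psi>) \<in> \<Sigma>"
    using triangle_exists[of "s \<cdot> m" M S] s t by (auto simp: Hom_iff)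
  note t = t triangle_typing(2,3,6-9,12)[OF tri']
  have P': "P' \<in> \<Z>"
    by (rule cone_alpha_Z[OF assms(1,2) b tri' qsm])
  obtain l where l: "l \<in> Arr C" "Dom C l = P" "Cod C l = P'" "l \<cdot> c = b' \<cdot> s" "\<psi> \<cdot> l = \<phi>"
    using triangle_morphism[OF tri tri', of "Ident C M" s] s t by (auto simp: Hom_iff)
  obtain r where r: "r \<in> Arr C" "Dom C r = P'" "Cod C r = P" "r \<cdot> b' = c \<cdot> p" "\<phi> \<cdot> r = \<psi>"
    using triangle_morphism[OF tri' tri, of "Ident C M" p] s t
    by (auto simp: Hom_iff Comp_reassoc[OF ps])
  \<comment> \<open>r l need not be the identity, but it fixes c and \<phi>; its inverse k corrects
    r to a retraction of l.\<close>
  have "is_iso C (r \<cdot> l)"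
    by (rule triangle_endo_iso[OF tri])
      (use t s l r ps in \<open>auto simp: Hom_iff Comp_reassoc[OF r(4)] Comp_reassoc[OF r(5)]\<close>)
  then obtain k where k: "k \<in> Hom C P P" "k \<cdot> (r \<cdot> l) = Ident C P"
    using is_isoE[of "r \<cdot> l" P P] l r by (auto simp: Hom_iff)
  show ?thesis
    by (rule retract_Z[of l P P' "k \<cdot> r"]) (use k l r P' in \<open>auto simp: Hom_iff\<close>)
qed

section \<open>Standard triangles\<close>

lemma pi_exists:
  assumes "M \<in> \<Z>" and tri: "(M, N, P, m, c, \<phi>) \<in> \<Sigma>" and "monic_wrt C \<D> m"
  obtains n p where
    "sextuple_morphism C T (M, N, P, m, c, \<phi>) (fixed_triangle K M) (Ident C M, n, p)"
proof -
  note t = triangle_typing[OF tri]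
  obtain n where n: "n \<in> Arr C" "Dom C n = N" "Cod C n = mid K M" "n \<cdot> m = alpha K M"
    by (rule monic_wrtE[OF assms(3), of "alpha K M"]) (use assms t in auto)
  show thesis
    using triangle_morphism[OF tri fixed_in(1)[OF assms(1)], of "Ident C M" n] n t assms(1) that
    unfolding fixed_triangle_def by (auto simp: Hom_iff)
qed

text \<open>By uniqueness modulo \<open>[\<D>]\<close>, only the equation \<open>\<gamma>\<^sub>M \<pi> = \<phi>\<close> matters for \<open>\<pi>\<close>.\<close>

lemma standardI:
  assumes "M \<in> \<Z>" "N \<in> \<Z>" and tri: "(M, N, P, m, c, \<phi>) \<in> \<Sigma>" and m: "monic_wrt C \<D> m"
    and p: "p \<in> Arr C" "Dom C p = P" "Cod C p = sig K M" "gamma K M \<cdot> p = \<phi>"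
  shows "(M, N, P, cls C \<D> m, cls C \<D> c, cls C \<D> p) \<in> standard"
proof -
  note t = triangle_typing[OF tri]
  obtain n p' where mor:
    "sextuple_morphism C T (M, N, P, m, c, \<phi>) (fixed_triangle K M) (Ident C M, n, p')"
    using pi_exists[OF assms(1) tri m] .
  then have "p' \<in> Arr C" "Dom C p' = P" "Cod C p' = sig K M" "gamma K M \<cdot> p' = \<phi>"
    using t by (auto simp: fixed_triangle_def Hom_iff)
  then have "cls C \<D> p = cls C \<D> p'"
    using p assms(1) by (intro sig_cls_unique[of M]) auto
  then show ?thesis
    unfolding standard_quotient_triangles_def
    using mor assms monic_cone_Z[OF assms(1,2) tri m] by blast
qed

lemma standardE:
  assumes "(M, N, P, F, G, H) \<in> standard"
  obtains m c \<phi> p where "M \<in> \<Z>" "N \<in> \<Z>" "P \<in> \<Z>" "(M, N, P, m, c, \<phi>) \<in> \<Sigma>" "monic_wrt C \<D> m"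
    "p \<in> Arr C" "Dom C p = P" "Cod C p = sig K M" "gamma K M \<cdot> p = \<phi>"
    "F = cls C \<D> m" "G = cls C \<D> c" "H = cls C \<D> p"
proof -
  obtain m c \<phi> n p where *: "F = cls C \<D> m" "G = cls C \<D> c" "H = cls C \<D> p" "M \<in> \<Z>" "N \<in> \<Z>" "P \<in> \<Z>"
    "(M, N, P, m, c, \<phi>) \<in> \<Sigma>" "monic_wrt C \<D> m"
    "sextuple_morphism C T (M, N, P, m, c, \<phi>) (fixed_triangle K M) (Ident C M, n, p)"
    using assms unfolding standard_quotient_triangles_def by blast
  then have "p \<in> Arr C" "Dom C p = P" "Cod C p = sig K M" "gamma K M \<cdot> p = \<phi>"
    using triangle_typing[OF *(7)] by (auto simp: fixed_triangle_def Hom_iff)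
  then show thesis
    using that * by blast
qed

lemma standard_exists:
  assumes "m \<in> Arr C" "Dom C m = M" "Cod C m = N" "M \<in> \<Z>" "N \<in> \<Z>" "monic_wrt C \<D> m"
  obtains P c \<phi> p where "P \<in> \<Z>" "(M, N, P, m, c, \<phi>) \<in> \<Sigma>" "p \<in> Arr C" "Dom C p = P"
    "Cod C p = sig K M" "gamma K M \<cdot> p = \<phi>"
    "(M, N, P, cls C \<D> m, cls C \<D> c, cls C \<D> p) \<in> standard"
proof -
  obtain P c \<phi> where tri: "(M, N, P, m, c, \<phi>) \<in> \<Sigma>"
    using triangle_exists[of m M N] assms by (auto simp: Hom_iff)
  obtain n p where
    "sextuple_morphism C T (M, N, P, m, c, \<phi>) (fixed_triangle K M) (Ident C M, n, p)"
    using pi_exists[OF assms(4) tri assms(6)] .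
  then have p: "p \<in> Arr C" "Dom C p = P" "Cod C p = sig K M" "gamma K M \<cdot> p = \<phi>"
    using triangle_typing[OF tri] by (auto simp: fixed_triangle_def Hom_iff)
  show thesis
    using that monic_cone_Z[OF assms(4,5) tri assms(6)] tri p standardI[OF assms(4,5) tri assms(6) p]
    by blast
qed

lemma standard_sextuples: "standard \<subseteq> sextuples Q \<sigma>"
proof
  fix s
  assume s: "s \<in> standard"
  obtain M N P F G H where s_eq: "s = (M, N, P, F, G, H)" by (cases s)
  obtain m c \<phi> p where *: "M \<in> \<Z>" "N \<in> \<Z>" "P \<in> \<Z>" "(M, N, P, m, c, \<phi>) \<in> \<Sigma>"
    "p \<in> Arr C" "Dom C p = P" "Cod C p = sig K M" "F = cls C \<D> m" "G = cls C \<D> c" "H = cls C \<D> p"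
    using s unfolding s_eq by (rule standardE)
  then show "s \<in> sextuples Q \<sigma>"
    using triangle_typing[OF *(4)] by (simp add: s_eq sextuples_def Hom_iff)
qed

lemma standard_Ident:
  assumes "A \<in> \<Z>"
  shows "\<exists>Z. is_zero_object Q Z \<and> (Z, A, A, Zero Q Z A, Ident Q A, Zero Q A (omap \<sigma> Z)) \<in> standard"
proof -
  obtain Z where Z: "is_zero_object C Z" "Z \<in> \<Z>"
    using zero_object_in_subcategory subcat_Z by metis
  have z: "Z \<in> Obj C" "Ident C Z = Zero C Z Z"
    using Z by (auto simp: zero_object_iff)
  have "is_zero_object Q Z"
    using Z z by (simp add: Q.zero_object_iff)
  moreover have "monic_wrt C \<D> (Zero C Z A)"
  proof (rule monic_wrtI)
    fix u
    assume u: "u \<in> Arr C" "Dom C u = Dom C (Zero C Z A)" "Cod C u \<in> \<D>"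
    then have "u = Zero C A (Cod C u) \<cdot> Zero C Z A"
      using zero_object_arrows(1)[OF Z(1), of u] assms z by simp
    then show "\<exists>w\<in>Arr C. Dom C w = Cod C (Zero C Z A) \<and> Cod C w = Cod C u \<and> u = w \<cdot> Zero C Z A"
      using u assms z by (intro bexI[of _ "Zero C A (Cod C u)"]) auto
  qed (use assms z in simp)
  then have "(Z, A, A, cls C \<D> (Zero C Z A), cls C \<D> (Ident C A), cls C \<D> (Zero C A (sig K Z))) \<in> standard"
    using assms z Z by (intro standardI[OF _ _ triangle_Ident[OF Z(1)]]) auto
  ultimately show ?thesis
    using assms Z by auto
qed

section \<open>Completion, rotation and morphisms of standard triangles\<close>

text \<open>Adding \<open>\<alpha>\<close> as a second component makes any map \<open>\<D>\<close>-monic without changing its class.\<close>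

lemma monic_replacement:
  assumes "f \<in> Arr C" "Dom C f = A" "Cod C f = B" "A \<in> \<Z>" "B \<in> \<Z>"
  obtains S i p a where "S \<in> \<Z>" "i \<in> Arr C" "Dom C i = B" "Cod C i = S" "p \<in> Arr C" "Dom C p = S"
    "Cod C p = B" "p \<cdot> i = Ident C B" "is_iso Q (cls C \<D> i)" "a \<in> Arr C" "Dom C a = A" "Cod C a = S"
    "monic_wrt C \<D> a" "cls C \<D> a = cls C \<D> (i \<cdot> f)"
proof -
  obtain S i p j q where b: "biproduct B (mid K A) S i p j q"
    by (rule biproduct_exists[OF Z_Obj[OF assms(5)] fixed_typing(10)[OF assms(4)]])
  note t = biproduct_typing[OF b] and e = biproduct_eqs[OF b]
  have S: "S \<in> \<Z>"
    using subcategory_biproduct[OF subcat_Z b] assms by simp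
  define a where "a = Add C (i \<cdot> f) (j \<cdot> alpha K A)"
  have a: "a \<in> Arr C" "Dom C a = A" "Cod C a = S" "q \<cdot> a = alpha K A"
    using t assms by (auto simp: a_def e(1-4)[THEN Comp_reassoc])
  have "monic_wrt C \<D> a"
  proof (rule monic_wrtI)
    fix u
    assume u: "u \<in> Arr C" "Dom C u = Dom C a" "Cod C u \<in> \<D>"
    \<comment> \<open>Since q a = \<open>alpha K A\<close>, it is enough to extend u along
      \<open>alpha K A\<close> and ignore the summand B.\<close>
    obtain w where w: "w \<in> Arr C" "Dom C w = mid K A" "Cod C w = Cod C u" "w \<cdot> alpha K A = u"
      by (rule monic_wrtE[OF alpha_monic[OF assms(4)] u(1)]) (use u a assms in auto)
    then show "\<exists>w\<in>Arr C. Dom C w = Cod C a \<and> Cod C w = Cod C u \<and> u = w \<cdot> a"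
      using t a by (intro bexI[of _ "w \<cdot> q"]) auto
  qed (fact a(1))
  moreover have "cls C \<D> a = cls C \<D> (i \<cdot> f)"
    by (rule cls_eqI[of _ _ "alpha K A" j]) (use t a assms in \<open>auto simp: a_def\<close>)
  ultimately show thesis
    using that[of S i p a] S t a e cls_projection_iso(2)[OF b assms(5)] assms by simp
qed

lemma standard_completion:
  assumes "F \<in> Hom Q A B"
  shows "\<exists>B' X u g h. u \<in> Hom Q B B' \<and> is_iso Q u \<and> (A, B', X, u \<cdot>\<^bsub>Q\<^esub> F, g, h) \<in> standard"
proof -
  obtain f where f: "f \<in> Arr C" "Dom C f = A" "Cod C f = B" "A \<in> \<Z>" "B \<in> \<Z>" "F = cls C \<D> f"
    using assms by (rule Hom_QE)
  obtain S i p a where a: "S \<in> \<Z>" "i \<in> Arr C" "Dom C i = B" "Cod C i = S" "is_iso Q (cls C \<D> i)"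
    "a \<in> Arr C" "Dom C a = A" "Cod C a = S" "monic_wrt C \<D> a" "cls C \<D> a = cls C \<D> (i \<cdot> f)"
    by (rule monic_replacement[OF f(1-5)])
  obtain X c p where "(A, S, X, cls C \<D> a, cls C \<D> c, cls C \<D> p) \<in> standard"
    using standard_exists[OF a(6-8) f(4) a(1) a(9)] by blast
  then have "(A, S, X, cls C \<D> i \<cdot>\<^bsub>Q\<^esub> F, cls C \<D> c, cls C \<D> p) \<in> standard"
    using a f by simp
  moreover have "cls C \<D> i \<in> Hom Q B S"
    using a f by (simp add: Hom_iff)
  ultimately show ?thesis
    using a(5) by blast
qed

text \<open>
  The octahedron on \<open>N \<rightarrow> P \<oplus> D\<^sub>M \<rightarrow> P\<close> identifies the cone \<open>R\<close> of the first map with \<open>\<sigma>M\<close>.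
\<close>

lemma standard_rotate:
  assumes "(M, N, P, F, G, H) \<in> standard"
  shows "(N, P, omap \<sigma> M, G, H, Neg Q (amap \<sigma> F)) \<in> quotient_triangles C T \<Sigma> \<Z> \<D> K"
proof -
  obtain m c \<phi> p where Z: "M \<in> \<Z>" "N \<in> \<Z>" "P \<in> \<Z>" and tri: "(M, N, P, m, c, \<phi>) \<in> \<Sigma>"
    and m: "monic_wrt C \<D> m"
    and p: "p \<in> Arr C" "Dom C p = P" "Cod C p = sig K M" "gamma K M \<cdot> p = \<phi>"
    and FGH: "F = cls C \<D> m" "G = cls C \<D> c" "H = cls C \<D> p"
    using assms by (rule standardE)
  note t = triangle_typing[OF tri] and z = triangle_comp_zero[OF tri]
  obtain n where n: "n \<in> Arr C" "Dom C n = N" "Cod C n = mid K M" "n \<cdot> m = alpha K M"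
    by (rule monic_wrtE[OF m, of "alpha K M"]) (use Z t in auto)
  obtain S i r j q where b: "biproduct P (mid K M) S i r j q"
    by (rule biproduct_exists[OF Z_Obj[OF Z(3)] fixed_typing(10)[OF Z(1)]])
  note t = t biproduct_typing[OF b] and e = biproduct_eqs[OF b]
  have S: "S \<in> \<Z>"
    using subcategory_biproduct[OF subcat_Z b] Z by simp
  \<comment> \<open>c alone need not be \<D>-monic. The second component is n rather than the left
    approximation of N, because then a m = j \<alpha>, which is what links the cone of a to
    \<sigma>M.\<close>
  define a where "a = Add C (i \<cdot> c) (j \<cdot> n)"
  have a: "a \<in> Arr C" "Dom C a = N" "Cod C a = S" and ra: "r \<cdot> a = c" and qa: "q \<cdot> a = n"
    and am: "a \<cdot> m = j \<cdot> alpha K M"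
    using t n Z by (auto simp: a_def e(1-4)[THEN Comp_reassoc] z)
  have monic_a: "monic_wrt C \<D> a"
  proof (rule monic_wrtI)
    fix u
    assume u: "u \<in> Arr C" "Dom C u = Dom C a" "Cod C u \<in> \<D>"
    \<comment> \<open>u m extends along \<alpha> to v; the difference u - v n kills m and hence
      factors through c. The two pieces together extend u along a = (c, n).\<close>
    obtain v where v: "v \<in> Arr C" "Dom C v = mid K M" "Cod C v = Cod C u" "v \<cdot> alpha K M = u \<cdot> m"
      by (rule monic_wrtE[OF alpha_monic[OF Z(1)], of "u \<cdot> m"]) (use u a t Z in auto)
    have "Add C u (Neg C (v \<cdot> n)) \<cdot> m = Zero C M (Cod C u)"
      using u v n t a by simp
    then obtain w where w: "w \<in> Hom C P (Cod C u)" "Add C u (Neg C (v \<cdot> n)) = w \<cdot> c"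
      using weak_cokernel_1[OF tri, of "Add C u (Neg C (v \<cdot> n))" "Cod C u"] u v n a
      by (auto simp: Hom_iff)
    have "Add C (w \<cdot> r) (v \<cdot> q) \<cdot> a = Add C (w \<cdot> c) (v \<cdot> n)"
      using w(1) v t a by (auto simp: Hom_iff ra qa)
    also have "\<dots> = u"
      unfolding w(2)[symmetric] using u v n a by (simp add: Add_assoc)
    finally show "\<exists>w\<in>Arr C. Dom C w = Cod C a \<and> Cod C w = Cod C u \<and> u = w \<cdot> a"
      using w(1) v t a by (intro bexI[of _ "Add C (w \<cdot> r) (v \<cdot> q)"]) (auto simp: Hom_iff)
  qed (fact a(1))
  obtain R b' \<psi> \<tau> where R: "R \<in> \<Z>" and tri': "(N, S, R, a, b', \<psi>) \<in> \<Sigma>"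
    and \<tau>: "\<tau> \<in> Arr C" "Dom C \<tau> = R" "Cod C \<tau> = sig K N" "gamma K N \<cdot> \<tau> = \<psi>"
    and std: "(N, S, R, cls C \<D> a, cls C \<D> b', cls C \<D> \<tau>) \<in> standard"
    using standard_exists[OF a Z(2) S monic_a] .
  note t = t triangle_typing(2,3,6-9,12)[OF tri']
  \<comment> \<open>Since r a = c, the rotation of the given triangle is the triangle on the
    composite in the octahedron for a and r.\<close>
  have rot: "(N, P, omap T M, r \<cdot> a, \<phi>, Neg C (amap T m)) \<in> \<Sigma>"
    using triangle_rotate[OF tri] ra by simp
  obtain l i' where l: "l \<in> Arr C" "Dom C l = R" "Cod C l = omap T M"
    and i': "i' \<in> Arr C" "Dom C i' = omap T M" "Cod C i' = omap T (mid K M)"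
    and lb: "l \<cdot> b' = \<phi> \<cdot> r" and ml: "Neg C (amap T m) \<cdot> l = \<psi>"
    and ji: "Neg C (amap T j) \<cdot> i' = amap T a \<cdot> Neg C (amap T m)"
    and oct: "(R, omap T M, omap T (mid K M), l, i', amap T b' \<cdot> Neg C (amap T j)) \<in> \<Sigma>"
    using TR5[OF tri' triangle_rotate[OF split_triangle[OF biproduct_sym[OF b]]] rot]
    unfolding Hom_iff by blast
  \<comment> \<open>T j has the left inverse T q, so the octahedral identity for T j i' determines
    i' as T \<alpha>.\<close>
  have Tqj: "amap T q \<cdot> amap T j = Ident C (omap T (mid K M))"
    using t e(2) Z by (metis amap_Comp' amap_Ident)
  have "amap T (a \<cdot> m) = amap T (j \<cdot> alpha K M)"
    using am by simp
  then have "amap T a \<cdot> amap T m = amap T j \<cdot> amap T (alpha K M)"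
    using a t Z by simp
  then have "Neg C (amap T j \<cdot> i') = Neg C (amap T j \<cdot> amap T (alpha K M))"
    using ji i' t a Z by simp
  then have "amap T j \<cdot> i' = amap T j \<cdot> amap T (alpha K M)"
    by (rule Neg_inject) (use i' t Z in auto)
  then have "amap T q \<cdot> (amap T j \<cdot> i') = amap T q \<cdot> (amap T j \<cdot> amap T (alpha K M))"
    by simp
  then have i'_eq: "i' = amap T (alpha K M)"
    using i' t Z by (simp add: Comp_reassoc[OF Tqj])
  \<comment> \<open>The octahedral triangle R -> TM is rotated back twice. Here its last morphism is
    - T (b' j).\<close>
  have tri_R: "(mid K M, R, omap T M, b' \<cdot> j, l, i') \<in> \<Sigma>"
    by (rule unrotate) (use oct l i' t in \<open>auto simp: Hom_iff\<close>)
  \<comment> \<open>In the second step i' = T \<alpha> has to be read as - T (- \<alpha>), which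
    leaves a sign on the first morphism.\<close>
  have "(M, mid K M, R, Neg C (alpha K M), b' \<cdot> j, l) \<in> \<Sigma>"
    by (rule unrotate) (use tri_R l i'_eq t Z in \<open>auto simp: Hom_iff\<close>)
  \<comment> \<open>The sign is absorbed by -1 on \<open>mid K M\<close>. The first component stays
    the identity, so the comparison x satisfies l x = \<open>gamma K M\<close>.\<close>
  moreover have "is_iso C (Neg C (Ident C (mid K M)))"
    by (rule is_isoI[of _ "mid K M" "mid K M" "Neg C (Ident C (mid K M))"]) (use Z in \<open>auto simp: Hom_iff\<close>)
  ultimately obtain x where "is_iso C x" "sextuple_morphism C T
      (M, mid K M, sig K M, alpha K M, beta K M, gamma K M) (M, mid K M, R, Neg C (alpha K M), b' \<cdot> j, l)
      (Ident C M, Neg C (Ident C (mid K M)), x)"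
    using triangle_morphism_iso[OF fixed_in(1)[OF Z(1)], of M "mid K M" R "Neg C (alpha K M)" "b' \<cdot> j" l
        "Ident C M" "Neg C (Ident C (mid K M))"] Z
    by (auto simp: Hom_iff)
  then have x: "x \<in> Hom C (sig K M) R" "is_iso C x" "l \<cdot> x = gamma K M"
    using Z by (auto simp: Hom_iff)
  obtain k where k: "k \<in> Arr C" "Dom C k = R" "Cod C k = sig K M"
    and kx: "k \<cdot> x = Ident C (sig K M)" "x \<cdot> k = Ident C R"
    using is_isoE[OF x(2,1)] unfolding Hom_iff by metis
  have "gamma K M \<cdot> k = (l \<cdot> x) \<cdot> k"
    using x by simp
  also have "\<dots> = l"
    using x(1) k kx l by (auto simp: Hom_iff)
  finally have gk: "gamma K M \<cdot> k = l" .
  obtain m' where m': "m' \<in> Arr C" "Dom C m' = sig K M" "Cod C m' = sig K N"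
    "gamma K N \<cdot> m' = amap T m \<cdot> gamma K M" "amap \<sigma> F = cls C \<D> m'"
    using sigma_lift[of m] t Z FGH by auto
  have "cls C \<D> (k \<cdot> b') = cls C \<D> (p \<cdot> r)"
    by (rule sig_cls_unique[OF Z(1)])
      (use k p t Z lb in \<open>auto simp: Comp_reassoc[OF gk] Comp_reassoc[OF p(4)]\<close>)
  \<comment> \<open>After \<open>gamma K N\<close> both sides are - T m l; the sign of TR(3) in the
    original category becomes the sign required in the quotient.\<close>
  moreover have "cls C \<D> \<tau> = cls C \<D> (Neg C (m' \<cdot> k))"
    by (rule sig_cls_unique[OF Z(2)])
      (use \<tau> m'(1-3) k t Z ml l in \<open>auto simp: Comp_reassoc[OF m'(4)] gk\<close>)
  moreover have "amap \<sigma> (cls C \<D> (Ident C N)) = cls C \<D> (Ident C (sig K N))"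
    using Q.amap_Ident[of N] Z by simp
  ultimately have "sextuple_morphism Q \<sigma> (N, S, R, cls C \<D> a, cls C \<D> b', cls C \<D> \<tau>)
      (N, P, omap \<sigma> M, G, H, Neg Q (amap \<sigma> F)) (Ident Q N, cls C \<D> r, cls C \<D> k)"
    using t a k p(1-3) m'(1-3) \<tau>(1-3) Z S R ra by (simp add: FGH(2,3) m'(5) Hom_iff)
  moreover have "is_iso Q (Ident Q N)"
    using Z Q.is_iso_Ident[of N] by simp
  moreover have "is_iso Q (cls C \<D> r)"
    using cls_projection_iso(1)[OF b] Z by simp
  moreover have "is_iso Q (cls C \<D> k)"
    by (rule cls_iso[of _ R "sig K M" x]) (use k kx x Z R in \<open>auto simp: Hom_iff\<close>)
  ultimately have "sextuple_isomorphic Q \<sigma> (N, S, R, cls C \<D> a, cls C \<D> b', cls C \<D> \<tau>)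
      (N, P, omap \<sigma> M, G, H, Neg Q (amap \<sigma> F))"
    unfolding sextuple_isomorphic_def by blast
  moreover have "(N, P, omap \<sigma> M, G, H, Neg Q (amap \<sigma> F)) \<in> sextuples Q \<sigma>"
    using t p m' Z by (simp add: sextuples_def FGH(2,3) m'(5) Hom_iff)
  ultimately show ?thesis
    unfolding quotient_triangles_def using std by blast
qed

text \<open>Representatives commute only up to an error v u through \<D>. After b has been changed
  within its class they commute strictly, and TR(4) of the original category applies.\<close>

lemma standard_morphism:
  assumes "(A, B, X, F, G, H) \<in> standard" "(A', B', X', F', G', H') \<in> standard"
    "U \<in> Hom Q A A'" "V \<in> Hom Q B B'" "V \<cdot>\<^bsub>Q\<^esub> F = F' \<cdot>\<^bsub>Q\<^esub> U"
  shows "\<exists>W. sextuple_morphism Q \<sigma> (A, B, X, F, G, H) (A', B', X', F', G', H') (U, V, W)"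
proof -
  obtain m c \<phi> p where Z: "A \<in> \<Z>" "B \<in> \<Z>" "X \<in> \<Z>" and tri: "(A, B, X, m, c, \<phi>) \<in> \<Sigma>"
    and m: "monic_wrt C \<D> m"
    and p: "p \<in> Arr C" "Dom C p = X" "Cod C p = sig K A" "gamma K A \<cdot> p = \<phi>"
    and FGH: "F = cls C \<D> m" "G = cls C \<D> c" "H = cls C \<D> p"
    using assms(1) by (rule standardE)
  obtain m' c' \<phi>' p' where Z': "A' \<in> \<Z>" "B' \<in> \<Z>" "X' \<in> \<Z>" and tri': "(A', B', X', m', c', \<phi>') \<in> \<Sigma>"
    and p': "p' \<in> Arr C" "Dom C p' = X'" "Cod C p' = sig K A'" "gamma K A' \<cdot> p' = \<phi>'"
    and FGH': "F' = cls C \<D> m'" "G' = cls C \<D> c'" "H' = cls C \<D> p'"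
    using assms(2) by (rule standardE)
  note t = triangle_typing[OF tri] triangle_typing[OF tri']
  obtain a where a: "a \<in> Arr C" "Dom C a = A" "Cod C a = A'" "U = cls C \<D> a"
    using assms(3) by (rule Hom_QE)
  obtain b where b: "b \<in> Arr C" "Dom C b = B" "Cod C b = B'" "V = cls C \<D> b"
    using assms(4) by (rule Hom_QE)
  have "cls C \<D> (b \<cdot> m) = cls C \<D> (m' \<cdot> a)"
    using assms(5) t a b unfolding FGH FGH' by simp
  then obtain u v where uv: "u \<in> Arr C" "v \<in> Arr C" "Cod C u \<in> \<D>" "Dom C v = Cod C u" "Dom C u = A"
    "Cod C v = B'" "b \<cdot> m = Add C (m' \<cdot> a) (v \<cdot> u)"
    using cls_eqE[of "b \<cdot> m" "m' \<cdot> a"] t a b by (auto simp del: Comp_Q)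
  obtain x where x: "x \<in> Arr C" "Dom C x = B" "Cod C x = Cod C u" "x \<cdot> m = u"
    using monic_wrtE[OF m uv(1)] uv t by metis
  \<comment> \<open>As m is \<D>-monic, u = x m; subtracting v x from b therefore removes exactly
    the error v u.\<close>
  define b0 where "b0 = Add C b (Neg C (v \<cdot> x))"
  have b0: "b0 \<in> Arr C" "Dom C b0 = B" "Cod C b0 = B'"
    using b uv x by (auto simp: b0_def)
  have "b0 \<cdot> m = Add C (b \<cdot> m) (Neg C (v \<cdot> u))"
    using b uv(1-6) x t by (auto simp: b0_def)
  also have "\<dots> = m' \<cdot> a"
    unfolding uv(7) using uv(1-6) t a by (simp add: Add_assoc)
  finally have b0m: "b0 \<cdot> m = m' \<cdot> a" .
  have "b = Add C b0 (v \<cdot> x)"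
    using b uv(1-6) x by (simp add: b0_def Add_assoc)
  then have cls_b: "cls C \<D> b = cls C \<D> b0"
    by (intro cls_eqI[of _ _ x v]) (use b b0 uv(1-6) x in auto)
  obtain d where d: "d \<in> Arr C" "Dom C d = X" "Cod C d = X'" "d \<cdot> c = c' \<cdot> b0" "amap T a \<cdot> \<phi> = \<phi>' \<cdot> d"
    using triangle_morphism[OF tri tri', of a b0] a b0 b0m by (auto simp: Hom_iff)
  obtain a' where a': "a' \<in> Arr C" "Dom C a' = sig K A" "Cod C a' = sig K A'"
    "gamma K A' \<cdot> a' = amap T a \<cdot> gamma K A" "amap \<sigma> U = cls C \<D> a'"
    using sigma_lift[of a] a Z Z' by auto
  \<comment> \<open>The third square ends in \<sigma>A', so it is enough that it commutes after
    \<open>gamma K A'\<close>, which is the third square of the strict morphism.\<close>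
  have "cls C \<D> (a' \<cdot> p) = cls C \<D> (p' \<cdot> d)"
    by (rule sig_cls_unique[OF Z'(1)])
      (use a a'(1-3) p p' d t Z Z' in \<open>auto simp: Comp_reassoc[OF a'(4)] Comp_reassoc[OF p'(4)]\<close>)
  moreover have "cls C \<D> (d \<cdot> c) = cls C \<D> (c' \<cdot> b)"
    unfolding d(4) using b b0 t by (intro cls_Comp_cong) (auto simp: cls_b)
  ultimately have "sextuple_morphism Q \<sigma> (A, B, X, F, G, H) (A', B', X', F', G', H') (U, V, cls C \<D> d)"
    using assms(3-5) a' p p' d(1-3) t b Z Z'
    by (simp add: FGH(2,3) FGH'(2,3) b(4) a'(5) Hom_iff)
  then show ?thesis ..
qed

lemma right_pretriangulated_Q: "right_pretriangulated Q \<sigma> (quotient_triangles C T \<Sigma> \<Z> \<D> K)"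
proof (rule Q.right_pretriangulated_iso_closure[of _ standard])
  show "quotient_triangles C T \<Sigma> \<Z> \<D> K =
      {s \<in> sextuples Q \<sigma>. \<exists>s0\<in>standard. sextuple_isomorphic Q \<sigma> s0 s}"
    by (rule quotient_triangles_def)
qed (use standard_sextuples standard_Ident standard_completion standard_rotate standard_morphism
  in \<open>simp_all del: Comp_Q\<close>)

lemma standard_subset: "standard \<subseteq> quotient_triangles C T \<Sigma> \<Z> \<D> K"
  unfolding quotient_triangles_def using standard_sextuples Q.sextuple_isomorphic_refl by blast

section \<open>The octahedral axiom\<close>

text \<open>This makes the fourth triangle of the octahedron standard. For u from Z into \<D>, u b
  extends along d to v; v kills d a and so equals w g. Then u - w l kills b, hence equals x c = x h
  l, and u = (x h + w) l.\<close>

lemma octahedron_monic: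
  assumes 1: "(X, Y, Z, a, b, c) \<in> \<Sigma>" and 2: "(Y, U, V, d, e, f) \<in> \<Sigma>"
    and 3: "(X, U, W, d \<cdot> a, g, h) \<in> \<Sigma>" and d: "monic_wrt C \<D> d"
    and l: "l \<in> Arr C" "Dom C l = Z" "Cod C l = W" "l \<cdot> b = g \<cdot> d" "h \<cdot> l = c"
  shows "monic_wrt C \<D> l"
proof (rule monic_wrtI)
  note t = triangle_typing[OF 1] triangle_typing[OF 2] triangle_typing(2,3,6-9,12)[OF 3]
  fix u
  assume u: "u \<in> Arr C" "Dom C u = Dom C l" "Cod C u \<in> \<D>"
  obtain v where v: "v \<in> Arr C" "Dom C v = U" "Cod C v = Cod C u" "v \<cdot> d = u \<cdot> b"
    by (rule monic_wrtE[OF d, of "u \<cdot> b"]) (use u l t in auto)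
  have "v \<cdot> (d \<cdot> a) = u \<cdot> (b \<cdot> a)"
    using v u l t by (simp add: Comp_reassoc[OF v(4)])
  then have "v \<cdot> (d \<cdot> a) = Zero C X (Cod C u)"
    using triangle_comp_zero(1)[OF 1] u l t by simp
  then obtain w where w: "w \<in> Hom C W (Cod C u)" "v = w \<cdot> g"
    using weak_cokernel_1[OF 3, of v "Cod C u"] v by (auto simp: Hom_iff)
  have "w \<cdot> (l \<cdot> b) = u \<cdot> b"
    unfolding l(4) v(4)[symmetric] w(2) using w(1) t by (auto simp: Hom_iff)
  then have "Add C u (Neg C (w \<cdot> l)) \<cdot> b = Zero C Y (Cod C u)"
    using w(1) u l t by (auto simp: Hom_iff)
  then obtain x where x: "x \<in> Hom C (omap T X) (Cod C u)" "Add C u (Neg C (w \<cdot> l)) = x \<cdot> c"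
    using weak_cokernel_2[OF 1, of "Add C u (Neg C (w \<cdot> l))" "Cod C u"] w(1) u l
    by (auto simp: Hom_iff)
  have "Add C (x \<cdot> h) w \<cdot> l = Add C (x \<cdot> c) (w \<cdot> l)"
    using x(1) w(1) l t by (auto simp: Hom_iff)
  also have "\<dots> = u"
    unfolding x(2)[symmetric] using u w(1) l by (auto simp: Hom_iff Add_assoc)
  finally show "\<exists>w\<in>Arr C. Dom C w = Cod C l \<and> Cod C w = Cod C u \<and> u = w \<cdot> l"
    using x(1) w(1) l t by (intro bexI[of _ "Add C (x \<cdot> h) w"]) (auto simp: Hom_iff)
qed (fact l(1))

text \<open>With strict \<D>-monic representatives a, d and d a all three triangles are standard,
  and TR(5) is applied to them directly. Only identities with target \<sigma>X or \<sigma>Y' still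
  need uniqueness modulo [\<D>].\<close>

lemma octahedron_Q:
  assumes "F \<in> Hom Q X Y" "G \<in> Hom Q Y U"
  shows "\<exists>Y' U' y u d' Z b c V e f W g h l i.
      y \<in> Hom Q Y Y' \<and> is_iso Q y \<and> u \<in> Hom Q U U' \<and> is_iso Q u \<and> d' \<cdot>\<^bsub>Q\<^esub> y = u \<cdot>\<^bsub>Q\<^esub> G \<and>
      (X, Y', Z, y \<cdot>\<^bsub>Q\<^esub> F, b, c) \<in> standard \<and> (Y', U', V, d', e, f) \<in> standard \<and>
      (X, U', W, d' \<cdot>\<^bsub>Q\<^esub> (y \<cdot>\<^bsub>Q\<^esub> F), g, h) \<in> standard \<and> l \<in> Hom Q Z W \<and> i \<in> Hom Q W V \<and>
      l \<cdot>\<^bsub>Q\<^esub> b = g \<cdot>\<^bsub>Q\<^esub> d' \<and> h \<cdot>\<^bsub>Q\<^esub> l = c \<and> i \<cdot>\<^bsub>Q\<^esub> g = e \<and>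
      f \<cdot>\<^bsub>Q\<^esub> i = amap \<sigma> (y \<cdot>\<^bsub>Q\<^esub> F) \<cdot>\<^bsub>Q\<^esub> h \<and> (Z, W, V, l, i, amap \<sigma> b \<cdot>\<^bsub>Q\<^esub> f) \<in> standard"
proof -
  obtain a0 where a0: "a0 \<in> Arr C" "Dom C a0 = X" "Cod C a0 = Y" "X \<in> \<Z>" "Y \<in> \<Z>" "F = cls C \<D> a0"
    using assms(1) by (rule Hom_QE)
  obtain d0 where d0: "d0 \<in> Arr C" "Dom C d0 = Y" "Cod C d0 = U" "Y \<in> \<Z>" "U \<in> \<Z>" "G = cls C \<D> d0"
    using assms(2) by (rule Hom_QE)
  obtain Y' y y' a where y: "Y' \<in> \<Z>" "y \<in> Arr C" "Dom C y = Y" "Cod C y = Y'" "y' \<in> Arr C"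
    "Dom C y' = Y'" "Cod C y' = Y" "y' \<cdot> y = Ident C Y" "is_iso Q (cls C \<D> y)"
    and a: "a \<in> Arr C" "Dom C a = X" "Cod C a = Y'" "monic_wrt C \<D> a" "cls C \<D> a = cls C \<D> (y \<cdot> a0)"
    by (rule monic_replacement[OF a0(1-5)])
  \<comment> \<open>The second morphism must start at the enlarged object Y'; the retraction y'
    extends d0 to it.\<close>
  have "d0 \<cdot> y' \<in> Arr C" "Dom C (d0 \<cdot> y') = Y'" "Cod C (d0 \<cdot> y') = U"
    using y d0 by auto
  from monic_replacement[OF this y(1) d0(5)] obtain U' u u' d where u: "U' \<in> \<Z>" "u \<in> Arr C" "Dom C u = U" "Cod C u = U'"
    "is_iso Q (cls C \<D> u)"
    and d: "d \<in> Arr C" "Dom C d = Y'" "Cod C d = U'" "monic_wrt C \<D> d"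
      "cls C \<D> d = cls C \<D> (u \<cdot> (d0 \<cdot> y'))"
    by metis
  have "cls C \<D> (d \<cdot> y) = cls C \<D> ((u \<cdot> (d0 \<cdot> y')) \<cdot> y)"
    by (rule cls_Comp_cong) (use d y u d0 in auto)
  then have dy: "cls C \<D> (d \<cdot> y) = cls C \<D> (u \<cdot> d0)"
    using y u d0 by simp
  have da: "monic_wrt C \<D> (d \<cdot> a)"
  proof (rule monic_wrtI)
    fix v
    assume v: "v \<in> Arr C" "Dom C v = Dom C (d \<cdot> a)" "Cod C v \<in> \<D>"
    obtain w where w: "w \<in> Arr C" "Dom C w = Y'" "Cod C w = Cod C v" "w \<cdot> a = v"
      using monic_wrtE[OF a(4) v(1)] v a d by auto
    obtain x where x: "x \<in> Arr C" "Dom C x = U'" "Cod C x = Cod C v" "x \<cdot> d = w"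
      using monic_wrtE[OF d(4) w(1)] w v d by auto
    show "\<exists>w\<in>Arr C. Dom C w = Cod C (d \<cdot> a) \<and> Cod C w = Cod C v \<and> v = w \<cdot> (d \<cdot> a)"
      using w x a d by (intro bexI[of _ x]) (auto simp: Comp_reassoc[OF x(4)])
  qed (use a d in simp)
  obtain Z b c0 c where 1: "Z \<in> \<Z>" "(X, Y', Z, a, b, c0) \<in> \<Sigma>" "c \<in> Arr C" "Dom C c = Z"
    "Cod C c = sig K X" "gamma K X \<cdot> c = c0"
    and s1: "(X, Y', Z, cls C \<D> a, cls C \<D> b, cls C \<D> c) \<in> standard"
    by (rule standard_exists[OF a(1-3) a0(4) y(1) a(4)])
  obtain V e f0 f where 2: "V \<in> \<Z>" "(Y', U', V, d, e, f0) \<in> \<Sigma>" "f \<in> Arr C" "Dom C f = V"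
    "Cod C f = sig K Y'" "gamma K Y' \<cdot> f = f0"
    and s2: "(Y', U', V, cls C \<D> d, cls C \<D> e, cls C \<D> f) \<in> standard"
    by (rule standard_exists[OF d(1-3) y(1) u(1) d(4)])
  have "d \<cdot> a \<in> Arr C" "Dom C (d \<cdot> a) = X" "Cod C (d \<cdot> a) = U'"
    using a d by auto
  then obtain W g h0 h where 3: "W \<in> \<Z>" "(X, U', W, d \<cdot> a, g, h0) \<in> \<Sigma>" "h \<in> Arr C" "Dom C h = W"
    "Cod C h = sig K X" "gamma K X \<cdot> h = h0"
    and s3: "(X, U', W, cls C \<D> (d \<cdot> a), cls C \<D> g, cls C \<D> h) \<in> standard"
    by (rule standard_exists[OF _ _ _ a0(4) u(1) da])
  note t = triangle_typing[OF 1(2)] triangle_typing[OF 2(2)] triangle_typing(2,3,6-9,12)[OF 3(2)]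
  obtain l i where l: "l \<in> Arr C" "Dom C l = Z" "Cod C l = W" "l \<cdot> b = g \<cdot> d" "h0 \<cdot> l = c0"
    and i: "i \<in> Arr C" "Dom C i = W" "Cod C i = V" "i \<cdot> g = e" "f0 \<cdot> i = amap T a \<cdot> h0"
    and tri: "(Z, W, V, l, i, amap T b \<cdot> f0) \<in> \<Sigma>"
    using TR5[OF 1(2) 2(2) 3(2)] unfolding Hom_iff by blast
  have l_monic: "monic_wrt C \<D> l"
    by (rule octahedron_monic[OF 1(2) 2(2) 3(2) d(4) l])
  obtain a' where a': "a' \<in> Arr C" "Dom C a' = sig K X" "Cod C a' = sig K Y'"
    "gamma K Y' \<cdot> a' = amap T a \<cdot> gamma K X" "amap \<sigma> (cls C \<D> a) = cls C \<D> a'"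
    using sigma_lift[of a] a a0 y by auto
  obtain b' where b': "b' \<in> Arr C" "Dom C b' = sig K Y'" "Cod C b' = sig K Z"
    "gamma K Z \<cdot> b' = amap T b \<cdot> gamma K Y'" "amap \<sigma> (cls C \<D> b) = cls C \<D> b'"
    using sigma_lift[of b] t 1 y by auto
  \<comment> \<open>T b f0 is the connecting morphism of the octahedral triangle; it equals
    \<open>gamma K Z\<close> after b' f, so b' f represents the required third morphism.\<close>
  have s4: "(Z, W, V, cls C \<D> l, cls C \<D> i, cls C \<D> (b' \<cdot> f)) \<in> standard"
    by (rule standardI[OF 1(1) 3(1) tri l_monic])
      (use b' 2 t 1(1) y in \<open>auto simp: Comp_reassoc[OF b'(4)]\<close>)
  \<comment> \<open>Both sides end in \<sigma>X, and after \<open>gamma K X\<close> they become the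
    octahedral identity for h0, l and c0.\<close>
  have hl: "cls C \<D> (h \<cdot> l) = cls C \<D> c"
    by (rule sig_cls_unique[OF a0(4)]) (use 1 3 l a0 in \<open>auto simp: Comp_reassoc[OF 3(6)]\<close>)
  have fi: "cls C \<D> (f \<cdot> i) = cls C \<D> (a' \<cdot> h)"
    by (rule sig_cls_unique[OF y(1)])
      (use 2(3-5) 3(3-6) a'(1-3) i(1-3,5) a(1-3) a0(4) y(1) t(22)
        in \<open>simp_all add: Comp_reassoc[OF 2(6)] Comp_reassoc[OF a'(4)]\<close>)
  have yF: "cls C \<D> y \<cdot>\<^bsub>Q\<^esub> F = cls C \<D> a"
    using a0 y a by simp
  show ?thesis
  proof (rule exI[of _ Y'], rule exI[of _ U'], rule exI[of _ "cls C \<D> y"], rule exI[of _ "cls C \<D> u"],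
      rule exI[of _ "cls C \<D> d"], rule exI[of _ Z], rule exI[of _ "cls C \<D> b"],
      rule exI[of _ "cls C \<D> c"], rule exI[of _ V], rule exI[of _ "cls C \<D> e"],
      rule exI[of _ "cls C \<D> f"], rule exI[of _ W], rule exI[of _ "cls C \<D> g"],
      rule exI[of _ "cls C \<D> h"], rule exI[of _ "cls C \<D> l"], rule exI[of _ "cls C \<D> i"],
      unfold yF, intro conjI)
    show "cls C \<D> y \<in> Hom Q Y Y'" "cls C \<D> u \<in> Hom Q U U'" "cls C \<D> l \<in> Hom Q Z W"
      "cls C \<D> i \<in> Hom Q W V"
      using y u l i a0 d0 1(1) 2(1) 3(1) by (auto simp: Hom_iff)
    show "cls C \<D> d \<cdot>\<^bsub>Q\<^esub> cls C \<D> y = cls C \<D> u \<cdot>\<^bsub>Q\<^esub> G"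
      using dy d y u d0 by simp
    show "(X, U', W, cls C \<D> d \<cdot>\<^bsub>Q\<^esub> cls C \<D> a, cls C \<D> g, cls C \<D> h) \<in> standard"
      using s3 a(1-3) d(1-3) by simp
    show "cls C \<D> l \<cdot>\<^bsub>Q\<^esub> cls C \<D> b = cls C \<D> g \<cdot>\<^bsub>Q\<^esub> cls C \<D> d"
      using l t by simp
    show "cls C \<D> h \<cdot>\<^bsub>Q\<^esub> cls C \<D> l = cls C \<D> c"
      using l 3 hl by simp
    show "cls C \<D> i \<cdot>\<^bsub>Q\<^esub> cls C \<D> g = cls C \<D> e"
      using i t by simp
    show "cls C \<D> f \<cdot>\<^bsub>Q\<^esub> cls C \<D> i = amap \<sigma> (cls C \<D> a) \<cdot>\<^bsub>Q\<^esub> cls C \<D> h"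
      using fi 2 3 i a' by simp
    show "(Z, W, V, cls C \<D> l, cls C \<D> i, amap \<sigma> (cls C \<D> b) \<cdot>\<^bsub>Q\<^esub> cls C \<D> f) \<in> standard"
      using s4 b' 2 by simp
  qed (fact y u s1 s2)+
qed

theorem right_triangulated_Q: "right_triangulated Q \<sigma> (quotient_triangles C T \<Sigma> \<Z> \<D> K)"
proof -
  interpret P: right_pretriangulated Q \<sigma> "quotient_triangles C T \<Sigma> \<Z> \<D> K"
    by (rule right_pretriangulated_Q)
  show ?thesis
  proof (rule P.right_triangulated_of_octahedra, goal_cases)
    case (1 X Y U a d)
    then show ?case
      using octahedron_Q[OF 1] standard_subset by (elim exE conjE) (intro exI conjI; blast)
  qed
qed

end

theorem theorem3p9:
  fixes C :: "('o, 'm) precat"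
    and T :: "('o, 'm) endofunctor"
    and \<Sigma> :: "('o, 'm) sextuple set"
    and \<D> \<Z> :: "'o set"
    and K :: "('o, 'm) triangle_choice"
  assumes "right_triangulated C T \<Sigma>"
    and "Krull_Schmidt C"
    and "\<And>A B X f g h. \<lbrakk>f \<in> Hom C A B; g \<in> Hom C B X; h \<in> Hom C X (omap T A);
        (B, X, omap T A, g, h, Neg C (amap T f)) \<in> \<Sigma>\<rbrakk> \<Longrightarrow> (A, B, X, f, g, h) \<in> \<Sigma>"
    and "subcategory C \<D>"
    and "subcategory C \<Z>"
    and "\<D> \<subseteq> \<Z>"
    and "factor_through_epic C T \<D>"
    and "extension_closed \<Sigma> \<Z>"
    and "\<Z> = mu C \<Sigma> \<Z> \<D>"
    and "fixed_triangles C \<Sigma> \<Z> \<D> K"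
  shows "right_triangulated (quotient_cat C \<Z> \<D>) (sigma_functor C T \<D> K)
    (quotient_triangles C T \<Sigma> \<Z> \<D> K)"
proof -
  interpret right_triangulated C T \<Sigma> by (fact assms(1))
  interpret mutation C T \<Sigma> \<Z> \<D> K
    by unfold_locales (fact assms)+
  show ?thesis
    by (rule right_triangulated_Q)
qed

end
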